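(* Let $m\ge2$ and $d\ge1$ be integers, and let $${\rm U}C\ell^{\frac1m}_d:=\{U\in C\ell^{\frac1m}_d:\ \overline{U}U=e\}.$$ Then there is an isomorphism of Lie groups $${\rm U}C\ell^{\frac1m}_d\simeq\begin{cases}{\rm U}(m^{\frac d2}),&\text{if } d \text{ is even};\\ \underbrace{{\rm U}(m^{\frac{d-1}2})\times{\rm U}(m^{\frac{d-1}2})\times\cdots\times{\rm U}(m^{\frac{d-1}2})}_{m\ \text{times}},&\text{if } d\text{ is odd},\end{cases}$$ where ${\rm U}(n)=\{A\in{\rm Mat}(n,\mathbb{C}):A^{\rm H}A=I\}$ is the classical matrix unitary group.
   Context: The generalized Clifford algebra $C\ell^{\frac1m}_d$ is the unital associative algebra over $\mathbb{C}$ with identity $e$ and generators $e_1,\dots,e_d$ subject to $e_j^m=e$ for $j=1,\dots,d$ and $e_ke_l=\omega e_le_k$ for $k<l$, where $\omega:=e^{2\pi i/m}$. It has dimension $m^d$ with basis $e_1^{j_1}\cdots e_d^{j_d}$, $0\le j_1,\dots,j_d\le m-1$ (each basis element is invertible), so each element is uniquely $U=\sum_{j_1,\dots,j_d=0}^{m-1}u_{j_1\ldots j_d}e_1^{j_1}\cdots e_d^{j_d}$ with $u_{j_1\ldots j_d}\in\mathbb{C}$. Hermitian conjugation: $\overline{U}:=\sum_{j_1,\dots,j_d=0}^{m-1}\overline{u_{j_1\ldots j_d}}\,(e_1^{j_1}\cdots e_d^{j_d})^{-1}$, where $\overline{u}$ is complex conjugation for $u\in\mathbb{C}$. *)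

theory Defs
  imports
    "HOL-Analysis.Analysis"
    "HOL-Algebra.Algebra"
    "Jordan_Normal_Form.Schur_Decomposition"
begin

section \<open>Smooth maps between subsets of Euclidean spaces\<close>

text \<open>
  For a finite index set \<open>I\<close>, the space of real vectors indexed by \<open>I\<close> is
  \<^term>\<open>powertop_real I\<close>, whose points are the functions in \<^term>\<open>I \<rightarrow>\<^sub>E (UNIV :: real set)\<close>.
\<close>

primrec Ck_on :: "'i set \<Rightarrow> nat \<Rightarrow> ('i \<Rightarrow> real) set \<Rightarrow> (('i \<Rightarrow> real) \<Rightarrow> real) \<Rightarrow> bool" where
  "Ck_on I 0 U f \<longleftrightarrow> continuous_map (subtopology (powertop_real I) U) euclideanreal f"
| "Ck_on I (Suc k) U f \<longleftrightarrow>
     continuous_map (subtopology (powertop_real I) U) euclideanreal f \<and>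
     (\<forall>i\<in>I. \<exists>g. (\<forall>x\<in>U. ((\<lambda>t. f (x(i := t))) has_real_derivative g x) (at (x i))) \<and>
                Ck_on I k U g)"

definition Cinf_on :: "'i set \<Rightarrow> ('i \<Rightarrow> real) set \<Rightarrow> (('i \<Rightarrow> real) \<Rightarrow> real) \<Rightarrow> bool" where
  "Cinf_on I U f \<longleftrightarrow> (\<forall>k. Ck_on I k U f)"

text \<open>
  A set \<open>S\<close> (of elements of any type) is regarded as a subset of a Euclidean space through
  an injective coordinate map \<open>\<phi>\<close> into the vectors indexed by \<open>I\<close>, and likewise \<open>T\<close> through \<open>\<psi>\<close>
  and \<open>J\<close>. As usual for subsets of Euclidean spaces, a map is smooth if near each point it is
  the restriction of a \<open>C\<^sup>\<infinity>\<close> map defined on an open set of the ambient space.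
\<close>

definition smooth_map ::
  "'a set \<Rightarrow> 'i set \<Rightarrow> ('a \<Rightarrow> 'i \<Rightarrow> real) \<Rightarrow> 'b set \<Rightarrow> 'j set \<Rightarrow> ('b \<Rightarrow> 'j \<Rightarrow> real) \<Rightarrow> ('a \<Rightarrow> 'b) \<Rightarrow> bool"
where
  "smooth_map S I \<phi> T J \<psi> f \<longleftrightarrow>
     f \<in> S \<rightarrow> T \<and>
     (\<forall>x\<in>S. \<exists>U F. openin (powertop_real I) U \<and> \<phi> x \<in> U \<and>
        (\<forall>j\<in>J. Cinf_on I U (\<lambda>u. F u j)) \<and>
        (\<forall>y\<in>S. \<phi> y \<in> U \<longrightarrow> (\<forall>j\<in>J. F (\<phi> y) j = \<psi> (f y) j)))"

definition diffeo ::
  "'a set \<Rightarrow> 'i set \<Rightarrow> ('a \<Rightarrow> 'i \<Rightarrow> real) \<Rightarrow> 'b set \<Rightarrow> 'j set \<Rightarrow> ('b \<Rightarrow> 'j \<Rightarrow> real) \<Rightarrow> ('a \<Rightarrow> 'b) \<Rightarrow> bool"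
where
  "diffeo S I \<phi> T J \<psi> f \<longleftrightarrow>
     bij_betw f S T \<and> smooth_map S I \<phi> T J \<psi> f \<and> smooth_map T J \<psi> S I \<phi> (inv_into S f)"

text \<open>
  The set \<open>S\<close> is an embedded \<open>k\<close>-dimensional submanifold: each of its points has a relatively
  open neighbourhood diffeomorphic to an open subset of \<open>k\<close>-dimensional Euclidean space.
\<close>

definition submanifold :: "nat \<Rightarrow> 'a set \<Rightarrow> 'i set \<Rightarrow> ('a \<Rightarrow> 'i \<Rightarrow> real) \<Rightarrow> bool" where
  "submanifold k S I \<phi> \<longleftrightarrow>
     finite I \<and> \<phi> \<in> S \<rightarrow> (I \<rightarrow>\<^sub>E UNIV) \<and> inj_on \<phi> S \<and>
     (\<forall>x\<in>S. \<exists>W V h. openin (powertop_real I) W \<and> \<phi> x \<in> W \<and>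
        openin (powertop_real {..<k}) V \<and>
        diffeo {y \<in> S. \<phi> y \<in> W} I \<phi> V {..<k} id h)"


section \<open>Lie groups and their isomorphisms\<close>

record ('a, 'i) coord_group = "'a monoid" +
  index :: "'i set"
  coords :: "'a \<Rightarrow> 'i \<Rightarrow> real"

text \<open>
  The product \<open>G \<times> G\<close> is given coordinates in the vectors indexed by \<open>I <+> I\<close>.
\<close>

definition lie_group :: "('a, 'i) coord_group \<Rightarrow> bool" where
  "lie_group G \<longleftrightarrow>
     group G \<and>
     (\<exists>k. submanifold k (carrier G) (index G) (coords G)) \<and>
     smooth_map (carrier G \<times> carrier G) (index G <+> index G)
       (\<lambda>(x, y). case_sum (coords G x) (coords G y))
       (carrier G) (index G) (coords G) (\<lambda>(x, y). x \<otimes>\<^bsub>G\<^esub> y) \<and>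
     smooth_map (carrier G) (index G) (coords G) (carrier G) (index G) (coords G)
       (\<lambda>x. inv\<^bsub>G\<^esub> x)"

definition lie_isomorphic :: "('a, 'i) coord_group \<Rightarrow> ('b, 'j) coord_group \<Rightarrow> bool" where
  "lie_isomorphic G H \<longleftrightarrow>
     lie_group G \<and> lie_group H \<and>
     (\<exists>h \<in> iso G H. diffeo (carrier G) (index G) (coords G) (carrier H) (index H) (coords H) h)"

text \<open>The real coordinates (real and imaginary parts) of a complex vector indexed by \<open>I\<close>.\<close>

definition realify :: "'i set \<Rightarrow> ('i \<Rightarrow> complex) \<Rightarrow> 'i \<times> bool \<Rightarrow> real" where
  "realify I u = (\<lambda>(i, b) \<in> I \<times> UNIV. if b then Im (u i) else Re (u i))"


section \<open>The generalized Clifford algebra\<close>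

text \<open>
  The free unital associative complex algebra on generators numbered \<open>1, \<dots>, d\<close>: finitely
  supported families of complex coefficients indexed by words, multiplied by concatenating words.
\<close>

definition free_algebra :: "nat \<Rightarrow> (nat list \<Rightarrow> complex) ring" where
  "free_algebra d =
     \<lparr>carrier = {f. finite {w. f w \<noteq> 0} \<and> (\<forall>w. f w \<noteq> 0 \<longrightarrow> set w \<subseteq> {1..d})},
      monoid.mult = (\<lambda>f g w. \<Sum>i\<le>length w. f (take i w) * g (drop i w)),
      one = (\<lambda>w. if w = [] then 1 else 0),
      ring.zero = (\<lambda>w. 0),
      ring.add = (\<lambda>f g w. f w + g w)\<rparr>"

definition free_scalar :: "complex \<Rightarrow> nat list \<Rightarrow> complex" where
  "free_scalar c = (\<lambda>w. if w = [] then c else 0)"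

definition free_gen :: "nat \<Rightarrow> nat list \<Rightarrow> complex" where
  "free_gen j = (\<lambda>w. if w = [j] then 1 else 0)"

definition clifford_omega :: "nat \<Rightarrow> complex" where
  "clifford_omega m = exp (2 * of_real pi * \<i> / of_nat m)"

definition clifford_relators :: "nat \<Rightarrow> nat \<Rightarrow> (nat list \<Rightarrow> complex) set" where
  "clifford_relators m d =
     (let F = free_algebra d in
        {(free_gen j [^]\<^bsub>F\<^esub> m) \<ominus>\<^bsub>F\<^esub> \<one>\<^bsub>F\<^esub> | j. j \<in> {1..d}} \<union>
        {(free_gen k \<otimes>\<^bsub>F\<^esub> free_gen l) \<ominus>\<^bsub>F\<^esub>
           (free_scalar (clifford_omega m) \<otimes>\<^bsub>F\<^esub> (free_gen l \<otimes>\<^bsub>F\<^esub> free_gen k)) | k l.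
           k \<in> {1..d} \<and> l \<in> {1..d} \<and> k < l})"

text \<open>
  The complex scalars lie in \<^const>\<open>free_algebra\<close>, so every two-sided ring ideal is a
  linear subspace, and the quotient ring is the quotient algebra, scalar multiplication being
  multiplication by \<open>clifford_scalar\<close>.
\<close>

definition clifford_ideal :: "nat \<Rightarrow> nat \<Rightarrow> (nat list \<Rightarrow> complex) set" where
  "clifford_ideal m d = Idl\<^bsub>free_algebra d\<^esub> (clifford_relators m d)"

definition clifford :: "nat \<Rightarrow> nat \<Rightarrow> (nat list \<Rightarrow> complex) set ring" where
  "clifford m d = free_algebra d Quot clifford_ideal m d"

definition clifford_scalar :: "nat \<Rightarrow> nat \<Rightarrow> complex \<Rightarrow> (nat list \<Rightarrow> complex) set" where
  "clifford_scalar m d c = clifford_ideal m d +>\<^bsub>free_algebra d\<^esub> free_scalar c"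

definition clifford_gen :: "nat \<Rightarrow> nat \<Rightarrow> nat \<Rightarrow> (nat list \<Rightarrow> complex) set" where
  "clifford_gen m d j = clifford_ideal m d +>\<^bsub>free_algebra d\<^esub> free_gen j"

definition multi_indices :: "nat \<Rightarrow> nat \<Rightarrow> (nat \<Rightarrow> nat) set" where
  "multi_indices m d = {1..d} \<rightarrow>\<^sub>E {0..<m}"

text \<open>The basis element \<open>e\<^sub>1\<close> to the power \<open>J 1\<close>, times \dots, times \<open>e\<^sub>d\<close> to the power \<open>J d\<close>.\<close>

definition clifford_monomial :: "nat \<Rightarrow> nat \<Rightarrow> (nat \<Rightarrow> nat) \<Rightarrow> (nat list \<Rightarrow> complex) set" where
  "clifford_monomial m d J =
     foldr (\<lambda>j x. (clifford_gen m d j [^]\<^bsub>clifford m d\<^esub> J j) \<otimes>\<^bsub>clifford m d\<^esub> x)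
       [1..<Suc d] \<one>\<^bsub>clifford m d\<^esub>"

definition clifford_coeffs ::
  "nat \<Rightarrow> nat \<Rightarrow> (nat list \<Rightarrow> complex) set \<Rightarrow> (nat \<Rightarrow> nat) \<Rightarrow> complex"
where
  "clifford_coeffs m d U =
     (THE u. u \<in> multi_indices m d \<rightarrow>\<^sub>E UNIV \<and>
        U = (\<Oplus>\<^bsub>clifford m d\<^esub>J\<in>multi_indices m d.
               clifford_scalar m d (u J) \<otimes>\<^bsub>clifford m d\<^esub> clifford_monomial m d J))"

definition clifford_conj ::
  "nat \<Rightarrow> nat \<Rightarrow> (nat list \<Rightarrow> complex) set \<Rightarrow> (nat list \<Rightarrow> complex) set"
where
  "clifford_conj m d U =
     (\<Oplus>\<^bsub>clifford m d\<^esub>J\<in>multi_indices m d.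
        clifford_scalar m d (cnj (clifford_coeffs m d U J)) \<otimes>\<^bsub>clifford m d\<^esub>
        inv\<^bsub>clifford m d\<^esub> clifford_monomial m d J)"


section \<open>The unitary groups\<close>

definition unitary_clifford ::
  "nat \<Rightarrow> nat \<Rightarrow> ((nat list \<Rightarrow> complex) set, (nat \<Rightarrow> nat) \<times> bool) coord_group"
where
  "unitary_clifford m d =
     \<lparr>carrier = {U \<in> carrier (clifford m d).
                   clifford_conj m d U \<otimes>\<^bsub>clifford m d\<^esub> U = \<one>\<^bsub>clifford m d\<^esub>},
      monoid.mult = monoid.mult (clifford m d),
      one = monoid.one (clifford m d),
      index = multi_indices m d \<times> UNIV,
      coords = (\<lambda>U. realify (multi_indices m d) (clifford_coeffs m d U))\<rparr>"

definition unitary_matrices :: "nat \<Rightarrow> (complex mat, (nat \<times> nat) \<times> bool) coord_group" where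
  "unitary_matrices n =
     \<lparr>carrier = {A \<in> carrier_mat n n. mat_adjoint A * A = 1\<^sub>m n},
      monoid.mult = (*),
      one = 1\<^sub>m n,
      index = ({..<n} \<times> {..<n}) \<times> UNIV,
      coords = (\<lambda>A. realify ({..<n} \<times> {..<n}) (\<lambda>p. A $$ p))\<rparr>"

definition unitary_matrices_power ::
  "nat \<Rightarrow> nat \<Rightarrow> (nat \<Rightarrow> complex mat, (nat \<times> nat \<times> nat) \<times> bool) coord_group"
where
  "unitary_matrices_power r n =
     monoid.extend (product_group {..<r} (\<lambda>_. unitary_matrices n))
       \<lparr>index = ({..<r} \<times> {..<n} \<times> {..<n}) \<times> UNIV,
        coords = (\<lambda>A. realify ({..<r} \<times> {..<n} \<times> {..<n}) (\<lambda>(k, p). A k $$ p))\<rparr>"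

end

theory Submission
  imports Defs
begin

text \<open>
  Unitary matrices satisfying the Clifford relations are built from clock and shift matrices, with
  $m$ blocks when $d$ is odd. The relations and the choice of blocks force distinct monomials to be orthogonal for the trace form,
  and there are as many of them as matrix entries, so they form an orthogonal basis of the (block)
  matrix algebra. Since normal ordering shows that the monomials span the Clifford algebra, the
  representation is an isomorphism of algebras; as it sends monomials to unitary matrices, it turns
  the conjugation into the adjoint. The restriction to the unitary groups is therefore an
  isomorphism that is linear in both directions, hence a diffeomorphism. The manifold structure
  itself comes from the Cayley transform, which maps the unitary matrices near a given one to
  skew-Hermitian matrices by rational functions.
\<close>

section \<open>Smooth functions of real coordinates\<close>

text \<open>Linear independence of the Clifford monomials, and with it the meaning of
  \<open>clifford_coeffs\<close>, is hard to reach inside a quotient of the free algebra: rewriting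
  words would call for a confluence argument. Normal ordering is therefore used for spanning alone,
  with the scalars left unspecified, and independence is read off from the matrices.

  The two parities are handled together: with \<open>n = m ^ (d div 2)\<close> and \<open>r\<close>
  equal to \<open>1\<close> or \<open>m\<close>, the count \<open>r * (n * n) = m ^ d\<close> holds
  in both cases, and tuples of \<open>r\<close> unitary matrices of size \<open>n\<close> are the
  common model. The inductive construction produces an odd number of generators; for even
  \<open>d\<close> the last one is dropped.

  The relations force orthogonality because conjugation by a generator multiplies each monomial by a
  root of unity. For even \<open>d\<close> these roots determine all exponents; for odd
  \<open>d\<close> they do so once the last exponent is known.\<close>

lemma Ck_on_continuous: "Ck_on I k U f \<Longrightarrow> continuous_map (subtopology (powertop_real I) U) euclideanreal f"
  by (cases k) auto

text \<open>Needed because the derivative of a product or of an inverse contains the functions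
  themselves next to their derivatives, so a function given with one order to spare must also be
  usable at the lower order.\<close>

lemma Ck_on_Suc_imp_Ck_on: "Ck_on I (Suc k) U f \<Longrightarrow> Ck_on I k U f"
proof (induction k arbitrary: f)
  case 0
  then show ?case by simp
next
  case (Suc k)
  have "\<exists>g. (\<forall>x\<in>U. ((\<lambda>t. f (x(i := t))) has_real_derivative g x) (at (x i))) \<and> Ck_on I k U g"
    if i: "i \<in> I" for i
  proof -
    obtain g where "\<forall>x\<in>U. ((\<lambda>t. f (x(i := t))) has_real_derivative g x) (at (x i))" "Ck_on I (Suc k) U g"
      using Suc.prems i unfolding Ck_on.simps(2)[of I "Suc k"] by blast
    then show ?thesis using Suc.IH by blast
  qed
  then show ?case using Ck_on_continuous[OF Suc.prems] unfolding Ck_on.simps(2) by blast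
qed

lemma Ck_on_const: "Ck_on I k U (\<lambda>_. c)"
  by (induction k arbitrary: c) (auto intro!: exI[of _ "\<lambda>_. 0"])

lemma Ck_on_coordinate:
  assumes "i \<in> I"
  shows "Ck_on I k U (\<lambda>u. u i)"
proof -
  have c: "continuous_map (subtopology (powertop_real I) U) euclideanreal (\<lambda>u. u i)"
    using assms by (auto intro!: continuous_map_from_subtopology continuous_map_product_projection)
  have d: "((\<lambda>t. (x(j := t)) i) has_real_derivative (if i = j then 1 else 0)) (at (x j))"
    for x :: "'a \<Rightarrow> real" and j
    by (cases "i = j") auto
  show ?thesis
  proof (cases k)
    case (Suc k')
    show ?thesis unfolding Suc Ck_on.simps
      using c d Ck_on_const by (intro conjI ballI) (auto intro!: exI[of _ "\<lambda>_. (if i = _ then 1 else 0)"])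
  qed (use c in simp)
qed

lemma Ck_on_add:
  "Ck_on I k U f \<Longrightarrow> Ck_on I k U g \<Longrightarrow> Ck_on I k U (\<lambda>u. f u + g u)"
proof (induction k arbitrary: f g)
  case 0
  then show ?case by (auto intro: continuous_map_add)
next
  case (Suc k)
  have "\<exists>h. (\<forall>x\<in>U. ((\<lambda>t. f (x(i := t)) + g (x(i := t))) has_real_derivative h x) (at (x i))) \<and> Ck_on I k U h"
    if i: "i \<in> I" for i
  proof -
    from Suc.prems(1) i obtain f' where f:
      "\<forall>x\<in>U. ((\<lambda>t. f (x(i := t))) has_real_derivative f' x) (at (x i))" "Ck_on I k U f'"
      unfolding Ck_on.simps by blast
    from Suc.prems(2) i obtain g' where g:
      "\<forall>x\<in>U. ((\<lambda>t. g (x(i := t))) has_real_derivative g' x) (at (x i))" "Ck_on I k U g'"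
      unfolding Ck_on.simps by blast
    note d = f g
    have "((\<lambda>t. f (x(i := t)) + g (x(i := t))) has_real_derivative f' x + g' x) (at (x i))"
      if "x \<in> U" for x
      using DERIV_add[of "\<lambda>t. f (x(i := t))" "f' x" "x i" UNIV "\<lambda>t. g (x(i := t))" "g' x"] d(1)[rule_format, OF that] d(3)[rule_format, OF that]
      by (simp only:)
    moreover have "Ck_on I k U (\<lambda>x. f' x + g' x)"
      using d by (intro Suc.IH)
    ultimately show ?thesis by (intro exI[of _ "\<lambda>x. f' x + g' x"] conjI ballI)
  qed
  with Suc.prems show ?case unfolding Ck_on.simps by (blast intro: continuous_map_add)
qed

lemma Ck_on_mult:
  "Ck_on I k U f \<Longrightarrow> Ck_on I k U g \<Longrightarrow> Ck_on I k U (\<lambda>u. f u * g u)"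
proof (induction k arbitrary: f g)
  case 0
  then show ?case by (auto intro: continuous_map_real_mult)
next
  case (Suc k)
  have "\<exists>h. (\<forall>x\<in>U. ((\<lambda>t. f (x(i := t)) * g (x(i := t))) has_real_derivative h x) (at (x i))) \<and> Ck_on I k U h"
    if i: "i \<in> I" for i
  proof -
    from Suc.prems(1) i obtain f' where f:
      "\<forall>x\<in>U. ((\<lambda>t. f (x(i := t))) has_real_derivative f' x) (at (x i))" "Ck_on I k U f'"
      unfolding Ck_on.simps by blast
    from Suc.prems(2) i obtain g' where g:
      "\<forall>x\<in>U. ((\<lambda>t. g (x(i := t))) has_real_derivative g' x) (at (x i))" "Ck_on I k U g'"
      unfolding Ck_on.simps by blast
    note d = f g
    have "((\<lambda>t. f (x(i := t)) * g (x(i := t))) has_real_derivative f' x * g x + g' x * f x) (at (x i))"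
      if "x \<in> U" for x
      using DERIV_mult[of "\<lambda>t. f (x(i := t))" "f' x" "x i" UNIV "\<lambda>t. g (x(i := t))" "g' x"] d(1)[rule_format, OF that] d(3)[rule_format, OF that]
      by (simp only: fun_upd_triv)
    moreover have "Ck_on I k U (\<lambda>x. f' x * g x + g' x * f x)"
      using d(2,4) Suc.prems by (intro Ck_on_add Suc.IH) (simp_all only: Ck_on_Suc_imp_Ck_on)
    ultimately show ?thesis by (intro exI[of _ "\<lambda>x. f' x * g x + g' x * f x"] conjI ballI)
  qed
  with Suc.prems show ?case unfolding Ck_on.simps by (blast intro: continuous_map_real_mult)
qed

text \<open>The derivative of 1/f is -f'/f^2. It is written as a product in which
  \<open>inverse (f x)\<close> appears twice, so that the induction hypothesis for the same
  \<open>f\<close> and closure under products suffice.\<close>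

lemma Ck_on_inverse:
  assumes U: "U \<subseteq> topspace (powertop_real I)"
  shows "Ck_on I k U f \<Longrightarrow> (\<And>u. u \<in> U \<Longrightarrow> f u \<noteq> 0) \<Longrightarrow> Ck_on I k U (\<lambda>u. inverse (f u))"
proof (induction k arbitrary: f)
  case 0
  then show ?case by (auto intro: continuous_map_real_inverse)
next
  case (Suc k)
  have "\<exists>h. (\<forall>x\<in>U. ((\<lambda>t. inverse (f (x(i := t)))) has_real_derivative h x) (at (x i))) \<and> Ck_on I k U h"
    if i: "i \<in> I" for i
  proof -
    from Suc.prems(1) i obtain f' where d:
      "\<forall>x\<in>U. ((\<lambda>t. f (x(i := t))) has_real_derivative f' x) (at (x i))" "Ck_on I k U f'"
      unfolding Ck_on.simps by blast
    have "((\<lambda>t. inverse (f (x(i := t)))) has_real_derivative (- 1) * (inverse (f x) * f' x * inverse (f x))) (at (x i))"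
      if "x \<in> U" for x
      using DERIV_inverse'[of "\<lambda>t. f (x(i := t))" "f' x" "x i" UNIV] d(1)[rule_format, OF that] Suc.prems(2)[OF that]
      by (simp only: fun_upd_triv mult_minus1 simp_thms)
    moreover have "Ck_on I k U (\<lambda>x. (- 1) * (inverse (f x) * f' x * inverse (f x)))"
      using d(2) Suc.prems(2) Suc.IH[OF Ck_on_Suc_imp_Ck_on[OF Suc.prems(1)]] by (intro Ck_on_mult Ck_on_const) auto
    ultimately show ?thesis
      by (intro exI[of _ "\<lambda>x. (- 1) * (inverse (f x) * f' x * inverse (f x))"] conjI ballI)
  qed
  moreover have "continuous_map (subtopology (powertop_real I) U) euclideanreal (\<lambda>u. inverse (f u))"
    using Suc.prems U Ck_on_continuous[OF Suc.prems(1)] by (auto intro!: continuous_map_real_inverse)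
  ultimately show ?case unfolding Ck_on.simps by blast
qed

section \<open>Complex-valued smooth functions\<close>

definition complex_smooth :: "'i set \<Rightarrow> ('i \<Rightarrow> real) set \<Rightarrow> (('i \<Rightarrow> real) \<Rightarrow> complex) \<Rightarrow> bool" where
  "complex_smooth I U f \<longleftrightarrow> Cinf_on I U (\<lambda>u. Re (f u)) \<and> Cinf_on I U (\<lambda>u. Im (f u))"

lemma complex_smooth_of_real: "Cinf_on I U f \<Longrightarrow> complex_smooth I U (\<lambda>u. of_real (f u))"
  unfolding complex_smooth_def Cinf_on_def by (simp add: Ck_on_const)

lemma Cinf_on_Re: "complex_smooth I U f \<Longrightarrow> Cinf_on I U (\<lambda>u. Re (f u))"
  and Cinf_on_Im: "complex_smooth I U f \<Longrightarrow> Cinf_on I U (\<lambda>u. Im (f u))"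
  by (auto simp: complex_smooth_def)

lemma Cinf_on_add: "Cinf_on I U f \<Longrightarrow> Cinf_on I U g \<Longrightarrow> Cinf_on I U (\<lambda>u. f u + g u)"
  by (simp add: Cinf_on_def Ck_on_add)

lemma complex_smooth_const: "complex_smooth I U (\<lambda>_. c)"
  unfolding complex_smooth_def Cinf_on_def by (simp add: Ck_on_const)

lemma complex_smooth_coordinate: "i \<in> I \<Longrightarrow> complex_smooth I U (\<lambda>u. of_real (u i))"
  by (simp add: complex_smooth_of_real Cinf_on_def Ck_on_coordinate)

lemma complex_smooth_add:
  "complex_smooth I U f \<Longrightarrow> complex_smooth I U g \<Longrightarrow> complex_smooth I U (\<lambda>u. f u + g u)"
  unfolding complex_smooth_def Cinf_on_def by (simp add: Ck_on_add)

lemma complex_smooth_mult: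
  assumes "complex_smooth I U f" "complex_smooth I U g"
  shows "complex_smooth I U (\<lambda>u. f u * g u)"
proof -
  have "Cinf_on I U (\<lambda>u. Re (f u) * Re (g u) + (- 1) * (Im (f u) * Im (g u)))"
    "Cinf_on I U (\<lambda>u. Re (f u) * Im (g u) + Im (f u) * Re (g u))"
    using assms unfolding complex_smooth_def Cinf_on_def
    by (intro allI Ck_on_add Ck_on_mult Ck_on_const; simp)+
  then show ?thesis by (simp add: complex_smooth_def)
qed

lemma complex_smooth_cnj: "complex_smooth I U f \<Longrightarrow> complex_smooth I U (\<lambda>u. cnj (f u))"
  unfolding complex_smooth_def Cinf_on_def
  using Ck_on_mult[OF Ck_on_const[where c = "-1"], where g = "\<lambda>u. Im (f u)"] by fastforce

lemma complex_smooth_minus: "complex_smooth I U f \<Longrightarrow> complex_smooth I U (\<lambda>u. - f u)"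
  using complex_smooth_mult[OF complex_smooth_const[of I U "-1"], of f] by simp

lemma complex_smooth_diff:
  "complex_smooth I U f \<Longrightarrow> complex_smooth I U g \<Longrightarrow> complex_smooth I U (\<lambda>u. f u - g u)"
  using complex_smooth_add[OF _ complex_smooth_minus, of I U f g] by simp

text \<open>Reduced to the real case by 1/z = cnj z / |z|^2; \<open>?N\<close> is the squared
  modulus, which vanishes only where \<open>f\<close> does.\<close>

lemma complex_smooth_inverse:
  assumes U: "U \<subseteq> topspace (powertop_real I)" and f: "complex_smooth I U f"
    and nz: "\<And>u. u \<in> U \<Longrightarrow> f u \<noteq> 0"
  shows "complex_smooth I U (\<lambda>u. inverse (f u))"
proof -
  let ?N = "\<lambda>u. Re (f u) * Re (f u) + Im (f u) * Im (f u)"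
  have "?N u \<noteq> 0" if "u \<in> U" for u
    using nz[OF that] by (simp add: sum_squares_eq_zero_iff complex_eq_iff)
  then have "Cinf_on I U (\<lambda>u. inverse (?N u))"
    using f U unfolding Cinf_on_def complex_smooth_def
    by (intro allI Ck_on_inverse Ck_on_add Ck_on_mult) auto
  then have "complex_smooth I U (\<lambda>u. cnj (f u) * of_real (inverse (?N u)))"
    by (intro complex_smooth_mult complex_smooth_cnj f complex_smooth_of_real)
  also have "(\<lambda>u. cnj (f u) * of_real (inverse (?N u))) = (\<lambda>u. inverse (f u))"
    by (auto simp: fun_eq_iff complex_eq_iff power2_eq_square divide_inverse simp del: of_real_add of_real_mult of_real_inverse
             simp flip: of_real_add of_real_mult of_real_inverse)
  finally show ?thesis .
qed

lemma complex_smooth_sum: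
  "(\<And>a. a \<in> A \<Longrightarrow> complex_smooth I U (f a)) \<Longrightarrow> complex_smooth I U (\<lambda>u. \<Sum>a\<in>A. f a u)"
  by (induction A rule: infinite_finite_induct)
     (auto intro: complex_smooth_const complex_smooth_add)

lemma complex_smooth_prod:
  "(\<And>a. a \<in> A \<Longrightarrow> complex_smooth I U (f a)) \<Longrightarrow> complex_smooth I U (\<lambda>u. \<Prod>a\<in>A. f a u)"
  by (induction A rule: infinite_finite_induct)
     (auto intro: complex_smooth_const complex_smooth_mult)

text \<open>The size is demanded at every \<open>u\<close>, also outside \<open>U\<close>: the
  entries of sums, products and adjoints can then be rewritten as equalities of functions, without
  side conditions on \<open>u\<close>.\<close>

definition matrix_smooth ::
  "'i set \<Rightarrow> ('i \<Rightarrow> real) set \<Rightarrow> nat \<Rightarrow> (('i \<Rightarrow> real) \<Rightarrow> complex mat) \<Rightarrow> bool" where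
  "matrix_smooth I U n M \<longleftrightarrow> (\<forall>u. M u \<in> carrier_mat n n) \<and>
     (\<forall>i<n. \<forall>j<n. complex_smooth I U (\<lambda>u. M u $$ (i, j)))"

lemma matrix_smooth_const: "A \<in> carrier_mat n n \<Longrightarrow> matrix_smooth I U n (\<lambda>_. A)"
  by (auto simp: matrix_smooth_def complex_smooth_const)

lemma matrix_smooth_mat:
  "(\<And>i j. i < n \<Longrightarrow> j < n \<Longrightarrow> complex_smooth I U (\<lambda>u. f u i j)) \<Longrightarrow>
   matrix_smooth I U n (\<lambda>u. mat n n (\<lambda>(i, j). f u i j))"
  by (auto simp: matrix_smooth_def)

lemma matrix_smooth_add:
  assumes "matrix_smooth I U n M" "matrix_smooth I U n N"
  shows "matrix_smooth I U n (\<lambda>u. M u + N u)"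
proof -
  have "dim_row (N u) = n" "dim_col (N u) = n" for u using assms by (auto simp: matrix_smooth_def)
  then show ?thesis using assms by (auto simp: matrix_smooth_def intro!: complex_smooth_add)
qed

lemma matrix_smooth_diff:
  assumes "matrix_smooth I U n M" "matrix_smooth I U n N"
  shows "matrix_smooth I U n (\<lambda>u. M u - N u)"
proof -
  have "dim_row (N u) = n" "dim_col (N u) = n" for u using assms by (auto simp: matrix_smooth_def)
  then show ?thesis using assms by (auto simp: matrix_smooth_def intro!: complex_smooth_diff)
qed

lemma matrix_smooth_smult:
  assumes "matrix_smooth I U n M" "complex_smooth I U f"
  shows "matrix_smooth I U n (\<lambda>u. f u \<cdot>\<^sub>m M u)"
proof -
  have "dim_row (M u) = n" "dim_col (M u) = n" for u using assms by (auto simp: matrix_smooth_def)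
  then show ?thesis using assms by (auto simp: matrix_smooth_def intro!: complex_smooth_mult)
qed

lemma matrix_smooth_mult:
  assumes "matrix_smooth I U n M" "matrix_smooth I U n N"
  shows "matrix_smooth I U n (\<lambda>u. M u * N u)"
proof -
  have "dim_row (M u) = n" "dim_col (M u) = n" "dim_row (N u) = n" "dim_col (N u) = n" for u
    using assms by (auto simp: matrix_smooth_def)
  then show ?thesis using assms
    by (auto simp: matrix_smooth_def times_mat_def scalar_prod_def intro!: complex_smooth_sum complex_smooth_mult)
qed

lemma dim_mat_adjoint [simp]: "dim_row (mat_adjoint A) = dim_col A" "dim_col (mat_adjoint A) = dim_row A"
  by (simp_all add: mat_adjoint_def)

lemma mat_adjoint_carrier [simp]: "A \<in> carrier_mat n m \<Longrightarrow> mat_adjoint A \<in> carrier_mat m n"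
  by auto

lemma mat_adjoint_index [simp]:
  "i < dim_col A \<Longrightarrow> j < dim_row A \<Longrightarrow> mat_adjoint A $$ (i, j) = cnj (A $$ (j, i))"
  unfolding mat_adjoint_def by (simp add: mat_of_rows_def cols_def conjugate_complex_def)

lemma matrix_smooth_adjoint:
  assumes "matrix_smooth I U n M"
  shows "matrix_smooth I U n (\<lambda>u. mat_adjoint (M u))"
proof -
  have "dim_row (M u) = n" "dim_col (M u) = n" for u using assms by (auto simp: matrix_smooth_def)
  then show ?thesis using assms by (auto simp: matrix_smooth_def intro!: complex_smooth_cnj)
qed

lemma complex_smooth_det:
  assumes "matrix_smooth I U n M"
  shows "complex_smooth I U (\<lambda>u. det (M u))"
proof -
  have "dim_row (M u) = n" "dim_col (M u) = n" for u
    using assms by (auto simp: matrix_smooth_def)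
  then show ?thesis using assms unfolding Determinant.det_def
    by (auto simp: matrix_smooth_def intro!: complex_smooth_sum complex_smooth_mult complex_smooth_const complex_smooth_prod
         dest: permutes_in_image)
qed

section \<open>Inverse matrices\<close>

lemma smult_smult_mat: "a \<cdot>\<^sub>m (b \<cdot>\<^sub>m A) = (a * b) \<cdot>\<^sub>m (A :: 'a :: semigroup_mult mat)"
  by (rule eq_matI) (auto simp: mult.assoc)

lemma one_smult_mat: "1 \<cdot>\<^sub>m A = (A :: 'a :: monoid_mult mat)"
  by (rule eq_matI) auto

text \<open>The adjugate formula is chosen because it is rational in the entries and so preserves
  smoothness.\<close>

definition mat_inv :: "complex mat \<Rightarrow> complex mat" where
  "mat_inv A = inverse (det A) \<cdot>\<^sub>m adj_mat A"

lemma mat_inv: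
  assumes "A \<in> carrier_mat n n" "det A \<noteq> 0"
  shows "mat_inv A \<in> carrier_mat n n" "A * mat_inv A = 1\<^sub>m n" "mat_inv A * A = 1\<^sub>m n"
proof -
  note a = adj_mat[OF assms(1)]
  show "mat_inv A \<in> carrier_mat n n" using a by (simp add: one_smult_mat mat_inv_def)
  show "A * mat_inv A = 1\<^sub>m n" using a assms
    by (simp add: one_smult_mat mat_inv_def mult_smult_distrib[OF assms(1) a(1)] smult_smult_mat)
  show "mat_inv A * A = 1\<^sub>m n" using a assms
    by (simp add: one_smult_mat mat_inv_def mult_smult_assoc_mat[OF a(1) assms(1)] smult_smult_mat)
qed

lemma matrix_smooth_inv:
  assumes U: "U \<subseteq> topspace (powertop_real I)" and M: "matrix_smooth I U n M"
    and nz: "\<And>u. u \<in> U \<Longrightarrow> det (M u) \<noteq> 0"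
  shows "matrix_smooth I U n (\<lambda>u. mat_inv (M u))"
proof -
  have c: "M u \<in> carrier_mat n n" and d: "dim_row (M u) = n" "dim_col (M u) = n" for u
    using M by (auto simp: matrix_smooth_def)
  have "matrix_smooth I U (n - 1) (\<lambda>u. mat_delete (M u) i j)" if "i < n" "j < n" for i j
    using M that d by (auto simp: matrix_smooth_def mat_delete_def)
  then have "matrix_smooth I U n (\<lambda>u. adj_mat (M u))"
    using adj_mat(1)[OF c] unfolding matrix_smooth_def[of I U n] adj_mat_def cofactor_def
    by (auto simp: d intro!: complex_smooth_mult complex_smooth_const complex_smooth_det)
  then show ?thesis unfolding mat_inv_def
    by (intro matrix_smooth_smult complex_smooth_inverse U complex_smooth_det[OF M] nz)
qed


section \<open>The Cayley transform\<close>

lemma mat_adjoint_mult: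
  fixes A B :: "complex mat"
  assumes "A \<in> carrier_mat n m" "B \<in> carrier_mat m l"
  shows "mat_adjoint (A * B) = mat_adjoint B * mat_adjoint A"
  using assms by (intro eq_matI) (auto simp: scalar_prod_def mult.commute)

lemma mat_adjoint_add:
  fixes A B :: "complex mat"
  assumes "A \<in> carrier_mat n m" "B \<in> carrier_mat n m"
  shows "mat_adjoint (A + B) = mat_adjoint A + mat_adjoint B"
  using assms by (intro eq_matI) auto

lemma mat_adjoint_diff:
  fixes A B :: "complex mat"
  assumes "A \<in> carrier_mat n m" "B \<in> carrier_mat n m"
  shows "mat_adjoint (A - B) = mat_adjoint A - mat_adjoint B"
  using assms by (intro eq_matI) auto

lemma mat_adjoint_smult: "mat_adjoint (c \<cdot>\<^sub>m A) = cnj c \<cdot>\<^sub>m mat_adjoint A"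
  by (intro eq_matI) auto

lemma mat_adjoint_one [simp]: "mat_adjoint (1\<^sub>m n :: complex mat) = 1\<^sub>m n"
  by (intro eq_matI) auto

lemma mat_adjoint_adjoint [simp]: "mat_adjoint (mat_adjoint A) = (A :: complex mat)"
  by (intro eq_matI) auto

lemma mat_inv_unique:
  assumes "A \<in> carrier_mat n n" "B \<in> carrier_mat n n" "A * B = 1\<^sub>m n"
  shows "det A \<noteq> 0" "mat_inv A = B"
proof -
  have "det A * det B = 1" using det_mult[OF assms(1,2)] assms(3) by simp
  then show d: "det A \<noteq> 0" by auto
  note i = mat_inv[OF assms(1) d]
  have "mat_inv A = mat_inv A * (A * B)" using i assms by simp
  also have "\<dots> = B" using i assms assoc_mult_mat[OF i(1) assms(1,2)] by simp
  finally show "mat_inv A = B" .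
qed

text \<open>
  This is $(1 - Z)(1 + Z)^{-1}$, written so that $1 + Z$ and $1 + \mathrm{cayley}(Z)$ are visibly
  inverse to each other up to the factor 2.
\<close>

definition cayley :: "nat \<Rightarrow> complex mat \<Rightarrow> complex mat" where
  "cayley n Z = 2 \<cdot>\<^sub>m mat_inv (1\<^sub>m n + Z) - 1\<^sub>m n"

lemma cayley_carrier:
  "Z \<in> carrier_mat n n \<Longrightarrow> det (1\<^sub>m n + Z) \<noteq> 0 \<Longrightarrow> cayley n Z \<in> carrier_mat n n"
  using mat_inv(1)[of "1\<^sub>m n + Z" n] by (auto simp: cayley_def)

lemma cayley_involution:
  assumes Z: "Z \<in> carrier_mat n n" "det (1\<^sub>m n + Z) \<noteq> 0"
  shows "det (1\<^sub>m n + cayley n Z) \<noteq> 0" "cayley n (cayley n Z) = Z"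
proof -
  define S where "S = 1\<^sub>m n + Z"
  define J where "J = mat_inv S"
  have S: "S \<in> carrier_mat n n" using Z by (simp add: S_def)
  note J = mat_inv[OF S, folded J_def]
  have J': "J \<in> carrier_mat n n" "S * J = 1\<^sub>m n" "J * S = 1\<^sub>m n" using J Z(2) by (auto simp: S_def)
  have eq: "1\<^sub>m n + cayley n Z = 2 \<cdot>\<^sub>m J"
    using J' by (intro eq_matI) (auto simp: cayley_def J_def S_def)
  \<comment> \<open>The inverse of \<open>2 \<cdot>\<^sub>m J\<close> is half of \<open>S\<close>,
    so the second Cayley transform is 2 (S/2) - 1 = Z.\<close>
  have "2 \<cdot>\<^sub>m J * ((1/2) \<cdot>\<^sub>m S) = 1\<^sub>m n"
    using J' S by (simp add: mult_smult_distrib[of _ n n _ n] mult_smult_assoc_mat[of _ n n _ n] smult_smult_mat one_smult_mat)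
  note u = mat_inv_unique[OF _ _ this]
  have c: "2 \<cdot>\<^sub>m J \<in> carrier_mat n n" "(1/2) \<cdot>\<^sub>m S \<in> carrier_mat n n" using J' S by auto
  show "det (1\<^sub>m n + cayley n Z) \<noteq> 0" using u(1)[OF c] eq by simp
  show "cayley n (cayley n Z) = Z"
    using u(2)[OF c] S Z unfolding cayley_def[of _ "cayley n Z"] eq
    by (intro eq_matI) (auto simp: S_def add_divide_distrib)
qed

text \<open>
  With $S = 1 + Z$ and $J = S^{-1}$ this gives both halves of the Cayley correspondence: if $Z$ is
  unitary then $S + S^H = S^H S$, so $J^H + J = 1$; if $Z$ is skew-Hermitian then $S + S^H = 2$, so
  $J^H + J = 2 J^H J$.
\<close>

lemma adjoint_inv_sandwich:
  assumes S: "S \<in> carrier_mat n n" "det S \<noteq> 0"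
  shows "mat_adjoint (mat_inv S) * (S + mat_adjoint S) * mat_inv S = mat_adjoint (mat_inv S) + mat_inv S"
proof -
  define J where "J = mat_inv S"
  note J = mat_inv[OF S, folded J_def]
  have c: "S \<in> carrier_mat n n" "J \<in> carrier_mat n n" "mat_adjoint S \<in> carrier_mat n n" "mat_adjoint J \<in> carrier_mat n n" using S J by auto
  have "mat_adjoint J * mat_adjoint S = 1\<^sub>m n"
    using mat_adjoint_mult[OF S(1) J(1)] J by simp
  then have "mat_adjoint J * S * J = mat_adjoint J" "mat_adjoint J * mat_adjoint S * J = J"
    using c J by (simp_all add: assoc_mult_mat[OF c(4) c(1) c(2)])
  then show ?thesis unfolding J_def[symmetric]
    using c by (simp add: mult_add_distrib_mat[of _ n n _ n] add_mult_distrib_mat[of _ n n _ _ n]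
        mult_carrier_mat[of _ n n _ n] del: assoc_mult_mat)
qed

lemma cayley_unitary_skew:
  assumes Z: "Z \<in> carrier_mat n n" "mat_adjoint Z * Z = 1\<^sub>m n" "det (1\<^sub>m n + Z) \<noteq> 0"
  shows "mat_adjoint (cayley n Z) = - cayley n Z"
proof -
  define S where "S = 1\<^sub>m n + Z"
  define J where "J = mat_inv S"
  have S: "S \<in> carrier_mat n n" "det S \<noteq> 0" using Z by (simp_all add: S_def)
  note J = mat_inv[OF S, folded J_def]
  have c: "S \<in> carrier_mat n n" "J \<in> carrier_mat n n" "mat_adjoint S \<in> carrier_mat n n" "mat_adjoint J \<in> carrier_mat n n"
      "Z \<in> carrier_mat n n" "mat_adjoint Z \<in> carrier_mat n n" using S J Z by auto
  have SH: "mat_adjoint S = 1\<^sub>m n + mat_adjoint Z" using Z by (simp add: S_def mat_adjoint_add[of _ n n])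
  have "mat_adjoint S * S = (1\<^sub>m n + mat_adjoint Z) + (Z + 1\<^sub>m n)"
    unfolding SH unfolding S_def using c Z(2)
    by (simp add: mult_add_distrib_mat[of _ n n _ n] add_mult_distrib_mat[of _ n n _ _ n])
  also have "\<dots> = S + mat_adjoint S" unfolding SH S_def using c by (intro eq_matI) auto
  finally have "mat_adjoint J * (mat_adjoint S * S) * J = mat_adjoint J + J"
    using adjoint_inv_sandwich[OF S] by (simp add: J_def)
  moreover have "mat_adjoint J * (mat_adjoint S * S) * J = (mat_adjoint J * mat_adjoint S) * (S * J)"
    using c by (simp add: assoc_mult_mat[of _ n n _ n _ n] mult_carrier_mat[of _ n n _ n])
  moreover have "mat_adjoint J * mat_adjoint S = 1\<^sub>m n"
    using mat_adjoint_mult[OF S(1) J(1)] J by simp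
  ultimately have e: "mat_adjoint J + J = 1\<^sub>m n" using J by simp
  have ent: "mat_adjoint J $$ (i, j) = 1\<^sub>m n $$ (i, j) - J $$ (i, j)" if "i < n" "j < n" for i j
    using arg_cong[OF e, of "\<lambda>M. M $$ (i, j)"] c that by (simp add: algebra_simps)
  \<comment> \<open>The transform is 2 J - 1, and \<open>e\<close> gives J^H = 1 - J, so the adjoint
    2 J^H - 1 equals 1 - 2 J.\<close>
  have "mat_adjoint (cayley n Z) = 2 \<cdot>\<^sub>m mat_adjoint J - 1\<^sub>m n"
    unfolding cayley_def S_def[symmetric] J_def[symmetric] using c
    by (simp add: mat_adjoint_diff[of _ n n] mat_adjoint_smult)
  also have "\<dots> = - cayley n Z"
    unfolding cayley_def S_def[symmetric] J_def[symmetric] using c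
    by (intro eq_matI) (auto simp: ent simp del: mat_adjoint_index)
  finally show ?thesis .
qed

text \<open>A skew-Hermitian matrix has purely imaginary eigenvalues, so -1 is not one of them. For
  a null vector v of 1 + Y the number v^H Y v equals -|v|^2, which is real, whereas skewness makes
  it purely imaginary; hence v = 0.\<close>

lemma det_one_plus_skew:
  fixes Y :: "complex mat"
  assumes Y: "Y \<in> carrier_mat n n" "mat_adjoint Y = - Y"
  shows "det (1\<^sub>m n + Y) \<noteq> 0"
proof
  assume "det (1\<^sub>m n + Y) = 0"
  then obtain v where v: "v \<in> carrier_vec n" "v \<noteq> 0\<^sub>v n" "(1\<^sub>m n + Y) *\<^sub>v v = 0\<^sub>v n"
    using det_0_iff_vec_prod_zero_field[of "1\<^sub>m n + Y" n] Y by auto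
  have sk: "cnj (Y $$ (j, i)) = - Y $$ (i, j)" if "i < n" "j < n" for i j
    using arg_cong[OF Y(2), of "\<lambda>M. M $$ (i, j)"] Y(1) that by (simp add: conjugate_complex_def)
  have Xv: "(\<Sum>j<n. Y $$ (i, j) * v $ j) = - v $ i" if "i < n" for i
  proof -
    have "((1\<^sub>m n + Y) *\<^sub>v v) $ i = v $ i + (\<Sum>j<n. Y $$ (i, j) * v $ j)"
      using Y(1) v(1) that by (simp add: scalar_prod_def atLeast0LessThan algebra_simps sum.distrib
          if_distrib[of "\<lambda>x. _ * x"] cong: if_cong)
    then show ?thesis using v that by (simp add: eq_neg_iff_add_eq_0 add.commute)
  qed
  define s where "s = (\<Sum>i<n. \<Sum>j<n. cnj (v $ i) * Y $$ (i, j) * v $ j)"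
  have s1: "s = - of_real (\<Sum>i<n. (cmod (v $ i))\<^sup>2)"
  proof -
    have "s = (\<Sum>i<n. cnj (v $ i) * (\<Sum>j<n. Y $$ (i, j) * v $ j))"
      by (simp add: s_def sum_distrib_left mult.assoc)
    also have "\<dots> = (\<Sum>i<n. - of_real ((cmod (v $ i))\<^sup>2))"
      using Xv by (intro sum.cong) (auto simp: complex_norm_square mult.commute simp del: of_real_power)
    finally show ?thesis by (simp add: sum_negf)
  qed
  have "cnj s = (\<Sum>i<n. \<Sum>j<n. v $ i * cnj (Y $$ (i, j)) * cnj (v $ j))" by (simp add: s_def)
  also have "\<dots> = (\<Sum>i<n. \<Sum>j<n. - (cnj (v $ j) * Y $$ (j, i) * v $ i))"
    by (intro sum.cong refl) (simp add: sk)
  also have "\<dots> = - s" unfolding s_def sum_negf by (subst sum.swap) simp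
  finally have "s = 0" using s1 by (simp add: complex_eq_iff)
  then have "(\<Sum>i<n. (cmod (v $ i))\<^sup>2) = 0" using s1 by (simp del: of_real_sum)
  then have "\<forall>i<n. v $ i = 0" by (subst (asm) sum_nonneg_eq_0_iff) auto
  then show False using v by (auto simp: vec_eq_iff)
qed

text \<open>The transform is 2 J - 1 with J the inverse of 1 + Y, and (2 J^H - 1)(2 J - 1) = 4 J^H J
  - 2 J^H - 2 J + 1 collapses to 1 by J^H + J = 2 J^H J.\<close>

lemma cayley_skew_unitary:
  assumes Y: "Y \<in> carrier_mat n n" "mat_adjoint Y = - Y"
  shows "mat_adjoint (cayley n Y) * cayley n Y = 1\<^sub>m n"
proof -
  define S where "S = 1\<^sub>m n + Y"
  define J where "J = mat_inv S"
  have S: "S \<in> carrier_mat n n" "det S \<noteq> 0" using Y det_one_plus_skew[OF Y] by (simp_all add: S_def)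
  note J = mat_inv[OF S, folded J_def]
  have c: "S \<in> carrier_mat n n" "J \<in> carrier_mat n n" "mat_adjoint S \<in> carrier_mat n n" "mat_adjoint J \<in> carrier_mat n n"
      "Y \<in> carrier_mat n n" using S J Y by auto
  have "mat_adjoint S = 1\<^sub>m n - Y"
    using Y by (auto simp: S_def mat_adjoint_add[of _ n n])
  then have "S + mat_adjoint S = 2 \<cdot>\<^sub>m 1\<^sub>m n" unfolding S_def using Y by (intro eq_matI) auto
  then have "2 \<cdot>\<^sub>m (mat_adjoint J * J) = mat_adjoint J + J"
    using adjoint_inv_sandwich[OF S] c
    by (simp add: J_def[symmetric] mult_smult_distrib[of _ n n _ n] mult_smult_assoc_mat[of _ n n _ n])
  note e = this
  have ent: "2 * ((mat_adjoint J * J) $$ (i, j)) = mat_adjoint J $$ (i, j) + J $$ (i, j)"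
    if "i < n" "j < n" for i j
    using that c arg_cong[OF e, of "\<lambda>M. M $$ (i, j)"] by (simp del: mat_adjoint_index index_mult_mat(1))
  let ?K = "mat_adjoint J"
  have "mat_adjoint (cayley n Y) = 2 \<cdot>\<^sub>m ?K - 1\<^sub>m n"
    unfolding cayley_def S_def[symmetric] J_def[symmetric] using c
    by (simp add: mat_adjoint_diff[of _ n n] mat_adjoint_smult)
  then have "mat_adjoint (cayley n Y) * cayley n Y = (2 \<cdot>\<^sub>m ?K - 1\<^sub>m n) * (2 \<cdot>\<^sub>m J - 1\<^sub>m n)"
    unfolding cayley_def S_def[symmetric] J_def[symmetric] by simp
  also have "\<dots> = 2 \<cdot>\<^sub>m (2 \<cdot>\<^sub>m (?K * J) - J) - (2 \<cdot>\<^sub>m ?K - 1\<^sub>m n)"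
    using c by (simp add: mult_minus_distrib_mat[of _ n n _ n] minus_mult_distrib_mat[of _ n n _ _ n] mult_carrier_mat[of _ n n _ n] minus_carrier_mat[of _ n n]
        mult_smult_distrib[of _ n n _ n] mult_smult_assoc_mat[of _ n n _ n] smult_smult_mat)
  also have "\<dots> = 1\<^sub>m n"
  proof (rule eq_matI)
    fix i j assume "i < dim_row (1\<^sub>m n :: complex mat)" "j < dim_col (1\<^sub>m n :: complex mat)"
    then have ij: "i < n" "j < n" by auto
    note e = ent[OF ij]
    then show "(2 \<cdot>\<^sub>m (2 \<cdot>\<^sub>m (?K * J) - J) - (2 \<cdot>\<^sub>m ?K - 1\<^sub>m n)) $$ (i, j) = 1\<^sub>m n $$ (i, j)"
      using ij c e by (simp del: mat_adjoint_index index_mult_mat(1))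
  qed (use c in auto)
  finally show ?thesis .
qed

lemma matrix_smooth_cayley:
  assumes "U \<subseteq> topspace (powertop_real I)" "matrix_smooth I U n M"
    "\<And>u. u \<in> U \<Longrightarrow> det (1\<^sub>m n + M u) \<noteq> 0"
  shows "matrix_smooth I U n (\<lambda>u. cayley n (M u))"
  unfolding cayley_def using assms
  by (intro matrix_smooth_diff matrix_smooth_smult matrix_smooth_inv matrix_smooth_add matrix_smooth_const
      complex_smooth_const) auto

lemma unitary_mult_adjoint:
  fixes A :: "complex mat"
  assumes "A \<in> carrier_mat n n" "mat_adjoint A * A = 1\<^sub>m n"
  shows "A * mat_adjoint A = 1\<^sub>m n"
  using mat_mult_left_right_inverse[OF mat_adjoint_carrier[OF assms(1)] assms(1) assms(2)] .

lemma unitary_mult: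
  fixes A B :: "complex mat"
  assumes "A \<in> carrier_mat n n" "mat_adjoint A * A = 1\<^sub>m n" "B \<in> carrier_mat n n" "mat_adjoint B * B = 1\<^sub>m n"
  shows "mat_adjoint (A * B) * (A * B) = 1\<^sub>m n"
proof -
  note c = assms(1,3) mat_adjoint_carrier[OF assms(1)] mat_adjoint_carrier[OF assms(3)]
  have "mat_adjoint (A * B) * (A * B) = mat_adjoint B * ((mat_adjoint A * A) * B)"
    using c by (simp add: mat_adjoint_mult[of _ n n _ n] assoc_mult_mat[of _ n n _ n _ n] del: assms(2))
  then show ?thesis using assms by simp
qed


section \<open>Groups with unitary matrix coordinates\<close>

text \<open>The maps treated below are each given by one formula on one open set, so a single
  extension serves for all points.\<close>

lemma smooth_mapI:
  assumes "f \<in> S \<rightarrow> T" "openin (powertop_real I) U" "\<phi> ` S \<subseteq> U"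
    "\<And>j. j \<in> J \<Longrightarrow> Cinf_on I U (\<lambda>u. F u j)"
    "\<And>y j. y \<in> S \<Longrightarrow> j \<in> J \<Longrightarrow> F (\<phi> y) j = \<psi> (f y) j"
  shows "smooth_map S I \<phi> T J \<psi> f"
  using assms unfolding smooth_map_def by (intro conjI ballI exI[of _ U] exI[of _ F]) auto

lemma smooth_map_cong:
  assumes "smooth_map S I \<phi> T J \<psi> f" "\<And>x. x \<in> S \<Longrightarrow> f x = g x"
  shows "smooth_map S I \<phi> T J \<psi> g"
proof -
  have "f \<in> S \<rightarrow> T \<longleftrightarrow> g \<in> S \<rightarrow> T" unfolding Pi_iff using assms(2) by auto
  then show ?thesis using assms unfolding smooth_map_def by simp
qed

text \<open>
  Linearity is required in both directions through coefficient families \<open>c\<close> and \<open>c'\<close>; a real-linear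
  functional of complex matrices is the real part of a complex-linear one. All structure maps and
  charts then become explicit rational functions of the coordinates, so that no chain rule is needed.
\<close>

locale unitary_coordinates =
  fixes G :: "('a, 'i) coord_group" and r n :: nat and h :: "'a \<Rightarrow> nat \<Rightarrow> complex mat"
    and c :: "nat \<Rightarrow> nat \<Rightarrow> nat \<Rightarrow> 'i \<Rightarrow> complex" and c' :: "'i \<Rightarrow> nat \<Rightarrow> nat \<Rightarrow> nat \<Rightarrow> complex"
  assumes finite_index: "finite (index G)"
    and coords_ext: "x \<in> carrier G \<Longrightarrow> coords G x \<in> index G \<rightarrow>\<^sub>E UNIV"
    and bij: "bij_betw h (carrier G) ({..<r} \<rightarrow>\<^sub>E carrier (unitary_matrices n))"
    and mult_closed: "x \<in> carrier G \<Longrightarrow> y \<in> carrier G \<Longrightarrow> x \<otimes>\<^bsub>G\<^esub> y \<in> carrier G"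
    and h_mult: "x \<in> carrier G \<Longrightarrow> y \<in> carrier G \<Longrightarrow> k < r \<Longrightarrow> h (x \<otimes>\<^bsub>G\<^esub> y) k = h x k * h y k"
    and one_closed: "\<one>\<^bsub>G\<^esub> \<in> carrier G"
    and h_one: "k < r \<Longrightarrow> h \<one>\<^bsub>G\<^esub> k = 1\<^sub>m n"
    and entries: "x \<in> carrier G \<Longrightarrow> k < r \<Longrightarrow> i < n \<Longrightarrow> j < n \<Longrightarrow>
      h x k $$ (i, j) = (\<Sum>a\<in>index G. c k i j a * of_real (coords G x a))"
    and coords_entries: "x \<in> carrier G \<Longrightarrow> a \<in> index G \<Longrightarrow>
      coords G x a = Re (\<Sum>k<r. \<Sum>i<n. \<Sum>j<n. c' a k i j * h x k $$ (i, j))"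
begin

text \<open>Extends the matrices of a group element, as functions of its coordinates, to every real
  vector; the extensions that \<open>smooth_map\<close> asks for are built from it.\<close>

definition lin :: "('i \<Rightarrow> real) \<Rightarrow> nat \<Rightarrow> complex mat" where
  "lin u k = mat n n (\<lambda>(i, j). \<Sum>a\<in>index G. c k i j a * of_real (u a))"

text \<open>Meaningful for any tuple of matrices, so it also applies to matrix functions whose
  values leave the group away from the image of the coordinates.\<close>

definition coords_of :: "(nat \<Rightarrow> complex mat) \<Rightarrow> 'i \<Rightarrow> real" where
  "coords_of M a = Re (\<Sum>k<r. \<Sum>i<n. \<Sum>j<n. c' a k i j * M k $$ (i, j))"

definition h_inv :: "(nat \<Rightarrow> complex mat) \<Rightarrow> 'a" where
  "h_inv = inv_into (carrier G) h"

lemma lin_carrier [simp]: "lin u k \<in> carrier_mat n n"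
  by (simp add: lin_def)

lemma h_ext: "x \<in> carrier G \<Longrightarrow> h x \<in> {..<r} \<rightarrow>\<^sub>E carrier (unitary_matrices n)"
  using bij_betwE[OF bij] by blast

lemma h_unitary:
  assumes "x \<in> carrier G" "k < r"
  shows "h x k \<in> carrier_mat n n" "mat_adjoint (h x k) * h x k = 1\<^sub>m n"
  using PiE_mem[OF h_ext[OF assms(1)], of k] assms(2) by (auto simp: unitary_matrices_def)

lemma h_eqI: "x \<in> carrier G \<Longrightarrow> y \<in> carrier G \<Longrightarrow> (\<And>k. k < r \<Longrightarrow> h x k = h y k) \<Longrightarrow> x = y"
  using bij_betw_imp_inj_on[OF bij] PiE_ext[OF h_ext[of x] h_ext[of y]] by (auto simp: inj_on_def)

lemma lin_coords: "x \<in> carrier G \<Longrightarrow> k < r \<Longrightarrow> lin (coords G x) k = h x k"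
  using h_unitary(1)[of x k] by (intro eq_matI) (auto simp: lin_def entries)

lemma h_inv:
  assumes "\<And>k. k < r \<Longrightarrow> M k \<in> carrier_mat n n" "\<And>k. k < r \<Longrightarrow> mat_adjoint (M k) * M k = 1\<^sub>m n"
  shows "h_inv (\<lambda>k\<in>{..<r}. M k) \<in> carrier G" "k < r \<Longrightarrow> h (h_inv (\<lambda>k\<in>{..<r}. M k)) k = M k"
proof -
  have "(\<lambda>k\<in>{..<r}. M k) \<in> {..<r} \<rightarrow>\<^sub>E carrier (unitary_matrices n)"
    using assms by (auto simp: unitary_matrices_def)
  then show "h_inv (\<lambda>k\<in>{..<r}. M k) \<in> carrier G" "k < r \<Longrightarrow> h (h_inv (\<lambda>k\<in>{..<r}. M k)) k = M k"
    using bij_betw_inv_into_right[OF bij] bij_betwE[OF bij_betw_inv_into[OF bij]] by (auto simp: h_inv_def)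
qed

lemma inj_coords: "inj_on (coords G) (carrier G)"
  by (intro inj_onI h_eqI) (auto simp flip: lin_coords)

lemma coords_topspace: "x \<in> carrier G \<Longrightarrow> coords G x \<in> topspace (powertop_real (index G))"
  using coords_ext by (simp add: topspace_product_topology)

lemma matrix_smooth_lin:
  "(\<And>a. a \<in> index G \<Longrightarrow> Cinf_on I U (\<lambda>u. \<phi> u a)) \<Longrightarrow> matrix_smooth I U n (\<lambda>u. lin (\<phi> u) k)"
  unfolding lin_def
  by (intro matrix_smooth_mat complex_smooth_sum complex_smooth_mult complex_smooth_const complex_smooth_of_real) auto

lemma matrix_smooth_lin_id: "matrix_smooth (index G) U n (\<lambda>u. lin u k)"
  by (rule matrix_smooth_lin) (simp add: Cinf_on_def Ck_on_coordinate)

text \<open>The coordinates are real parts of linear forms in the matrix entries, so it is enough to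
  extend the matrices of the image point smoothly.\<close>

lemma smooth_map_into:
  assumes "f \<in> S \<rightarrow> T" "T \<subseteq> carrier G" "openin (powertop_real I) U" "\<phi> ` S \<subseteq> U"
    and M: "\<And>k. k < r \<Longrightarrow> matrix_smooth I U n (\<lambda>u. M u k)"
    and fM: "\<And>y k. y \<in> S \<Longrightarrow> k < r \<Longrightarrow> M (\<phi> y) k = h (f y) k"
  shows "smooth_map S I \<phi> T (index G) (coords G) f"
proof (rule smooth_mapI[OF assms(1,3,4), of "index G" "\<lambda>u. coords_of (M u)"])
  show "Cinf_on I U (\<lambda>u. coords_of (M u) a)" if "a \<in> index G" for a
    using M unfolding coords_of_def matrix_smooth_def
    by (intro Cinf_on_Re complex_smooth_sum complex_smooth_mult complex_smooth_const) auto
  show "coords_of (M (\<phi> y)) a = coords G (f y) a" if "y \<in> S" "a \<in> index G" for y a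
    using that assms(1,2) fM by (auto simp: coords_of_def coords_entries Pi_iff subset_iff)
qed

lemma inverse_exists:
  assumes x: "x \<in> carrier G"
  shows "h_inv (\<lambda>k\<in>{..<r}. mat_adjoint (h x k)) \<in> carrier G" (is "?y \<in> _")
    "h_inv (\<lambda>k\<in>{..<r}. mat_adjoint (h x k)) \<otimes>\<^bsub>G\<^esub> x = \<one>\<^bsub>G\<^esub>"
    "k < r \<Longrightarrow> h (h_inv (\<lambda>k\<in>{..<r}. mat_adjoint (h x k))) k = mat_adjoint (h x k)"
proof -
  note y = h_inv[of "\<lambda>k. mat_adjoint (h x k)"]
  have u: "k < r \<Longrightarrow> mat_adjoint (h x k) \<in> carrier_mat n n"
    "k < r \<Longrightarrow> mat_adjoint (mat_adjoint (h x k)) * mat_adjoint (h x k) = 1\<^sub>m n" for k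
    using h_unitary[OF x, of k] unitary_mult_adjoint[of "h x k" n] by auto
  show y1: "?y \<in> carrier G" using y(1)[OF u] .
  show y2: "k < r \<Longrightarrow> h ?y k = mat_adjoint (h x k)" for k using y(2)[OF u] .
  show "?y \<otimes>\<^bsub>G\<^esub> x = \<one>\<^bsub>G\<^esub>"
    using x y1 by (intro h_eqI mult_closed one_closed) (simp_all add: h_mult h_one y2 h_unitary)
qed

lemma is_group: "group G"
proof (rule groupI)
  fix x y z assume xyz: "x \<in> carrier G" "y \<in> carrier G" "z \<in> carrier G"
  show "x \<otimes>\<^bsub>G\<^esub> y \<otimes>\<^bsub>G\<^esub> z = x \<otimes>\<^bsub>G\<^esub> (y \<otimes>\<^bsub>G\<^esub> z)"
    using xyz h_unitary(1) by (intro h_eqI) (simp_all add: mult_closed h_mult assoc_mult_mat[of _ n n _ n _ n])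
next
  fix x assume x: "x \<in> carrier G"
  show "\<one>\<^bsub>G\<^esub> \<otimes>\<^bsub>G\<^esub> x = x"
    using x h_unitary(1)[OF x] by (intro h_eqI) (simp_all add: mult_closed one_closed h_mult h_one left_mult_one_mat[of _ n n])
  show "\<exists>y\<in>carrier G. y \<otimes>\<^bsub>G\<^esub> x = \<one>\<^bsub>G\<^esub>" using inverse_exists[OF x] by blast
qed (auto simp: mult_closed one_closed)

lemma h_group_inv:
  assumes "x \<in> carrier G" "k < r"
  shows "h (inv\<^bsub>G\<^esub> x) k = mat_adjoint (h x k)"
proof -
  interpret group G by (rule is_group)
  have "inv\<^bsub>G\<^esub> x = h_inv (\<lambda>k\<in>{..<r}. mat_adjoint (h x k))"
    by (rule inv_equality[OF inverse_exists(2)[OF assms(1)] assms(1) inverse_exists(1)[OF assms(1)]])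
  then show ?thesis using inverse_exists(3)[OF assms] by simp
qed

text \<open>
  The real part of a skew-Hermitian matrix is antisymmetric and its imaginary part is symmetric, so
  the matrix is determined by the sum of the two, which can be any real matrix. The function \<open>b\<close>
  numbers the entries of the \<open>r\<close> blocks.
\<close>

definition skew :: "(nat \<Rightarrow> real) \<Rightarrow> (nat \<times> nat \<times> nat \<Rightarrow> nat) \<Rightarrow> nat \<Rightarrow> complex mat" where
  "skew v b k = mat n n (\<lambda>(i, j). of_real (v (b (k, i, j))) * ((1 + \<i>) / 2) + of_real (v (b (k, j, i))) * ((\<i> - 1) / 2))"

lemma skew: "skew v b k \<in> carrier_mat n n" "mat_adjoint (skew v b k) = - skew v b k"
proof -
  show "mat_adjoint (skew v b k) = - skew v b k"
    by (intro eq_matI) (auto simp: skew_def complex_eq_iff field_simps)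
qed (simp add: skew_def)

text \<open>Left multiplication by the adjoint of \<open>A k\<close> moves the point
  \<open>x0\<close> to the identity, and the Cayley transform then yields skew-Hermitian matrices
  wherever no \<open>D u k\<close> vanishes. The chart has all of R^N as its image, with N = r n^2:
  one plus a skew-Hermitian matrix is always invertible, so the inverse chart, with matrices
  \<open>P\<close>, is defined everywhere.\<close>

lemma submanifold: "\<exists>N. submanifold N (carrier G) (index G) (coords G)"
proof -
  define B where "B = {..<r} \<times> {..<n} \<times> {..<n}"
  define N where "N = card B"
  obtain \<beta> where \<beta>: "bij_betw \<beta> {..<N} B"
    using ex_bij_betw_nat_finite[of B] by (auto simp: B_def N_def atLeast0LessThan)
  define b where "b = inv_into {..<N} \<beta>"
  have b: "b p \<in> {..<N}" "\<beta> (b p) = p" if "p \<in> B" for p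
    using that bij_betwE[OF bij_betw_inv_into[OF \<beta>]] bij_betw_inv_into_right[OF \<beta>] by (auto simp: b_def)
  have b\<beta>: "\<beta> t \<in> B" "b (\<beta> t) = t" if "t < N" for t
    using that bij_betwE[OF \<beta>] bij_betw_inv_into_left[OF \<beta>] by (auto simp: b_def)
  let ?X = "powertop_real (index G)" and ?V = "{..<N} \<rightarrow>\<^sub>E (UNIV :: real set)"
  have "\<exists>W V g. openin ?X W \<and> coords G x0 \<in> W \<and> openin (powertop_real {..<N}) V \<and>
     diffeo {y \<in> carrier G. coords G y \<in> W} (index G) (coords G) V {..<N} id g"
    if x0: "x0 \<in> carrier G" for x0
  proof -
    define A where "A k = h x0 k" for k
    have A: "A k \<in> carrier_mat n n" "mat_adjoint (A k) \<in> carrier_mat n n" "mat_adjoint (A k) * A k = 1\<^sub>m n"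
      "A k * mat_adjoint (A k) = 1\<^sub>m n" if "k < r" for k
      using h_unitary[OF x0 that] unitary_mult_adjoint by (auto simp: A_def)
    define D where "D u k = det (1\<^sub>m n + mat_adjoint (A k) * lin u k)" for u k
    define W where "W = {u \<in> topspace ?X. \<forall>k<r. D u k \<noteq> 0}"
    have ms: "matrix_smooth (index G) U n (\<lambda>u. mat_adjoint (A k) * lin u k)" if "k < r" for k U
      using A[OF that] by (intro matrix_smooth_mult matrix_smooth_const matrix_smooth_lin_id)
    \<comment> \<open>The nonvanishing of all the complex determinants is condensed into one real
      function, the product of their squared moduli, whose nonzero set is open by
      continuity.\<close>
    have W_eq: "W = {u \<in> topspace ?X. (\<Prod>k<r. Re (D u k * cnj (D u k))) \<in> - {0}}"
      by (auto simp: W_def complex_eq_iff sum_power2_eq_zero_iff simp flip: power2_eq_square)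
    have cont: "continuous_map ?X euclideanreal (\<lambda>u. \<Prod>k<r. Re (D u k * cnj (D u k)))"
    proof -
      have "complex_smooth (index G) (topspace ?X) (\<lambda>u. D u k)" if "k < r" for k
        unfolding D_def using ms[OF that]
        by (intro complex_smooth_det[of _ _ n] matrix_smooth_add matrix_smooth_const) auto
      then have "Cinf_on (index G) (topspace ?X) (\<lambda>u. Re (D u k * cnj (D u k)))" if "k < r" for k
        using that by (intro Cinf_on_Re complex_smooth_mult complex_smooth_cnj) auto
      then have "Ck_on (index G) 0 (topspace ?X) (\<lambda>u. Re (D u k * cnj (D u k)))" if "k < r" for k
        using that unfolding Cinf_on_def by blast
      then have "continuous_map ?X euclideanreal (\<lambda>u. Re (D u k * cnj (D u k)))" if "k < r" for k
        using that unfolding Ck_on.simps subtopology_topspace .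
      then show ?thesis by (intro continuous_map_prod) auto
    qed
    have openW: "openin ?X W"
      unfolding W_eq by (rule openin_continuous_map_preimage[OF cont]) (simp add: open_Compl flip: open_openin)
    have W_sub: "W \<subseteq> topspace ?X" by (auto simp: W_def)
    \<comment> \<open>At \<open>x0\<close> itself the translated matrix is the identity, and 1 + 1 =
      2 is invertible.\<close>
    have x0W: "coords G x0 \<in> W"
    proof -
      have "1\<^sub>m n + 1\<^sub>m n = (2 :: complex) \<cdot>\<^sub>m 1\<^sub>m n" by (intro eq_matI) auto
      then show ?thesis using x0 A by (simp add: W_def coords_ext D_def lin_coords A_def[symmetric])
    qed
    define S where "S = {y \<in> carrier G. coords G y \<in> W}"
    define Q where "Q u k = cayley n (mat_adjoint (A k) * lin u k)" for u k
    \<comment> \<open>Real plus imaginary part undoes \<open>skew\<close>, whose entry (i, j) has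
      real part (v_ij - v_ji)/2 and imaginary part (v_ij + v_ji)/2.\<close>
    define F where "F u t = (case \<beta> t of (k, i, j) \<Rightarrow> Re (Q u k $$ (i, j)) + Im (Q u k $$ (i, j)))" for u t
    define g where "g y = (\<lambda>t\<in>{..<N}. F (coords G y) t)" for y
    define P where "P v k = A k * cayley n (skew v b k)" for v k
    define g' where "g' v = h_inv (\<lambda>k\<in>{..<r}. P v k)" for v
    have cs: "cayley n (skew v b k) \<in> carrier_mat n n" for v k
      by (intro cayley_carrier skew det_one_plus_skew)
    have P: "P v k \<in> carrier_mat n n" "mat_adjoint (P v k) * P v k = 1\<^sub>m n"
      "mat_adjoint (A k) * P v k = cayley n (skew v b k)" if "k < r" for v k
      using A[OF that] cs[of v k] unitary_mult[OF A(1)[OF that] A(3)[OF that] cs cayley_skew_unitary[OF skew]]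
      by (auto simp: P_def simp flip: assoc_mult_mat[of _ n n _ n _ n])
    note g'1 = h_inv[of "P _", OF P(1,2), folded g'_def]
    have g'S: "g' v \<in> S" for v
      using g'1 by (simp add: S_def W_def D_def coords_ext lin_coords P cayley_involution(1)
          skew(1) det_one_plus_skew[OF skew])
    have QS: "Q (coords G y) k \<in> carrier_mat n n" "mat_adjoint (Q (coords G y) k) = - Q (coords G y) k"
      "cayley n (Q (coords G y) k) = mat_adjoint (A k) * h y k" if "y \<in> S" "k < r" for y k
    proof -
      have y: "y \<in> carrier G" and d: "det (1\<^sub>m n + mat_adjoint (A k) * h y k) \<noteq> 0"
        using that by (auto simp: S_def W_def D_def lin_coords)
      let ?Z = "mat_adjoint (A k) * h y k"
      have Z: "?Z \<in> carrier_mat n n" "mat_adjoint ?Z * ?Z = 1\<^sub>m n"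
        using A[OF that(2)] h_unitary[OF y that(2)] by (auto intro!: unitary_mult)
      show "Q (coords G y) k \<in> carrier_mat n n" "mat_adjoint (Q (coords G y) k) = - Q (coords G y) k"
        "cayley n (Q (coords G y) k) = ?Z"
        using cayley_carrier[OF Z(1) d] cayley_unitary_skew[OF Z d] cayley_involution(2)[OF Z(1) d] that y
        by (simp_all add: Q_def lin_coords)
    qed
    have g'g: "g' (g y) = y" if y: "y \<in> S" for y
    proof (rule h_eqI)
      fix k assume k: "k < r"
      have "skew (g y) b k = Q (coords G y) k" (is "_ = ?Q")
      proof (rule eq_matI)
        fix i j assume "i < dim_row ?Q" "j < dim_col ?Q"
        then have ij: "i < n" "j < n" using QS(1)[OF y k] by auto
        have e: "cnj (?Q $$ (j, i)) = - ?Q $$ (i, j)"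
          using arg_cong[OF QS(2)[OF y k], of "\<lambda>M. M $$ (i, j)"] QS(1)[OF y k] ij by simp
        have gb: "g y (b (k, i, j)) = Re (?Q $$ (i, j)) + Im (?Q $$ (i, j))"
           "g y (b (k, j, i)) = Re (?Q $$ (j, i)) + Im (?Q $$ (j, i))"
          using b[of "(k, i, j)"] b[of "(k, j, i)"] k ij by (simp_all add: g_def F_def B_def)
        show "skew (g y) b k $$ (i, j) = ?Q $$ (i, j)"
          using e ij by (simp add: skew_def gb complex_eq_iff field_simps)
      qed (use QS(1)[OF y k] in \<open>auto simp: skew_def\<close>)
      then have "h (g' (g y)) k = A k * (mat_adjoint (A k) * h y k)"
        using g'1(2)[OF _ _ k] QS(3)[OF y k] P k by (simp add: P_def)
      also have "\<dots> = h y k"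
        using A[OF k] h_unitary(1)[of y k] y k by (simp add: S_def flip: assoc_mult_mat[of _ n n _ n _ n])
      finally show "h (g' (g y)) k = h y k" .
    qed (use g'S y in \<open>auto simp: S_def\<close>)
    have gg': "g (g' v) = v" if v: "v \<in> ?V" for v
    proof (rule PiE_ext[OF _ v])
      show "g (g' v) \<in> ?V" by (simp add: g_def)
      fix t assume "t \<in> {..<N}"
      then have t: "t < N" by simp
      obtain k i j where kij: "\<beta> t = (k, i, j)" by (metis prod_cases3)
      with b\<beta>[OF t] have kij': "k < r" "i < n" "j < n" "b (k, i, j) = t" by (auto simp: B_def)
      have "Q (coords G (g' v)) k = skew v b k"
        using g'S[of v] kij' g'1 P by (simp add: Q_def lin_coords S_def cayley_involution(2) skew(1) det_one_plus_skew[OF skew])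
      then show "g (g' v) t = v t"
        using t kij kij' by (simp add: g_def F_def skew_def field_simps)
    qed
    have bijg: "bij_betw g S ?V"
      by (rule bij_betw_byWitness[of S g' g])
         (use g'g gg' g'S in \<open>blast, blast, simp add: g_def image_subset_iff, blast\<close>)
    have inv_g: "inv_into S g v = g' v" if "v \<in> ?V" for v
      using g'S gg' that by (intro inv_into_f_eq bij_betw_imp_inj_on[OF bijg]) auto
    have sm1: "smooth_map S (index G) (coords G) ?V {..<N} id g"
    proof (rule smooth_mapI[OF _ openW])
      show "g \<in> S \<rightarrow> ?V" by (auto simp: g_def)
      show "coords G ` S \<subseteq> W" by (auto simp: S_def)
      show "F (coords G y) t = id (g y) t" if "t \<in> {..<N}" for y t using that by (simp add: g_def)
      show "Cinf_on (index G) W (\<lambda>u. F u t)" if "t \<in> {..<N}" for t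
      proof -
        obtain k i j where kij: "\<beta> t = (k, i, j)" by (metis prod_cases3)
        with b\<beta>[of t] that have kij': "k < r" "i < n" "j < n" by (auto simp: B_def)
        have "matrix_smooth (index G) W n (\<lambda>u. Q u k)"
          unfolding Q_def using ms[OF kij'(1)] kij'(1) W_sub
          by (intro matrix_smooth_cayley) (auto simp: W_def D_def)
        then show ?thesis unfolding F_def kij using kij'
          by (auto simp: matrix_smooth_def intro!: Cinf_on_add Cinf_on_Re Cinf_on_Im)
      qed
    qed
    have "smooth_map ?V {..<N} id S (index G) (coords G) g'"
    proof (rule smooth_map_into[where U = ?V and M = P])
      show "openin (powertop_real {..<N}) ?V"
        using openin_topspace[of "powertop_real {..<N}"] by (simp add: topspace_product_topology)
      show "matrix_smooth {..<N} ?V n (\<lambda>v. P v k)" if "k < r" for k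
      proof -
        have "matrix_smooth {..<N} ?V n (\<lambda>v. skew v b k)"
          unfolding skew_def using b[of "(k, _, _)"] that
          by (intro matrix_smooth_mat complex_smooth_add complex_smooth_mult complex_smooth_const
              complex_smooth_coordinate) (auto simp: B_def)
        then show ?thesis unfolding P_def using A[OF that] det_one_plus_skew[OF skew]
          by (intro matrix_smooth_mult matrix_smooth_const matrix_smooth_cayley)
             (auto simp: topspace_product_topology)
      qed
      show "P (id v) k = h (g' v) k" if "k < r" for v k using g'1(2)[OF _ _ that] P by simp
    qed (use g'S in \<open>auto simp: S_def\<close>)
    then have "smooth_map ?V {..<N} id S (index G) (coords G) (inv_into S g)"
      by (rule smooth_map_cong) (simp add: inv_g)
    then have "diffeo S (index G) (coords G) ?V {..<N} id g"
      using bijg sm1 by (simp add: diffeo_def)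
    moreover have "openin (powertop_real {..<N}) ?V"
      using openin_topspace[of "powertop_real {..<N}"] by (simp add: topspace_product_topology)
    ultimately show ?thesis using openW x0W unfolding S_def by blast
  qed
  then have "submanifold N (carrier G) (index G) (coords G)"
    using finite_index coords_ext inj_coords by (auto simp: submanifold_def)
  then show ?thesis ..
qed

lemma lie_group: "lie_group G"
proof -
  interpret group G by (rule is_group)
  let ?I = "index G <+> index G" and ?\<phi> = "\<lambda>(x, y). case_sum (coords G x) (coords G y)"
  have "smooth_map (carrier G \<times> carrier G) ?I ?\<phi> (carrier G) (index G) (coords G) (\<lambda>(x, y). x \<otimes>\<^bsub>G\<^esub> y)"
  proof (rule smooth_map_into[OF _ _ openin_topspace,
        where M = "\<lambda>u k. lin (\<lambda>a. u (Inl a)) k * lin (\<lambda>a. u (Inr a)) k"])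
    show "?\<phi> ` (carrier G \<times> carrier G) \<subseteq> topspace (powertop_real ?I)"
    proof -
      \<comment> \<open>Coordinates are \<open>undefined\<close> off the index set, hence so is
        their \<open>case_sum\<close> off \<open>?I\<close>, as membership in the topspace
        demands.\<close>
      have "a \<in> index G" if "x \<in> carrier G" "coords G x a \<noteq> undefined" for x a
        using PiE_arb[OF coords_ext] that by blast
      then show ?thesis by (auto simp: PiE_iff extensional_def split: sum.splits)
    qed
  next
    fix k assume "k < r"
    show "matrix_smooth ?I (topspace (powertop_real ?I)) n
       (\<lambda>u. lin (\<lambda>a. u (Inl a)) k * lin (\<lambda>a. u (Inr a)) k)"
      by (intro matrix_smooth_mult matrix_smooth_lin) (auto simp: Cinf_on_def intro!: Ck_on_coordinate)
  qed (auto simp: lin_coords h_mult)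
  moreover have "smooth_map (carrier G) (index G) (coords G) (carrier G) (index G) (coords G) (\<lambda>x. inv\<^bsub>G\<^esub> x)"
    by (rule smooth_map_into[OF _ _ openin_topspace, where M = "\<lambda>u k. mat_adjoint (lin u k)"])
       (auto simp: lin_coords h_group_inv dest: coords_topspace simp del: topspace_product_topology intro!: matrix_smooth_adjoint matrix_smooth_lin_id)
  ultimately show ?thesis using is_group submanifold by (simp add: lie_group_def)
qed

end

text \<open>On matrix tuples the isomorphism and its inverse are both the identity, so in each
  direction \<open>lin\<close> of the source is already the smooth extension.\<close>

lemma lie_isomorphic_if_unitary_coordinates:
  assumes "unitary_coordinates G r n h c c'" "unitary_coordinates H r n k e e'"
  shows "lie_isomorphic G H"
proof -
  interpret G: unitary_coordinates G r n h c c' by fact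
  interpret H: unitary_coordinates H r n k e e' by fact
  define f where "f x = inv_into (carrier H) k (h x)" for x
  have f: "f x \<in> carrier H" "k (f x) = h x" if "x \<in> carrier G" for x
    using G.h_ext[OF that] H.bij bij_betwE[OF bij_betw_inv_into[OF H.bij]]
    by (auto simp: f_def bij_betw_inv_into_right)
  have bijf: "bij_betw f (carrier G) (carrier H)"
    using bij_betw_trans[OF G.bij bij_betw_inv_into[OF H.bij]] by (simp add: f_def[abs_def] comp_def)
  have inv_f: "inv_into (carrier G) f y \<in> carrier G" "h (inv_into (carrier G) f y) = k y" if "y \<in> carrier H" for y
    using f[of "inv_into (carrier G) f y"] that bij_betwE[OF bij_betw_inv_into[OF bijf]] bij_betw_inv_into_right[OF bijf]
    by auto
  have "smooth_map (carrier G) (index G) (coords G) (carrier H) (index H) (coords H) f"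
    by (rule H.smooth_map_into[OF _ _ openin_topspace, where M = G.lin])
       (auto simp: f G.lin_coords dest: G.coords_topspace simp del: topspace_product_topology intro!: G.matrix_smooth_lin_id)
  moreover have "smooth_map (carrier H) (index H) (coords H) (carrier G) (index G) (coords G) (inv_into (carrier G) f)"
    by (rule G.smooth_map_into[OF _ _ openin_topspace, where M = H.lin])
       (auto simp: inv_f H.lin_coords dest: H.coords_topspace simp del: topspace_product_topology intro!: H.matrix_smooth_lin_id)
  moreover have "f \<in> iso G H"
    using bijf f by (auto simp: iso_def hom_def G.mult_closed H.mult_closed G.h_mult H.h_mult intro!: H.h_eqI)
  ultimately show ?thesis using G.lie_group H.lie_group bijf by (auto simp: lie_isomorphic_def diffeo_def)
qed


section \<open>From complex to real coordinates; the classical unitary groups\<close>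

lemma sum_realify:
  fixes f :: "'p \<Rightarrow> complex"
  shows "(\<Sum>p\<in>P. f p * u p) = (\<Sum>a\<in>P \<times> UNIV. (f (fst a) * (if snd a then \<i> else 1)) * of_real (realify P u a))"
proof -
  have "(\<Sum>a\<in>P \<times> UNIV. (f (fst a) * (if snd a then \<i> else 1)) * of_real (realify P u a)) =
    (\<Sum>p\<in>P. \<Sum>b\<in>UNIV. (f p * (if b then \<i> else 1)) * of_real (realify P u (p, b)))"
    by (simp add: sum.cartesian_product case_prod_beta)
  also have "\<dots> = (\<Sum>p\<in>P. f p * u p)"
    by (intro sum.cong refl) (simp add: UNIV_bool realify_def complex_eq_iff algebra_simps)
  finally show ?thesis ..
qed

text \<open>The Boolean in an index separates real from imaginary parts. Forward, u = Re u + i Im u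
  puts the factor \<open>\<i>\<close> on the imaginary coordinates; backward, Im z = Re (-i z)
  accounts for the factor \<open>- \<i>\<close>.\<close>

lemma unitary_coordinatesI:
  fixes G :: "('a, 'p \<times> bool) coord_group" and u :: "'a \<Rightarrow> 'p \<Rightarrow> complex"
  assumes G: "index G = P \<times> UNIV" "finite P" "\<And>x. coords G x = realify P (u x)"
    and "bij_betw h (carrier G) ({..<r} \<rightarrow>\<^sub>E carrier (unitary_matrices n))"
    and "\<And>x y. x \<in> carrier G \<Longrightarrow> y \<in> carrier G \<Longrightarrow> x \<otimes>\<^bsub>G\<^esub> y \<in> carrier G"
    and "\<And>x y k. x \<in> carrier G \<Longrightarrow> y \<in> carrier G \<Longrightarrow> k < r \<Longrightarrow> h (x \<otimes>\<^bsub>G\<^esub> y) k = h x k * h y k"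
    and "\<one>\<^bsub>G\<^esub> \<in> carrier G"
    and "\<And>k. k < r \<Longrightarrow> h \<one>\<^bsub>G\<^esub> k = 1\<^sub>m n"
    and f: "\<And>x k i j. x \<in> carrier G \<Longrightarrow> k < r \<Longrightarrow> i < n \<Longrightarrow> j < n \<Longrightarrow>
      h x k $$ (i, j) = (\<Sum>p\<in>P. f k i j p * u x p)"
    and f': "\<And>x p. x \<in> carrier G \<Longrightarrow> p \<in> P \<Longrightarrow>
      u x p = (\<Sum>k<r. \<Sum>i<n. \<Sum>j<n. f' p k i j * h x k $$ (i, j))"
  shows "unitary_coordinates G r n h (\<lambda>k i j a. f k i j (fst a) * (if snd a then \<i> else 1))
    (\<lambda>a k i j. (if snd a then - \<i> else 1) * f' (fst a) k i j)"
proof (unfold_locales, goal_cases)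
  case (2 x)
  show ?case by (auto simp: G realify_def)
next
  case (8 x k i j)
  show ?case unfolding f[OF 8] G(1,3) by (rule sum_realify)
next
  case (9 x a)
  then obtain p b where a: "a = (p, b)" "p \<in> P" unfolding G(1) by blast
  have "Re (\<Sum>k<r. \<Sum>i<n. \<Sum>j<n. (if b then - \<i> else 1) * f' p k i j * h x k $$ (i, j)) =
    Re ((if b then - \<i> else 1) * u x p)"
    unfolding f'[OF 9(1) a(2)] sum_distrib_left by (simp only: mult.assoc)
  then show ?case using a by (auto simp: G realify_def)
qed (use assms(1-8) in auto)

lemma unitary_coordinates_power:
  "\<exists>c c'. unitary_coordinates (unitary_matrices_power r n) r n (\<lambda>A. A) c c'"
proof -
  let ?G = "unitary_matrices_power r n" and ?P = "{..<r} \<times> {..<n} \<times> {..<n}"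
  have "unitary_coordinates ?G r n (\<lambda>A. A)
      (\<lambda>k i j a. (if fst a = (k, i, j) then 1 else 0) * (if snd a then \<i> else 1))
      (\<lambda>a k i j. (if snd a then - \<i> else 1) * (if fst a = (k, i, j) then 1 else 0))"
  proof (rule unitary_coordinatesI[where P = ?P and u = "\<lambda>A (k, p). A k $$ p"])
    fix A B assume "A \<in> carrier ?G" "B \<in> carrier ?G"
    then show "A \<otimes>\<^bsub>?G\<^esub> B \<in> carrier ?G"
      by (auto simp: unitary_matrices_power_def monoid.extend_def unitary_matrices_def PiE_iff intro!: unitary_mult mult_carrier_mat[of _ n n _ n])
  next
    fix A k i j assume "A \<in> carrier ?G" "k < r" "i < n" "j < n"
    then show "A k $$ (i, j) = (\<Sum>p\<in>?P. (if p = (k, i, j) then 1 else 0) * (case p of (k, p) \<Rightarrow> A k $$ p))"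
      by (subst sum.mono_neutral_right[where S = "{(k, i, j)}"]) auto
  next
    fix A :: "nat \<Rightarrow> complex mat" and p assume p: "p \<in> ?P"
    then obtain k i j where kij: "p = (k, i, j)" "k < r" "i < n" "j < n" by auto
    have "(\<Sum>k<r. \<Sum>i<n. \<Sum>j<n. (if p = (k, i, j) then 1 else 0) * A k $$ (i, j)) =
      (\<Sum>q\<in>?P. (if p = q then 1 else 0) * (case q of (k, p) \<Rightarrow> A k $$ p))"
      by (simp add: sum.cartesian_product case_prod_beta)
    also have "\<dots> = A k $$ (i, j)"
      using kij by (subst sum.mono_neutral_right[where S = "{(k, i, j)}"]) auto
    finally show "(case p of (k, p) \<Rightarrow> A k $$ p) = (\<Sum>k<r. \<Sum>i<n. \<Sum>j<n. (if p = (k, i, j) then 1 else 0) * A k $$ (i, j))"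
      using kij by simp
  qed (auto simp: unitary_matrices_power_def monoid.extend_def unitary_matrices_def bij_betw_def PiE_iff)
  then show ?thesis by blast
qed

text \<open>A matrix counts as a family over \<open>{..<1}\<close>, so that the even case fits the
  locale with a single block.\<close>

lemma unitary_coordinates_matrices:
  "\<exists>c c'. unitary_coordinates (unitary_matrices n) 1 n (\<lambda>A. \<lambda>k\<in>{..<1}. A) c c'"
proof -
  let ?G = "unitary_matrices n" and ?P = "{..<n} \<times> {..<n}" and ?h = "\<lambda>A. \<lambda>k\<in>{..<1::nat}. A :: complex mat"
  have "unitary_coordinates ?G 1 n ?h
      (\<lambda>k i j a. (if fst a = (i, j) then 1 else 0) * (if snd a then \<i> else 1))
      (\<lambda>a k i j. (if snd a then - \<i> else 1) * (if fst a = (i, j) then 1 else 0))"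
  proof (rule unitary_coordinatesI[where P = ?P and u = "\<lambda>A p. A $$ p"])
    show "bij_betw ?h (carrier ?G) ({..<1} \<rightarrow>\<^sub>E carrier ?G)"
      by (rule bij_betw_byWitness[where f' = "\<lambda>B. B 0"]) (auto simp: PiE_iff extensional_def fun_eq_iff)
  next
    fix A B assume "A \<in> carrier ?G" "B \<in> carrier ?G"
    then show "A \<otimes>\<^bsub>?G\<^esub> B \<in> carrier ?G"
      by (auto simp: unitary_matrices_def intro!: unitary_mult mult_carrier_mat[of _ n n _ n])
  next
    fix A and k i j :: nat assume "A \<in> carrier ?G" "k < 1" "i < n" "j < n"
    then show "?h A k $$ (i, j) = (\<Sum>p\<in>?P. (if p = (i, j) then 1 else 0) * A $$ p)"
      by (subst sum.mono_neutral_right[where S = "{(i, j)}"]) auto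
  next
    fix A :: "complex mat" and p assume p: "p \<in> ?P"
    then obtain i j where ij: "p = (i, j)" "i < n" "j < n" by auto
    have "(\<Sum>k<1::nat. \<Sum>i<n. \<Sum>j<n. (if p = (i, j) then 1 else 0) * ?h A k $$ (i, j)) =
      (\<Sum>q\<in>?P. (if p = q then 1 else 0) * A $$ q)"
      by (simp add: sum.cartesian_product case_prod_beta)
    also have "\<dots> = A $$ p"
      using ij by (subst sum.mono_neutral_right[where S = "{(i, j)}"]) auto
    finally show "A $$ p = (\<Sum>k<1::nat. \<Sum>i<n. \<Sum>j<n. (if p = (i, j) then 1 else 0) * ?h A k $$ (i, j))" ..
  qed (auto simp: unitary_matrices_def)
  then show ?thesis by blast
qed

section \<open>Unitary matrices satisfying the Clifford relations\<close>

lemma omega_cis: "clifford_omega m = cis (2 * pi / m)"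
  by (simp add: clifford_omega_def cis_conv_exp mult_ac)

lemma omega_cnj [simp]: "clifford_omega m * cnj (clifford_omega m) = 1" "cnj (clifford_omega m) * clifford_omega m = 1"
  by (simp_all add: omega_cis cis_cnj cis_mult)

lemma omega_power_m: "m > 0 \<Longrightarrow> clifford_omega m ^ m = 1"
  by (simp add: omega_cis Complex.DeMoivre)

text \<open>The root of unity is primitive, which allows equal phases to be turned back into equal
  exponents.\<close>

lemma omega_power_inj:
  assumes "clifford_omega m ^ a = clifford_omega m ^ b" "a < m" "b < m"
  shows "a = b"
proof -
  have "inj_on (\<lambda>k. cis (2 * pi * real k / real m)) {..<m}"
    using Complex.bij_betw_roots_unity[of m] assms by (auto simp: bij_betw_def)
  moreover have "clifford_omega m ^ k = cis (2 * pi * real k / real m)" for k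
    by (simp add: omega_cis Complex.DeMoivre mult_ac)
  ultimately show ?thesis using assms by (auto simp: inj_on_def)
qed

lemma one_pow_mat [simp]: "1\<^sub>m n ^\<^sub>m k = (1\<^sub>m n :: 'a :: semiring_1 mat)"
  by (induction k) auto

section \<open>Kronecker products\<close>

definition kron :: "nat \<Rightarrow> nat \<Rightarrow> complex mat \<Rightarrow> complex mat \<Rightarrow> complex mat" where
  "kron n m A B = mat (n * m) (n * m) (\<lambda>(i, j). A $$ (i div m, j div m) * B $$ (i mod m, j mod m))"

lemma div_less_factor: "(k :: nat) < n * m \<Longrightarrow> k div m < n"
  by (simp add: less_mult_imp_div_less)

lemma mod_less_factor: "(k :: nat) < n * m \<Longrightarrow> k mod m < m"
  by (cases "m = 0") auto

lemma sum_div_mod: "(\<Sum>k<n * m. f (k div m) (k mod m)) = (\<Sum>a<n. \<Sum>b<m. f a (b :: nat))"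
  unfolding sum.cartesian_product
proof (rule sum.reindex_bij_witness[where j = "\<lambda>k. (k div m, k mod m)" and i = "\<lambda>(a, b). a * m + b"], goal_cases)
  case (4 p)
  obtain a b where p: "p = (a, b)" "a < n" "b < m" using 4 by auto
  have "a * m + b < Suc a * m" using p by simp
  also have "\<dots> \<le> n * m" using p by (intro mult_le_mono1) simp
  finally show ?case using p by simp
qed (auto simp: div_less_factor mod_less_factor)

lemma kron_carrier [simp]: "kron n m A B \<in> carrier_mat (n * m) (n * m)"
  by (simp add: kron_def)

lemma kron_mult:
  assumes "A \<in> carrier_mat n n" "C \<in> carrier_mat n n" "B \<in> carrier_mat m m" "D \<in> carrier_mat m m"
  shows "kron n m A B * kron n m C D = kron n m (A * C) (B * D)"
proof (rule eq_matI)
  fix i j assume "i < dim_row (kron n m (A * C) (B * D))" "j < dim_col (kron n m (A * C) (B * D))"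
  then have ij: "i < n * m" "j < n * m" by (auto simp: kron_def)
  have "(kron n m A B * kron n m C D) $$ (i, j) =
    (\<Sum>k<n * m. (A $$ (i div m, k div m) * B $$ (i mod m, k mod m)) * (C $$ (k div m, j div m) * D $$ (k mod m, j mod m)))"
    using ij by (simp add: kron_def scalar_prod_def atLeast0LessThan)
  also have "\<dots> = (\<Sum>a<n. \<Sum>b<m. (A $$ (i div m, a) * B $$ (i mod m, b)) * (C $$ (a, j div m) * D $$ (b, j mod m)))"
    by (rule sum_div_mod)
  also have "\<dots> = (\<Sum>a<n. A $$ (i div m, a) * C $$ (a, j div m)) * (\<Sum>b<m. B $$ (i mod m, b) * D $$ (b, j mod m))"
    by (simp add: sum_product mult_ac)
  also have "\<dots> = (A * C) $$ (i div m, j div m) * (B * D) $$ (i mod m, j mod m)"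
    using assms ij div_less_factor[OF ij(1)] div_less_factor[OF ij(2)] mod_less_factor[OF ij(1)] mod_less_factor[OF ij(2)]
    by (simp add: scalar_prod_def atLeast0LessThan)
  finally show "(kron n m A B * kron n m C D) $$ (i, j) = kron n m (A * C) (B * D) $$ (i, j)"
    using ij by (simp add: kron_def)
qed (auto simp: kron_def)

lemma kron_adjoint:
  assumes "A \<in> carrier_mat n n" "B \<in> carrier_mat m m"
  shows "mat_adjoint (kron n m A B) = kron n m (mat_adjoint A) (mat_adjoint B)"
  using assms by (intro eq_matI) (auto simp: kron_def div_less_factor mod_less_factor)

lemma kron_one: "kron n m (1\<^sub>m n) (1\<^sub>m m) = 1\<^sub>m (n * m)"
proof (rule eq_matI)
  fix i j assume "i < dim_row (1\<^sub>m (n * m) :: complex mat)" "j < dim_col (1\<^sub>m (n * m) :: complex mat)"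
  then have ij: "i < n * m" "j < n * m" by auto
  have "i = j \<longleftrightarrow> i div m = j div m \<and> i mod m = j mod m" by (metis div_mult_mod_eq)
  then show "kron n m (1\<^sub>m n) (1\<^sub>m m) $$ (i, j) = 1\<^sub>m (n * m) $$ (i, j)"
    using ij by (auto simp: kron_def div_less_factor mod_less_factor)
qed (auto simp: kron_def)

lemma kron_smult_left: "A \<in> carrier_mat n n \<Longrightarrow> kron n m (c \<cdot>\<^sub>m A) B = c \<cdot>\<^sub>m kron n m A B"
  by (intro eq_matI) (auto simp: kron_def div_less_factor)

lemma kron_smult_right: "B \<in> carrier_mat m m \<Longrightarrow> kron n m A (c \<cdot>\<^sub>m B) = c \<cdot>\<^sub>m kron n m A B"
  by (intro eq_matI) (auto simp: kron_def mod_less_factor)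

lemma kron_pow:
  assumes "A \<in> carrier_mat n n" "B \<in> carrier_mat m m"
  shows "kron n m A B ^\<^sub>m k = kron n m (A ^\<^sub>m k) (B ^\<^sub>m k)"
proof (induction k)
  case 0
  show ?case using assms kron_one by (auto simp: kron_def)
next
  case (Suc k)
  then show ?case using assms by (simp add: kron_mult pow_carrier_mat)
qed

section \<open>Clock and weighted shift matrices\<close>

definition clock :: "nat \<Rightarrow> complex mat" where
  "clock m = mat m m (\<lambda>(i, j). if i = j then clifford_omega m ^ i else 0)"

text \<open>A cyclic shift with weight \<open>\<tau> * \<zeta> ^ j\<close> on the j-th basis vector.
  Parameters 1, 1 give the plain shift, and \<open>\<zeta> = cnj (clifford_omega m)\<close> gives
  \<open>\<tau>\<close> times the plain shift after the inverse clock matrix. One family covers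
  both, so powers and commutation are computed once.\<close>

definition shift :: "nat \<Rightarrow> complex \<Rightarrow> complex \<Rightarrow> complex mat" where
  "shift m \<tau> \<zeta> = mat m m (\<lambda>(i, j). if i = Suc j mod m then \<tau> * \<zeta> ^ j else 0)"

lemma clock_carrier [simp]: "clock m \<in> carrier_mat m m" and shift_carrier [simp]: "shift m \<tau> \<zeta> \<in> carrier_mat m m"
  by (simp_all add: clock_def shift_def)

lemma dim_clock_shift [simp]: "dim_row (clock m) = m" "dim_col (clock m) = m"
  "dim_row (shift m \<tau> \<zeta>) = m" "dim_col (shift m \<tau> \<zeta>) = m"
  by (simp_all add: clock_def shift_def)

lemma cnj_power_one: "cnj z * z = 1 \<Longrightarrow> cnj z ^ k * z ^ k = 1" for z :: complex
  by (simp flip: power_mult_distrib)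

lemma clock_unitary: "mat_adjoint (clock m) * clock m = 1\<^sub>m m"
proof (intro eq_matI)
  fix i j assume "i < dim_row (1\<^sub>m m :: complex mat)" "j < dim_col (1\<^sub>m m :: complex mat)"
  then show "(mat_adjoint (clock m) * clock m) $$ (i, j) = 1\<^sub>m m $$ (i, j)"
    by (simp add: clock_def scalar_prod_def if_distrib[of cnj] if_distrib[of "\<lambda>x. x * _"] if_distrib[of "\<lambda>x. _ * x"] cnj_power_one cong: if_cong)
qed auto

lemma clock_pow: "clock m ^\<^sub>m k = mat m m (\<lambda>(i, j). if i = j then clifford_omega m ^ (k * i) else 0)"
proof (induction k)
  case 0
  show ?case by (intro eq_matI) (auto simp: clock_def)
next
  case (Suc k)
  have "clock m ^\<^sub>m Suc k = mat m m (\<lambda>(i, j). if i = j then clifford_omega m ^ (k * i) else 0) * clock m"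
    by (simp add: Suc)
  also have "\<dots> = mat m m (\<lambda>(i, j). if i = j then clifford_omega m ^ (Suc k * i) else 0)"
    by (intro eq_matI) (auto simp: clock_def scalar_prod_def if_distrib[of "\<lambda>x. x * _"] if_distrib[of "\<lambda>x. _ * x"] power_add mult.commute cong: if_cong)
  finally show ?case .
qed

lemma clock_pow_m: "m > 0 \<Longrightarrow> clock m ^\<^sub>m m = 1\<^sub>m m"
  unfolding clock_pow by (intro eq_matI) (auto simp: power_mult omega_power_m)

lemma Suc_mod_inj: "i < m \<Longrightarrow> j < m \<Longrightarrow> Suc i mod m = Suc j mod m \<Longrightarrow> i = j"
  by (auto simp: mod_Suc split: if_splits)

lemma power_mod: "\<zeta> ^ m = 1 \<Longrightarrow> \<zeta> ^ (k mod m) = \<zeta> ^ k" for \<zeta> :: "'a :: monoid_mult"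
  by (metis div_mult_mod_eq mult.commute power_add power_mult power_one mult_1)

lemma shift_unitary:
  assumes "m > 0" "cnj \<tau> * \<tau> = 1" "cnj \<zeta> * \<zeta> = 1"
  shows "mat_adjoint (shift m \<tau> \<zeta>) * shift m \<tau> \<zeta> = 1\<^sub>m m"
proof (intro eq_matI)
  fix i j assume "i < dim_row (1\<^sub>m m :: complex mat)" "j < dim_col (1\<^sub>m m :: complex mat)"
  then have ij: "i < m" "j < m" by auto
  have "(mat_adjoint (shift m \<tau> \<zeta>) * shift m \<tau> \<zeta>) $$ (i, j) =
    (\<Sum>k<m. if k = Suc i mod m then (if k = Suc j mod m then cnj (\<tau> * \<zeta> ^ i) * (\<tau> * \<zeta> ^ j) else 0) else 0)"
    using ij by (simp add: scalar_prod_def atLeast0LessThan del: sum.delta sum.delta') (intro sum.cong, auto simp: shift_def)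
  also have "\<dots> = (if i = j then 1 else 0)"
    using ij assms Suc_mod_inj[OF ij] cnj_power_one[OF assms(3), of i] by (auto simp: mult_ac)
  finally show "(mat_adjoint (shift m \<tau> \<zeta>) * shift m \<tau> \<zeta>) $$ (i, j) = 1\<^sub>m m $$ (i, j)" using ij by simp
qed auto

text \<open>The weights met from the j-th basis vector on are those at j, j + 1, and so on. Their
  positions need no reduction modulo \<open>m\<close> because
  \<open>\<zeta> ^ m = 1\<close>.\<close>

lemma shift_pow:
  assumes "m > 0" "\<zeta> ^ m = 1"
  shows "shift m \<tau> \<zeta> ^\<^sub>m k = mat m m (\<lambda>(i, j). if i = (j + k) mod m then \<Prod>s<k. \<tau> * \<zeta> ^ (j + s) else 0)"
proof (induction k)
  case 0
  show ?case by (intro eq_matI) (auto simp: shift_def)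
next
  case (Suc k)
  let ?M = "\<lambda>k. mat m m (\<lambda>(i, j). if i = (j + k) mod m then \<Prod>s<k. \<tau> * \<zeta> ^ (j + s) else 0)"
  have "shift m \<tau> \<zeta> ^\<^sub>m Suc k = ?M k * shift m \<tau> \<zeta>" by (simp add: Suc)
  also have "\<dots> = ?M (Suc k)"
  proof (intro eq_matI)
    fix i j assume "i < dim_row (?M (Suc k))" "j < dim_col (?M (Suc k))"
    then have ij: "i < m" "j < m" by auto
    have "(?M k * shift m \<tau> \<zeta>) $$ (i, j) =
      (\<Sum>l<m. if l = Suc j mod m then (if i = (l + k) mod m then (\<Prod>s<k. \<tau> * \<zeta> ^ (l + s)) * (\<tau> * \<zeta> ^ j) else 0) else 0)"
      using ij by (simp add: scalar_prod_def atLeast0LessThan del: sum.delta sum.delta') (intro sum.cong, auto simp: shift_def)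
    also have "\<dots> = (if i = (Suc j mod m + k) mod m then (\<Prod>s<k. \<tau> * \<zeta> ^ (Suc j mod m + s)) * (\<tau> * \<zeta> ^ j) else 0)"
      using assms by simp
    also have "(\<Prod>s<k. \<tau> * \<zeta> ^ (Suc j mod m + s)) = (\<Prod>s<k. \<tau> * \<zeta> ^ (j + Suc s))"
      by (simp add: power_add power_mod[OF assms(2)] mult_ac)
    also have "(\<Prod>s<k. \<tau> * \<zeta> ^ (j + Suc s)) * (\<tau> * \<zeta> ^ j) = (\<Prod>s<Suc k. \<tau> * \<zeta> ^ (j + s))"
      by (subst prod.lessThan_Suc_shift) (simp add: mult_ac)
    finally show "(?M k * shift m \<tau> \<zeta>) $$ (i, j) = ?M (Suc k) $$ (i, j)"
      using ij by (simp add: mod_simps)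
  qed auto
  finally show ?case .
qed

text \<open>After m steps the j-th basis vector returns with total weight tau^m zeta^(m j) zeta^(0 +
  ... + (m - 1)), and the middle factor, the only one depending on j, is 1.\<close>

lemma shift_pow_m:
  assumes "m > 0" "\<zeta> ^ m = 1" "\<tau> ^ m * \<zeta> ^ (\<Sum>s<m. s) = 1"
  shows "shift m \<tau> \<zeta> ^\<^sub>m m = 1\<^sub>m m"
proof -
  have "(\<Prod>s<m. \<tau> * \<zeta> ^ (j + s)) = 1" for j
  proof -
    have "(\<Prod>s<m. \<tau> * \<zeta> ^ (j + s)) = \<tau> ^ m * ((\<zeta> ^ m) ^ j * \<zeta> ^ (\<Sum>s<m. s))"
      by (simp add: prod.distrib power_add power_sum flip: power_mult)  (simp add: mult.commute)
    then show ?thesis using assms by simp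
  qed
  then show ?thesis unfolding shift_pow[OF assms(1,2)] by (intro eq_matI) auto
qed

text \<open>From the j-th basis vector the clock matrix reads omega^j before the shift and
  omega^(j+1) after it; the wraparound is harmless since omega^m = 1.\<close>

lemma clock_shift:
  assumes "m > 0"
  shows "clock m * shift m \<tau> \<zeta> = clifford_omega m \<cdot>\<^sub>m (shift m \<tau> \<zeta> * clock m)"
proof (intro eq_matI)
  fix i j assume "i < dim_row (clifford_omega m \<cdot>\<^sub>m (shift m \<tau> \<zeta> * clock m))"
    "j < dim_col (clifford_omega m \<cdot>\<^sub>m (shift m \<tau> \<zeta> * clock m))"
  then have ij: "i < m" "j < m" by (auto simp: shift_def clock_def)
  have "(clock m * shift m \<tau> \<zeta>) $$ (i, j) = clifford_omega m ^ i * (if i = Suc j mod m then \<tau> * \<zeta> ^ j else 0)"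
    using ij by (simp add: clock_def shift_def scalar_prod_def if_distrib[of "\<lambda>x. x * _"] cong: if_cong)
  moreover have "(shift m \<tau> \<zeta> * clock m) $$ (i, j) = (if i = Suc j mod m then \<tau> * \<zeta> ^ j else 0) * clifford_omega m ^ j"
    using ij by (simp add: clock_def shift_def scalar_prod_def if_distrib[of "\<lambda>x. _ * x"] cong: if_cong)
  ultimately show "(clock m * shift m \<tau> \<zeta>) $$ (i, j) = (clifford_omega m \<cdot>\<^sub>m (shift m \<tau> \<zeta> * clock m)) $$ (i, j)"
    using ij power_mod[OF omega_power_m[OF assms], of "Suc j"] by (auto simp: clock_def shift_def mult_ac)
qed (auto simp: shift_def clock_def)

text \<open>On the j-th basis vector the two products have weights sigma xi^(j+1) tau zeta^j and
  sigma xi^j tau zeta^(j+1), so they differ by the factor xi / zeta, which is stated without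
  division.\<close>

lemma shift_shift:
  assumes "m > 0" "\<zeta> ^ m = 1" "\<xi> ^ m = 1"
  shows "\<zeta> \<cdot>\<^sub>m (shift m \<sigma> \<xi> * shift m \<tau> \<zeta>) = \<xi> \<cdot>\<^sub>m (shift m \<tau> \<zeta> * shift m \<sigma> \<xi>)"
proof -
  have e: "(shift m \<sigma> \<xi> * shift m \<tau> \<zeta>) $$ (i, j) =
      (if i = Suc (Suc j) mod m then (\<sigma> * \<xi> ^ Suc j) * (\<tau> * \<zeta> ^ j) else 0)"
    if ij: "i < m" "j < m" and z: "\<xi> ^ m = 1" for i j \<sigma> \<xi> \<tau> \<zeta>
  proof -
    have "(shift m \<sigma> \<xi> * shift m \<tau> \<zeta>) $$ (i, j) =
      (\<Sum>l<m. if l = Suc j mod m then (if i = Suc l mod m then (\<sigma> * \<xi> ^ l) * (\<tau> * \<zeta> ^ j) else 0) else 0)"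
      using ij by (simp add: scalar_prod_def atLeast0LessThan del: sum.delta sum.delta') (intro sum.cong, auto simp: shift_def)
    then show ?thesis using assms(1) power_mod[OF z, of "Suc j"] by (simp add: mod_Suc_eq)
  qed
  show ?thesis
    using e assms by (intro eq_matI) (auto simp: shift_def mult_ac)
qed

definition clifford_system :: "nat \<Rightarrow> nat \<Rightarrow> nat \<Rightarrow> (nat \<Rightarrow> complex mat) \<Rightarrow> bool" where
  "clifford_system m d n E \<longleftrightarrow>
     (\<forall>j\<in>{1..d}. E j \<in> carrier_mat n n \<and> mat_adjoint (E j) * E j = 1\<^sub>m n \<and> E j ^\<^sub>m m = 1\<^sub>m n) \<and>
     (\<forall>k\<in>{1..d}. \<forall>l\<in>{1..d}. k < l \<longrightarrow> E k * E l = clifford_omega m \<cdot>\<^sub>m (E l * E k))"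

text \<open>
  Two generators are added at a time: the last matrix \<open>E d\<close> is replaced by its tensor products with
  the clock matrix $A$, the cyclic shift $B$ and a multiple $C = \tau B A^{-1}$, which pairwise
  $\omega$-commute; the earlier ones are tensored with the identity.
\<close>

lemma clifford_system_exists:
  assumes "m > 0"
  shows "\<exists>E. clifford_system m (2 * q + 1) (m ^ q) E"
proof (induction q)
  case 0
  have "clifford_system m (2 * 0 + 1) (m ^ 0) (\<lambda>_. 1\<^sub>m 1)"
    by (simp add: clifford_system_def)
  then show ?case by blast
next
  case (Suc q)
  let ?n = "m ^ q" and ?d = "2 * q + 1" and ?w = "clifford_omega m"
  from Suc obtain E where E: "clifford_system m ?d ?n E" by blast
  \<comment> \<open>This scalar makes the \<open>m\<close>-th power of the third matrix the identity.\<close>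
  define \<tau> where "\<tau> = cis (pi * (real m - 1) / m)"
  have \<tau>: "\<tau> ^ m * cnj ?w ^ (\<Sum>s<m. s) = 1"
  proof -
    \<comment> \<open>\<open>\<tau> ^ m\<close> is e^(i pi (m - 1)), and the exponent sum m (m - 1)
      / 2 makes the conjugate of omega contribute e^(-i pi (m - 1)). The summation formula carries
      \<open>+ m\<close> to avoid subtracting naturals.\<close>
    have "2 * (\<Sum>s<m. s) + m = m * m" by (induction m) auto
    from arg_cong[OF this, of real] have s: "2 * real (\<Sum>s<m. s) = real m * (real m - 1)"
      by (simp add: algebra_simps del: of_nat_sum)
    have "real (\<Sum>s<m. s) * (2 * pi / m) = pi * (2 * real (\<Sum>s<m. s)) / m" by simp
    also have "\<dots> = pi * (real m * (real m - 1)) / m" by (simp only: s)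
    also have "\<dots> = pi * (real m - 1)" using assms by simp
    finally have "real (\<Sum>s<m. s) * (2 * pi / m) = pi * (real m - 1)" .
    then show ?thesis using assms
      by (simp add: \<tau>_def omega_cis cis_cnj Complex.DeMoivre cis_mult del: of_nat_sum)
  qed
  have wm: "cnj ?w ^ m = 1" using omega_power_m[OF assms] by (metis complex_cnj_one complex_cnj_power)
  define F where "F j = (if j = ?d then clock m else if j = ?d + 1 then shift m 1 1 else shift m \<tau> (cnj ?w))" for j
  have F: "F j \<in> carrier_mat m m" "mat_adjoint (F j) * F j = 1\<^sub>m m" "F j ^\<^sub>m m = 1\<^sub>m m" for j
    using assms \<tau> wm by (auto simp: F_def clock_unitary clock_pow_m \<tau>_def cis_cnj cis_mult intro!: shift_unitary shift_pow_m)
  have F2: "F k * F l = ?w \<cdot>\<^sub>m (F l * F k)" if "k < l" "?d \<le> k" "l \<le> ?d + 2" for k l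
  proof -
    have "shift m 1 1 * shift m \<tau> (cnj ?w) = ?w \<cdot>\<^sub>m (cnj ?w \<cdot>\<^sub>m (shift m 1 1 * shift m \<tau> (cnj ?w)))"
      by (simp add: smult_smult_mat one_smult_mat)
    also have "\<dots> = ?w \<cdot>\<^sub>m (shift m \<tau> (cnj ?w) * shift m 1 1)"
      using shift_shift[OF assms wm, of 1 1 \<tau>] by (simp add: one_smult_mat)
    finally show ?thesis using that assms by (auto simp: F_def clock_shift)
  qed
  \<comment> \<open>The three new matrices share the left factor \<open>E ?d\<close>. It supplies
    the phase against the old generators; among the new ones it commutes with itself, and the right
    factors \<open>F j\<close> supply the phase.\<close>
  define E' where "E' j = (if j < ?d then kron ?n m (E j) (1\<^sub>m m) else kron ?n m (E ?d) (F j))" for j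
  have c: "E j \<in> carrier_mat ?n ?n" "mat_adjoint (E j) * E j = 1\<^sub>m ?n" "E j ^\<^sub>m m = 1\<^sub>m ?n" if "1 \<le> j" "j \<le> ?d" for j
    using E that by (auto simp: clifford_system_def)
  have c2: "E k * E l = ?w \<cdot>\<^sub>m (E l * E k)" if "1 \<le> k" "k < l" "l \<le> ?d" for k l
    using E that by (auto simp: clifford_system_def)
  have "clifford_system m (2 * Suc q + 1) (m ^ Suc q) E'"
    unfolding clifford_system_def
  proof (intro conjI ballI impI)
    fix j assume "j \<in> {1..2 * Suc q + 1}"
    then have j: "1 \<le> j" by auto
    have nm: "m ^ Suc q = ?n * m" by simp
    show "E' j \<in> carrier_mat (m ^ Suc q) (m ^ Suc q)" by (simp add: E'_def nm del: power_Suc)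
    show "mat_adjoint (E' j) * E' j = 1\<^sub>m (m ^ Suc q)"
      using c[of j] c[of ?d] F[of j] j by (auto simp: E'_def nm kron_adjoint kron_mult kron_one simp del: power_Suc)
    show "E' j ^\<^sub>m m = 1\<^sub>m (m ^ Suc q)"
      using c[of j] c[of ?d] F[of j] j by (auto simp: E'_def nm kron_pow kron_one simp del: power_Suc)
  next
    fix k l assume kl: "k \<in> {1..2 * Suc q + 1}" "l \<in> {1..2 * Suc q + 1}" "k < l"
    consider "l < ?d" | "k < ?d" "?d \<le> l" | "?d \<le> k" by linarith
    then show "E' k * E' l = ?w \<cdot>\<^sub>m (E' l * E' k)"
    proof cases
      case 1
      with kl c[of k] c[of l] show ?thesis by (auto simp: E'_def kron_mult c2 kron_smult_left)
    next
      case 2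
      with kl c[of k] c[of ?d] F[of l] c2[of k ?d] show ?thesis by (auto simp: E'_def kron_mult kron_smult_left)
    next
      case 3
      with kl c[of ?d] F(1)[of l] F(1)[of k] F2[of k l] show ?thesis by (auto simp: E'_def kron_mult kron_smult_right)
    qed
  qed
  then show ?case by blast
qed


section \<open>Orthogonality of the monomials\<close>

definition frob :: "nat \<Rightarrow> complex mat \<Rightarrow> complex mat \<Rightarrow> complex" where
  "frob n A B = (\<Sum>i<n. \<Sum>j<n. cnj (A $$ (i, j)) * B $$ (i, j))"

lemma frob_smult:
  assumes "A \<in> carrier_mat n n" "B \<in> carrier_mat n n"
  shows "frob n (a \<cdot>\<^sub>m A) (b \<cdot>\<^sub>m B) = cnj a * b * frob n A B"
  using assms by (auto simp: frob_def sum_distrib_left mult_ac intro!: sum.cong)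

text \<open>Two forms, because a unitary factor on the left cancels in the first trace and one on
  the right cancels in the second.\<close>

lemma frob_diag:
  assumes "A \<in> carrier_mat n n" "B \<in> carrier_mat n n"
  shows "frob n A B = (\<Sum>j<n. (mat_adjoint A * B) $$ (j, j))"
    and "frob n A B = (\<Sum>i<n. (B * mat_adjoint A) $$ (i, i))"
proof -
  show "frob n A B = (\<Sum>j<n. (mat_adjoint A * B) $$ (j, j))"
    unfolding frob_def using assms by (subst sum.swap) (auto simp: scalar_prod_def atLeast0LessThan intro!: sum.cong)
  show "frob n A B = (\<Sum>i<n. (B * mat_adjoint A) $$ (i, i))"
    unfolding frob_def using assms by (auto simp: scalar_prod_def atLeast0LessThan mult.commute intro!: sum.cong)
qed

lemma frob_unitary_left:
  assumes "E \<in> carrier_mat n n" "mat_adjoint E * E = 1\<^sub>m n" "A \<in> carrier_mat n n" "B \<in> carrier_mat n n"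
  shows "frob n (E * A) (E * B) = frob n A B"
proof -
  have "mat_adjoint (E * A) * (E * B) = mat_adjoint A * ((mat_adjoint E * E) * B)"
    using assms(1,3,4) by (simp add: mat_adjoint_mult[of _ n n _ n] assoc_mult_mat[of _ n n _ n _ n] mult_carrier_mat[of _ n n _ n])
  then show ?thesis using assms
    by (simp add: frob_diag(1) mult_carrier_mat[of _ n n _ n])
qed

lemma frob_unitary_right:
  assumes "E \<in> carrier_mat n n" "mat_adjoint E * E = 1\<^sub>m n" "A \<in> carrier_mat n n" "B \<in> carrier_mat n n"
  shows "frob n (A * E) (B * E) = frob n A B"
proof -
  have "(B * E) * mat_adjoint (A * E) = B * ((E * mat_adjoint E) * mat_adjoint A)"
    using assms(1,3,4) by (simp add: mat_adjoint_mult[of _ n n _ n] assoc_mult_mat[of _ n n _ n _ n] mult_carrier_mat[of _ n n _ n])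
  then show ?thesis using assms unitary_mult_adjoint[OF assms(1,2)]
    by (simp add: frob_diag(2) mult_carrier_mat[of _ n n _ n])
qed

lemma frob_unitary_self:
  assumes "A \<in> carrier_mat n n" "mat_adjoint A * A = 1\<^sub>m n"
  shows "frob n A A = of_nat n"
  using assms by (simp add: frob_diag(1))

section \<open>Monomials in matrices satisfying the Clifford relations\<close>

definition mat_monomial :: "nat \<Rightarrow> (nat \<Rightarrow> complex mat) \<Rightarrow> nat list \<Rightarrow> (nat \<Rightarrow> nat) \<Rightarrow> complex mat" where
  "mat_monomial n E xs J = foldr (\<lambda>j A. (E j ^\<^sub>m J j) * A) xs (1\<^sub>m n)"

lemma finite_multi_indices [simp]: "finite (multi_indices m d)"
  by (simp add: multi_indices_def finite_PiE)

lemma card_multi_indices: "card (multi_indices m d) = m ^ d"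
  by (simp add: multi_indices_def card_PiE)

text \<open>The scalar that appears when generator \<open>l\<close> is moved from the left of
  generator \<open>j\<close> to its right. For \<open>j < l\<close> it is the inverse of omega,
  written as its conjugate.\<close>

definition swap_phase :: "nat \<Rightarrow> nat \<Rightarrow> nat \<Rightarrow> complex" where
  "swap_phase m l j = (if l < j then clifford_omega m else if j < l then cnj (clifford_omega m) else 1)"

lemma unitary_pow:
  fixes A :: "complex mat"
  assumes "A \<in> carrier_mat n n" "mat_adjoint A * A = 1\<^sub>m n"
  shows "mat_adjoint (A ^\<^sub>m k) * (A ^\<^sub>m k) = 1\<^sub>m n"
proof (induction k)
  case 0
  then show ?case using assms by simp
next
  case (Suc k)
  then show ?case using assms by (auto intro!: unitary_mult pow_carrier_mat)
qed

lemma smult_pow_mat: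
  fixes A :: "'a :: comm_semiring_1 mat"
  assumes "A \<in> carrier_mat n n"
  shows "(a \<cdot>\<^sub>m A) ^\<^sub>m k = a ^ k \<cdot>\<^sub>m (A ^\<^sub>m k)"
proof (induction k)
  case 0
  then show ?case using assms by (intro eq_matI) auto
next
  case (Suc k)
  have c: "A ^\<^sub>m k \<in> carrier_mat n n" using assms by (rule pow_carrier_mat)
  have "(a \<cdot>\<^sub>m A) ^\<^sub>m Suc k = (a ^ k \<cdot>\<^sub>m A ^\<^sub>m k) * (a \<cdot>\<^sub>m A)" by (simp add: Suc)
  also have "\<dots> = a \<cdot>\<^sub>m (a ^ k \<cdot>\<^sub>m (A ^\<^sub>m k * A))"
    using c assms by (simp add: mult_smult_distrib[of _ n n _ n] mult_smult_assoc_mat[of _ n n _ n])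
  finally show ?case by (simp add: smult_smult_mat)
qed

lemma mat_monomial_closed:
  assumes "\<And>j. j \<in> set xs \<Longrightarrow> E j \<in> carrier_mat n n"
  shows "mat_monomial n E xs J \<in> carrier_mat n n"
  using assms
proof (induction xs)
  case (Cons x xs)
  then have "E x ^\<^sub>m J x \<in> carrier_mat n n" "mat_monomial n E xs J \<in> carrier_mat n n"
    by (auto intro: pow_carrier_mat)
  then show ?case by (simp add: mat_monomial_def mult_carrier_mat[of _ n n _ n])
qed (simp add: mat_monomial_def)

text \<open>Serves to read off how the monomials change when the last generator is multiplied by a
  root of unity.\<close>

lemma mat_monomial_smult:
  assumes "\<And>j. j \<in> set xs \<Longrightarrow> E j \<in> carrier_mat n n"
  shows "mat_monomial n (\<lambda>j. a j \<cdot>\<^sub>m E j) xs J = (\<Prod>j\<leftarrow>xs. a j ^ J j) \<cdot>\<^sub>m mat_monomial n E xs J"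
  using assms
proof (induction xs)
  case Nil
  show ?case by (simp add: mat_monomial_def one_smult_mat)
next
  case (Cons x xs)
  let ?M = "mat_monomial n E xs J"
  have c: "?M \<in> carrier_mat n n" "E x ^\<^sub>m J x \<in> carrier_mat n n" "E x \<in> carrier_mat n n"
    using Cons.prems by (auto intro: pow_carrier_mat mat_monomial_closed)
  have IH: "mat_monomial n (\<lambda>j. a j \<cdot>\<^sub>m E j) xs J = (\<Prod>j\<leftarrow>xs. a j ^ J j) \<cdot>\<^sub>m ?M"
    using Cons by simp
  have "mat_monomial n (\<lambda>j. a j \<cdot>\<^sub>m E j) (x # xs) J = (a x ^ J x \<cdot>\<^sub>m (E x ^\<^sub>m J x)) * ((\<Prod>j\<leftarrow>xs. a j ^ J j) \<cdot>\<^sub>m ?M)"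
    unfolding IH[symmetric] using c by (simp add: mat_monomial_def smult_pow_mat[of _ n])
  also have "\<dots> = (\<Prod>j\<leftarrow>x # xs. a j ^ J j) \<cdot>\<^sub>m (E x ^\<^sub>m J x * ?M)"
    using c by (simp add: mult_smult_distrib[of _ n n _ n] mult_smult_assoc_mat[of _ n n _ n] smult_smult_mat mult_ac)
  finally show ?case by (simp add: mat_monomial_def)
qed

definition full_monomial :: "nat \<Rightarrow> nat \<Rightarrow> (nat \<Rightarrow> complex mat) \<Rightarrow> (nat \<Rightarrow> nat) \<Rightarrow> complex mat" where
  "full_monomial d n E J = mat_monomial n E [1..<Suc d] J"

locale clifford_sys =
  fixes m d n :: nat and E :: "nat \<Rightarrow> complex mat"
  assumes sys: "clifford_system m d n E"
begin

lemma E: "j \<in> {1..d} \<Longrightarrow> E j \<in> carrier_mat n n" "j \<in> {1..d} \<Longrightarrow> mat_adjoint (E j) * E j = 1\<^sub>m n"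
  "j \<in> {1..d} \<Longrightarrow> E j ^\<^sub>m m = 1\<^sub>m n"
  "k \<in> {1..d} \<Longrightarrow> l \<in> {1..d} \<Longrightarrow> k < l \<Longrightarrow> E k * E l = clifford_omega m \<cdot>\<^sub>m (E l * E k)"
  using sys by (auto simp: clifford_system_def)

lemma E_swap:
  assumes "l \<in> {1..d}" "j \<in> {1..d}"
  shows "E l * E j = swap_phase m l j \<cdot>\<^sub>m (E j * E l)"
  using E(4)[of l j] E(4)[of j l] assms
  by (cases l j rule: linorder_cases) (simp_all add: swap_phase_def smult_smult_mat one_smult_mat)

lemma E_swap_pow:
  assumes "l \<in> {1..d}" "j \<in> {1..d}"
  shows "E l * (E j ^\<^sub>m t) = swap_phase m l j ^ t \<cdot>\<^sub>m ((E j ^\<^sub>m t) * E l)"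
proof (induction t)
  case 0
  then show ?case using E(1)[OF assms(1)] E(1)[OF assms(2)] by (simp add: one_smult_mat)
next
  case (Suc t)
  let ?P = "E j ^\<^sub>m t"
  have c: "E l \<in> carrier_mat n n" "E j \<in> carrier_mat n n" "?P \<in> carrier_mat n n"
    using E(1) assms by (auto intro: pow_carrier_mat)
  have "E l * (E j ^\<^sub>m Suc t) = (E l * ?P) * E j" using c by (simp add: assoc_mult_mat[of _ n n _ n _ n])
  also have "\<dots> = swap_phase m l j ^ t \<cdot>\<^sub>m (?P * (E l * E j))"
    using c by (simp add: Suc mult_smult_assoc_mat[of _ n n _ n] assoc_mult_mat[of _ n n _ n _ n] mult_carrier_mat[of _ n n _ n])
  also have "\<dots> = swap_phase m l j ^ Suc t \<cdot>\<^sub>m (?P * E j * E l)"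
    unfolding E_swap[OF assms] using c
    by (simp add: mult_smult_distrib[of _ n n _ n] smult_smult_mat mult_ac assoc_mult_mat[of _ n n _ n _ n] mult_carrier_mat[of _ n n _ n])
  finally show ?case by simp
qed

lemma mat_monomial_carrier: "set xs \<subseteq> {1..d} \<Longrightarrow> mat_monomial n E xs J \<in> carrier_mat n n"
  using E(1) by (intro mat_monomial_closed) auto

lemma mat_monomial_unitary:
  "set xs \<subseteq> {1..d} \<Longrightarrow> mat_adjoint (mat_monomial n E xs J) * mat_monomial n E xs J = 1\<^sub>m n"
proof (induction xs)
  case Nil
  then show ?case by (simp add: mat_monomial_def)
next
  case (Cons x xs)
  then have "mat_adjoint ((E x ^\<^sub>m J x) * mat_monomial n E xs J) * ((E x ^\<^sub>m J x) * mat_monomial n E xs J) = 1\<^sub>m n"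
    using E mat_monomial_carrier by (intro unitary_mult unitary_pow pow_carrier_mat) auto
  then show ?case by (simp add: mat_monomial_def)
qed

lemma mat_monomial_swap:
  assumes "l \<in> {1..d}" "set xs \<subseteq> {1..d}"
  shows "E l * mat_monomial n E xs J = (\<Prod>j\<leftarrow>xs. swap_phase m l j ^ J j) \<cdot>\<^sub>m (mat_monomial n E xs J * E l)"
  using assms(2)
proof (induction xs)
  case Nil
  then show ?case using E(1)[OF assms(1)] by (simp add: mat_monomial_def one_smult_mat)
next
  case (Cons x xs)
  let ?M = "mat_monomial n E xs J" and ?P = "E x ^\<^sub>m J x" and ?c = "\<Prod>j\<leftarrow>xs. swap_phase m l j ^ J j"
  have c: "?M \<in> carrier_mat n n" "?P \<in> carrier_mat n n" "E l \<in> carrier_mat n n"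
    using Cons.prems E(1) assms mat_monomial_carrier by (auto intro: pow_carrier_mat)
  have e: "mat_monomial n E (x # xs) J = ?P * ?M" by (simp add: mat_monomial_def)
  have "E l * (?P * ?M) = (E l * ?P) * ?M" using c by (simp add: assoc_mult_mat[of _ n n _ n _ n])
  also have "\<dots> = swap_phase m l x ^ J x \<cdot>\<^sub>m (?P * (E l * ?M))"
    using c Cons.prems E_swap_pow[OF assms(1), of x "J x"]
    by (simp add: mult_smult_assoc_mat[of _ n n _ n] assoc_mult_mat[of _ n n _ n _ n] mult_carrier_mat[of _ n n _ n])
  also have "\<dots> = (swap_phase m l x ^ J x * ?c) \<cdot>\<^sub>m (?P * ?M * E l)"
    using c Cons
    by (simp add: mult_smult_distrib[of _ n n _ n] smult_smult_mat assoc_mult_mat[of _ n n _ n _ n] mult_carrier_mat[of _ n n _ n])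
  finally show ?case by (simp add: e)
qed

abbreviation "mono_mat \<equiv> full_monomial d n E"

definition character :: "nat \<Rightarrow> (nat \<Rightarrow> nat) \<Rightarrow> complex" where
  "character l J = (\<Prod>j\<in>{1..d}. swap_phase m l j ^ J j)"

lemma set_upt_Suc: "set [1..<Suc d] = {1..d}"
  by auto

lemma mon_swap: "l \<in> {1..d} \<Longrightarrow> E l * mono_mat J = character l J \<cdot>\<^sub>m (mono_mat J * E l)"
  using mat_monomial_swap[of l "[1..<Suc d]" J] prod.distinct_set_conv_list[of "[1..<Suc d]" "\<lambda>j. swap_phase m l j ^ J j"]
  unfolding character_def set_upt_Suc full_monomial_def by simp

lemma mon_carrier: "mono_mat J \<in> carrier_mat n n"
  unfolding full_monomial_def by (rule mat_monomial_carrier) auto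

lemma mon_unitary: "mat_adjoint (mono_mat J) * mono_mat J = 1\<^sub>m n"
  unfolding full_monomial_def by (rule mat_monomial_unitary) auto

text \<open>
  Conjugation by the unitary \<open>E l\<close> preserves the inner product and multiplies each monomial by its
  character, so monomials with different characters are orthogonal.
\<close>

lemma frob_character:
  assumes l: "l \<in> {1..d}"
  shows "frob n (mono_mat J) (mono_mat K) = cnj (character l J) * character l K * frob n (mono_mat J) (mono_mat K)"
proof -
  note c = mon_carrier E[OF l]
  have "frob n (mono_mat J) (mono_mat K) = frob n (E l * mono_mat J) (E l * mono_mat K)"
    using c by (simp add: frob_unitary_left)
  also have "\<dots> = cnj (character l J) * character l K * frob n (mono_mat J * E l) (mono_mat K * E l)"
    using c by (simp add: mon_swap[OF l] frob_smult mult_carrier_mat[of _ n n _ n])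
  also have "frob n (mono_mat J * E l) (mono_mat K * E l) = frob n (mono_mat J) (mono_mat K)"
    using c by (simp add: frob_unitary_right)
  finally show ?thesis .
qed

lemma swap_phase_cnj: "cnj (swap_phase m l j) * swap_phase m l j = 1"
  by (simp add: swap_phase_def)

lemma character_unit: "cnj (character l J) * character l J = 1"
  unfolding character_def cnj_prod
  by (simp add: cnj_power_one[OF swap_phase_cnj] flip: prod.distrib)

text \<open>Put delta_j = omega^(J_j - K_j), with conjugates serving as inverses. Equality of the
  l-th characters says that the conjugate deltas below l and the deltas above l multiply to 1
  (\<open>PQ\<close>). Comparing l with l + 1 gives delta_l delta_(l+1) = 1 (\<open>step\<close>),
  so a single delta equal to 1 forces all of them. For odd \<open>d\<close> the hypothesis on the
  last exponent provides delta_d = 1. For even \<open>d\<close> the product of all deltas is 1 by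
  pairing neighbours, while \<open>PQ\<close> at l = 1 says that the product without delta_1 is 1,
  so delta_1 = 1.\<close>

lemma characters_separate:
  assumes chi: "\<And>l. l \<in> {1..d} \<Longrightarrow> character l J = character l K"
    and odd: "odd d \<Longrightarrow> J d = K d" and m: "m > 0" and d: "d \<ge> 1"
    and JK: "J \<in> multi_indices m d" "K \<in> multi_indices m d"
  shows "J = K"
proof -
  let ?w = "clifford_omega m"
  define \<delta> where "\<delta> j = ?w ^ J j * cnj ?w ^ K j" for j
  have w: "?w ^ k * cnj ?w ^ k = 1" for k by (simp flip: power_mult_distrib)
  have \<delta>\<delta>: "\<delta> j * cnj (\<delta> j) = 1" for j
    using w[of "J j"] w[of "K j"] by (simp add: \<delta>_def mult_ac) (metis mult.commute mult.left_commute mult.right_neutral)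
  define \<psi> where "\<psi> l j = swap_phase m l j ^ J j * cnj (swap_phase m l j) ^ K j" for l j
  have \<psi>: "\<psi> l j = (if l < j then \<delta> j else if j < l then cnj (\<delta> j) else 1)" for l j
    by (simp add: \<psi>_def \<delta>_def swap_phase_def mult.commute)
  define P where "P l = (\<Prod>j\<in>{1..<l}. cnj (\<delta> j))" for l
  define Q where "Q l = (\<Prod>j\<in>{l<..d}. \<delta> j)" for l
  have PQ: "P l * Q l = 1" if l: "l \<in> {1..d}" for l
  proof -
    have "1 = character l J * cnj (character l K)"
      using chi[OF l] character_unit[of l K] by (simp add: mult.commute)
    also have "\<dots> = (\<Prod>j\<in>{1..d}. \<psi> l j)" by (simp add: character_def \<psi>_def prod.distrib)
    also have "{1..d} = ({1..<l} \<union> {l<..d}) \<union> {l}" using l by auto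
    also have "prod (\<psi> l) \<dots> = prod (\<psi> l) ({1..<l} \<union> {l<..d}) * \<psi> l l" by (subst prod.union_disjoint) auto
    also have "prod (\<psi> l) ({1..<l} \<union> {l<..d}) = prod (\<psi> l) {1..<l} * prod (\<psi> l) {l<..d}"
      by (subst prod.union_disjoint) auto
    also have "prod (\<psi> l) {1..<l} = P l" unfolding P_def by (intro prod.cong) (auto simp: \<psi>)
    also have "prod (\<psi> l) {l<..d} = Q l" unfolding Q_def by (intro prod.cong) (auto simp: \<psi>)
    finally show ?thesis by (simp add: \<psi>)
  qed
  have step: "\<delta> l * \<delta> (Suc l) = 1" if l: "1 \<le> l" "l < d" for l
  proof -
    have q: "Q l = \<delta> (Suc l) * Q (Suc l)"
    proof -
      have "{l<..d} = insert (Suc l) {Suc l<..d}" using l by auto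
      then show ?thesis by (simp add: Q_def)
    qed
    have p: "P (Suc l) = P l * cnj (\<delta> l)" using l by (simp add: P_def)
    have "P l * (\<delta> (Suc l) * Q (Suc l)) = 1" "P l * cnj (\<delta> l) * Q (Suc l) = 1"
      using PQ[of l] PQ[of "Suc l"] l q p by auto
    then have "P l * Q (Suc l) * \<delta> (Suc l) = P l * Q (Suc l) * cnj (\<delta> l)" "P l * Q (Suc l) \<noteq> 0"
      by (auto simp: mult_ac)
    then have "\<delta> (Suc l) = cnj (\<delta> l)" by simp
    then show ?thesis using \<delta>\<delta> by simp
  qed
  have all: "\<delta> j = 1" if "j \<in> {1..d}" for j
  proof (cases "odd d")
    case True
    from that have "1 \<le> j" "j \<le> d" by auto
    from this(2) this(1) show ?thesis
    proof (induction rule: inc_induct)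
      case base
      then show ?case using odd[OF True] w[of "K d"] by (simp add: \<delta>_def)
    next
      case (step k)
      then show ?case using \<open>\<And>l. 1 \<le> l \<Longrightarrow> l < d \<Longrightarrow> \<delta> l * \<delta> (Suc l) = 1\<close>[of k] by simp
    qed
  next
    case False
    have pairs: "2 * q \<le> d \<Longrightarrow> (\<Prod>j\<in>{1..2 * q}. \<delta> j) = 1" for q
    proof (induction q)
      case (Suc q)
      have "{1..2 * Suc q} = insert (Suc (Suc (2 * q))) (insert (Suc (2 * q)) {1..2 * q})" by auto
      then show ?case using Suc step[of "Suc (2 * q)"] by (simp add: mult_ac)
    qed simp
    have "(\<Prod>j\<in>{1..d}. \<delta> j) = 1" using pairs[of "d div 2"] False by simp
    moreover have "{1..d} = insert 1 {1<..d}" using d by auto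
    ultimately have "\<delta> 1 * Q 1 = 1" by (simp add: Q_def)
    moreover have "Q 1 = 1" using PQ[of 1] d by (simp add: P_def)
    ultimately have "\<delta> 1 = 1" by simp
    have "1 \<le> j \<Longrightarrow> j \<le> d \<Longrightarrow> \<delta> j = 1"
    proof (induction j rule: dec_induct)
      case base
      show ?case by fact
    next
      case (step k)
      then show ?case using \<open>\<And>l. 1 \<le> l \<Longrightarrow> l < d \<Longrightarrow> \<delta> l * \<delta> (Suc l) = 1\<close>[of k] by simp
    qed
    then show ?thesis using that by simp
  qed
  show ?thesis
  proof (rule PiE_ext[OF JK[unfolded multi_indices_def]])
    fix j assume j: "j \<in> {1..d}"
    have "?w ^ J j = \<delta> j * ?w ^ K j" using w[of "K j"] by (simp add: \<delta>_def mult_ac)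
    then have "?w ^ J j = ?w ^ K j" using all[OF j] by simp
    moreover have "J j < m" "K j < m" using JK j by (auto simp: multi_indices_def PiE_iff)
    ultimately show "J j = K j" by (rule omega_power_inj)
  qed
qed

text \<open>Each commutation relation acquires the same factor on both sides, while the power
  relation uses a^m = 1 and unitarity uses |a| = 1. Such rescalings will tell the blocks apart in
  the odd case.\<close>

lemma scale_last:
  assumes "d \<ge> 1" "a ^ m = 1" "cnj a * a = 1"
  shows "clifford_sys m d n (\<lambda>j. (if j = d then a else 1) \<cdot>\<^sub>m E j)"
proof
  let ?b = "\<lambda>j. if j = d then a else 1"
  have one: "cnj (?b j) * ?b j = 1" "?b j ^ m = 1" for j using assms by auto
  show "clifford_system m d n (\<lambda>j. ?b j \<cdot>\<^sub>m E j)"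
    unfolding clifford_system_def
  proof (intro conjI ballI impI)
    fix j assume j: "j \<in> {1..d}"
    note c = E(1-3)[OF j]
    show "?b j \<cdot>\<^sub>m E j \<in> carrier_mat n n" using c by simp
    show "mat_adjoint (?b j \<cdot>\<^sub>m E j) * (?b j \<cdot>\<^sub>m E j) = 1\<^sub>m n"
      using c one[of j] by (simp add: mat_adjoint_smult mult_smult_distrib[of _ n n _ n] mult_smult_assoc_mat[of _ n n _ n] smult_smult_mat one_smult_mat mult.commute del: if_split)
    show "(?b j \<cdot>\<^sub>m E j) ^\<^sub>m m = 1\<^sub>m n"
      using c one[of j] by (simp add: smult_pow_mat[of _ n] one_smult_mat)
  next
    fix k l assume kl: "k \<in> {1..d}" "l \<in> {1..d}" "k < l"
    note c = E(1)[OF kl(1)] E(1)[OF kl(2)] E(4)[OF kl]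
    show "(?b k \<cdot>\<^sub>m E k) * (?b l \<cdot>\<^sub>m E l) = clifford_omega m \<cdot>\<^sub>m ((?b l \<cdot>\<^sub>m E l) * (?b k \<cdot>\<^sub>m E k))"
      using c by (simp add: mult_smult_distrib[of _ n n _ n] mult_smult_assoc_mat[of _ n n _ n] smult_smult_mat mult_ac del: if_split)
  qed
qed

end

text \<open>A left inverse of a square matrix is also a right inverse; applied to the array
  \<open>B\<close> and its scaled adjoint, this passes from orthogonal columns to orthogonal rows.
  It will turn the orthogonality of the monomials into their completeness.\<close>

lemma square_orthogonal:
  fixes B :: "'s \<Rightarrow> 't \<Rightarrow> complex"
  assumes fin: "finite S" "finite T" "card S = card T" and a: "a \<noteq> 0"
    and orth: "\<And>t t'. t \<in> T \<Longrightarrow> t' \<in> T \<Longrightarrow> (\<Sum>s\<in>S. cnj (B s t) * B s t') = (if t = t' then a else 0)"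
    and s: "s \<in> S" "s' \<in> S"
  shows "(\<Sum>t\<in>T. B s t * cnj (B s' t)) = (if s = s' then a else 0)"
proof -
  define N where "N = card S"
  obtain \<sigma> where \<sigma>: "bij_betw \<sigma> {..<N} S" using ex_bij_betw_nat_finite[OF fin(1)] by (auto simp: N_def atLeast0LessThan)
  obtain \<tau> where \<tau>: "bij_betw \<tau> {..<N} T" using ex_bij_betw_nat_finite[OF fin(2)] fin(3) by (auto simp: N_def atLeast0LessThan)
  define M where "M = mat N N (\<lambda>(p, q). B (\<sigma> p) (\<tau> q))"
  define L where "L = inverse a \<cdot>\<^sub>m mat_adjoint M"
  have c: "M \<in> carrier_mat N N" "L \<in> carrier_mat N N" by (auto simp: M_def L_def)
  have "L * M = 1\<^sub>m N"
  proof (rule eq_matI)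
    fix i j assume "i < dim_row (1\<^sub>m N :: complex mat)" "j < dim_col (1\<^sub>m N :: complex mat)"
    then have ij: "i < N" "j < N" by auto
    have "(L * M) $$ (i, j) = inverse a * (\<Sum>p<N. cnj (B (\<sigma> p) (\<tau> i)) * B (\<sigma> p) (\<tau> j))"
      using ij by (simp add: L_def M_def scalar_prod_def atLeast0LessThan sum_distrib_left mult.assoc)
    also have "(\<Sum>p<N. cnj (B (\<sigma> p) (\<tau> i)) * B (\<sigma> p) (\<tau> j)) = (\<Sum>s\<in>S. cnj (B s (\<tau> i)) * B s (\<tau> j))"
      by (rule sum.reindex_bij_betw[OF \<sigma>])
    also have "\<dots> = (if i = j then a else 0)"
      using orth ij bij_betwE[OF \<tau>] bij_betw_imp_inj_on[OF \<tau>] by (auto dest: inj_onD)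
    finally show "(L * M) $$ (i, j) = 1\<^sub>m N $$ (i, j)" using ij a by simp
  qed (use c in auto)
  then have right_inv: "M * L = 1\<^sub>m N" using mat_mult_left_right_inverse c by blast
  obtain p p' where p: "p < N" "\<sigma> p = s" "p' < N" "\<sigma> p' = s'"
    using s bij_betw_imp_surj_on[OF \<sigma>] by (auto simp: image_iff)
  have "inverse a * (\<Sum>q<N. B s (\<tau> q) * cnj (B s' (\<tau> q))) = (M * L) $$ (p, p')"
    using p by (simp add: L_def M_def scalar_prod_def atLeast0LessThan sum_distrib_left mult_ac)
  also have "\<dots> = (if s = s' then 1 else 0)"
    unfolding right_inv using p bij_betw_imp_inj_on[OF \<sigma>] by (auto dest: inj_onD)
  also have "(\<Sum>q<N. B s (\<tau> q) * cnj (B s' (\<tau> q))) = (\<Sum>t\<in>T. B s t * cnj (B s' t))"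
    by (rule sum.reindex_bij_betw[OF \<tau>])
  finally show ?thesis using a by (auto simp: field_simps split: if_splits)
qed

text \<open>
  For odd \<open>d\<close> the characters do not see the centre, which is spanned by \<open>m\<close> monomials. Using \<open>m\<close>
  blocks, the \<open>k\<close>-th of which has its last generator multiplied by $\omega^k$, separates them.
\<close>

locale clifford_matrices =
  fixes m d n r :: nat and E :: "nat \<Rightarrow> nat \<Rightarrow> complex mat"
  assumes m_pos: "m > 0" and r_pos: "r > 0" and n_pos: "n > 0"
    and size: "r * (n * n) = m ^ d"
    and block_sys: "k < r \<Longrightarrow> clifford_sys m d n (E k)"
    and orthogonal: "J \<in> multi_indices m d \<Longrightarrow> K \<in> multi_indices m d \<Longrightarrow> J \<noteq> K \<Longrightarrow>
      (\<Sum>k<r. frob n (full_monomial d n (E k) J) (full_monomial d n (E k) K)) = 0"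

lemma clifford_matrices_exist:
  assumes m: "m \<ge> 2" and d: "d \<ge> 1"
  shows "\<exists>E. clifford_matrices m d (m ^ (d div 2)) (if odd d then m else 1) E"
proof -
  define n where "n = m ^ (d div 2)"
  define r where "r = (if odd d then m else 1)"
  obtain E where E: "clifford_system m (2 * (d div 2) + 1) n E"
    using clifford_system_exists[of m "d div 2"] m by (auto simp: n_def)
  \<comment> \<open>For even \<open>d\<close> the system has one generator more than required, and
    the last is dropped.\<close>
  have "d \<le> 2 * (d div 2) + 1" by presburger
  then have "clifford_sys m d n E" using E unfolding clifford_sys_def clifford_system_def by auto
  then interpret clifford_sys m d n E .
  let ?w = "clifford_omega m"
  define F where "F k j = (if j = d then ?w ^ k else 1) \<cdot>\<^sub>m E j" for k j
  have wk: "(?w ^ k) ^ m = 1" "cnj (?w ^ k) * ?w ^ k = 1" for k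
  proof -
    show "(?w ^ k) ^ m = 1" using omega_power_m[of m] m by (metis power_commutes power_mult power_one mult.commute zero_less_numeral less_le_trans)
    show "cnj (?w ^ k) * ?w ^ k = 1" using cnj_power_one[of ?w k] by simp
  qed
  have F: "clifford_sys m d n (F k)" for k
    using scale_last[OF d wk] by (simp add: F_def[abs_def])
  have F_mono: "full_monomial d n (F k) J = (?w ^ k) ^ J d \<cdot>\<^sub>m mono_mat J" for k J
  proof -
    have "(\<Prod>j\<leftarrow>[1..<Suc d]. (if j = d then ?w ^ k else 1) ^ J j) = (\<Prod>j\<in>{1..d}. (if j = d then ?w ^ k else 1) ^ J j)"
      using prod.distinct_set_conv_list[of "[1..<Suc d]" "\<lambda>j. (if j = d then ?w ^ k else 1) ^ J j"]
      unfolding set_upt_Suc by simp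
    also have "\<dots> = (\<Prod>j\<in>{1..d}. if j = d then (?w ^ k) ^ J j else 1)" by (intro prod.cong) auto
    also have "\<dots> = (?w ^ k) ^ J d" using d by simp
    finally have p: "(\<Prod>j\<leftarrow>[1..<Suc d]. (if j = d then ?w ^ k else 1) ^ J j) = (?w ^ k) ^ J d" .
    have "mat_monomial n (\<lambda>j. (if j = d then ?w ^ k else 1) \<cdot>\<^sub>m E j) [1..<Suc d] J =
      (\<Prod>j\<leftarrow>[1..<Suc d]. (if j = d then ?w ^ k else 1) ^ J j) \<cdot>\<^sub>m mat_monomial n E [1..<Suc d] J"
      by (rule mat_monomial_smult) (use E(1) in auto)
    then show ?thesis unfolding full_monomial_def F_def[abs_def] p .
  qed
  have "clifford_matrices m d n r F"
  proof (rule clifford_matrices.intro)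
    show "m > 0" "r > 0" "n > 0" using m by (auto simp: r_def n_def)
    show "r * (n * n) = m ^ d"
      by (cases "odd d") (auto simp: r_def n_def mult_2[symmetric] elim!: oddE evenE simp flip: power_add)
    show "clifford_sys m d n (F k)" for k by (rule F)
    fix J K assume JK: "J \<in> multi_indices m d" "K \<in> multi_indices m d" "J \<noteq> K"
    \<comment> \<open>Block \<open>k\<close> multiplies the inner product of the two monomials by
      the \<open>k\<close>-th power of this number. If that inner product is not zero, the
      characters agree, which leaves only odd \<open>d\<close> with different last exponents; then
      \<open>D\<close> is an m-th root of unity other than 1 and its m powers sum to 0.\<close>
    define D where "D = cnj (?w ^ J d) * ?w ^ K d"
    have frob_eq: "frob n (full_monomial d n (F k) J) (full_monomial d n (F k) K) = D ^ k * frob n (mono_mat J) (mono_mat K)" for k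
      unfolding F_mono using mon_carrier
      by (simp add: frob_smult D_def power_mult_distrib mult.commute flip: power_mult)
    show "(\<Sum>k<r. frob n (full_monomial d n (F k) J) (full_monomial d n (F k) K)) = 0"
    proof (cases "frob n (mono_mat J) (mono_mat K) = 0")
      case True
      then show ?thesis by (simp add: frob_eq)
    next
      case False
      have "character l J = character l K" if "l \<in> {1..d}" for l
      proof -
        have c: "cnj (character l J) * character l K = 1" using frob_character[OF that, of J K] False by simp
        have "character l K = (cnj (character l J) * character l J) * character l K"
          by (simp add: character_unit)
        also have "\<dots> = character l J * (cnj (character l J) * character l K)" by (simp only: mult_ac)
        also have "\<dots> = character l J" using c by simp
        finally show ?thesis ..
      qed
      then have od: "odd d" and "J d \<noteq> K d" using characters_separate[of J K] JK m d by auto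
      have "D \<noteq> 1"
      proof
        assume "D = 1"
        then have "?w ^ J d = ?w ^ J d * cnj (?w ^ J d) * ?w ^ K d" by (simp add: D_def mult.assoc)
        also have "\<dots> = ?w ^ K d" using wk(2)[of "J d"] by (simp add: mult.commute)
        finally have "J d = K d" using JK d by (intro omega_power_inj) (auto simp: multi_indices_def PiE_iff)
        with \<open>J d \<noteq> K d\<close> show False by simp
      qed
      moreover have "D ^ m = 1"
      proof -
        have "(cnj (?w ^ J d)) ^ m = cnj ((?w ^ J d) ^ m)" by simp
        then show ?thesis unfolding D_def power_mult_distrib using wk(1)[of "J d"] wk(1)[of "K d"] by simp
      qed
      ultimately have "(\<Sum>k<m. D ^ k) = 0" by (simp add: geometric_sum)
      then show ?thesis using od by (simp add: frob_eq r_def flip: sum_distrib_right)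
    qed
  qed
  then show ?thesis unfolding n_def r_def by blast
qed

context clifford_matrices
begin

abbreviation "mono_mat k \<equiv> full_monomial d n (E k)"

lemma mon_carrier [simp]: "k < r \<Longrightarrow> mono_mat k J \<in> carrier_mat n n"
  and mon_unitary: "k < r \<Longrightarrow> mat_adjoint (mono_mat k J) * mono_mat k J = 1\<^sub>m n"
  using clifford_sys.mon_carrier[OF block_sys] clifford_sys.mon_unitary[OF block_sys] by (auto simp: mono_def)

lemma mon_orthogonal:
  assumes "J \<in> multi_indices m d" "K \<in> multi_indices m d"
  shows "(\<Sum>k<r. \<Sum>i<n. \<Sum>j<n. cnj (mono_mat k J $$ (i, j)) * mono_mat k K $$ (i, j)) = (if J = K then of_nat (r * n) else 0)"
proof (cases "J = K")
  case True
  have "(\<Sum>k<r. frob n (mono_mat k J) (mono_mat k J)) = (\<Sum>k<r. of_nat n)"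
    using frob_unitary_self mon_unitary by (intro sum.cong) auto
  then show ?thesis using True by (simp add: frob_def)
next
  case False
  then show ?thesis using orthogonal[OF assms] by (simp add: frob_def mono_def)
qed

text \<open>The transposed form of \<open>mon_orthogonal\<close>, valid because the array of matrix
  entries against monomials is square. It expresses every matrix unit through monomials and so
  yields surjectivity of the representation.\<close>

lemma mon_complete:
  assumes "k < r" "i < n" "j < n" "k' < r" "i' < n" "j' < n"
  shows "(\<Sum>J\<in>multi_indices m d. mono_mat k J $$ (i, j) * cnj (mono_mat k' J $$ (i', j'))) =
    (if (k, i, j) = (k', i', j') then of_nat (r * n) else 0)"
proof -
  have "(\<Sum>J\<in>multi_indices m d. (\<lambda>(k, p) J. mono_mat k J $$ p) (k, i, j) J * cnj ((\<lambda>(k, p) J. mono_mat k J $$ p) (k', i', j') J)) =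
    (if (k, i, j) = (k', i', j') then of_nat (r * n) else 0)"
  proof (rule square_orthogonal[where S = "{..<r} \<times> {..<n} \<times> {..<n}"])
    show "card ({..<r} \<times> {..<n} \<times> {..<n}) = card (multi_indices m d)"
      by (simp add: card_cartesian_product card_multi_indices size)
    show "of_nat (r * n) \<noteq> (0 :: complex)" using r_pos n_pos by simp
    fix J K assume "J \<in> multi_indices m d" "K \<in> multi_indices m d"
    from mon_orthogonal[OF this]
    show "(\<Sum>s\<in>{..<r} \<times> {..<n} \<times> {..<n}. cnj ((\<lambda>(k, p) J. mono_mat k J $$ p) s J) * (\<lambda>(k, p) J. mono_mat k J $$ p) s K) =
      (if J = K then of_nat (r * n) else 0)"
      by (simp add: sum.cartesian_product case_prod_beta)
  qed (use assms in auto)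
  then show ?thesis by simp
qed

end


section \<open>Normal ordering in the Clifford algebra\<close>

lemma free_algebra_simps:
  "carrier (free_algebra d) = {f. finite {w. f w \<noteq> 0} \<and> (\<forall>w. f w \<noteq> 0 \<longrightarrow> set w \<subseteq> {1..d})}"
  "f \<otimes>\<^bsub>free_algebra d\<^esub> g = (\<lambda>w. \<Sum>i\<le>length w. f (take i w) * g (drop i w))"
  "\<one>\<^bsub>free_algebra d\<^esub> = (\<lambda>w. if w = [] then 1 else 0)"
  "\<zero>\<^bsub>free_algebra d\<^esub> = (\<lambda>w. 0)"
  "f \<oplus>\<^bsub>free_algebra d\<^esub> g = (\<lambda>w. f w + g w)"
  by (simp_all add: free_algebra_def)

text \<open>Both sides sum over the ways of cutting \<open>w\<close> into three pieces. The left
  side chooses the second cut first, the right side the first cut, whence the reindexing of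
  \<open>(i, j)\<close> as \<open>(j, i - j)\<close>.\<close>

lemma convolution_assoc:
  fixes f g h :: "'a list \<Rightarrow> complex"
  shows "(\<Sum>i\<le>length w. (\<Sum>j\<le>length (take i w). f (take j (take i w)) * g (drop j (take i w))) * h (drop i w)) =
    (\<Sum>j\<le>length w. f (take j w) * (\<Sum>l\<le>length (drop j w). g (take l (drop j w)) * h (drop l (drop j w))))"
proof -
  have "(\<Sum>i\<le>length w. (\<Sum>j\<le>length (take i w). f (take j (take i w)) * g (drop j (take i w))) * h (drop i w)) =
    (\<Sum>i\<le>length w. \<Sum>j\<le>i. f (take j w) * g (take (i - j) (drop j w)) * h (drop i w))"
    by (intro sum.cong refl) (auto simp: sum_distrib_right min_def drop_take intro!: sum.cong)
  also have "\<dots> = (\<Sum>(i, j)\<in>Sigma {..length w} (\<lambda>i. {..i}). f (take j w) * g (take (i - j) (drop j w)) * h (drop i w))"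
    by (rule sum.Sigma) auto
  also have "\<dots> = (\<Sum>(j, l)\<in>Sigma {..length w} (\<lambda>j. {..length w - j}). f (take j w) * g (take l (drop j w)) * h (drop (j + l) w))"
    by (rule sum.reindex_bij_witness[where i = "\<lambda>(j, l). (j + l, j)" and j = "\<lambda>(i, j). (j, i - j)"]) auto
  also have "\<dots> = (\<Sum>j\<le>length w. \<Sum>l\<le>length w - j. f (take j w) * g (take l (drop j w)) * h (drop (j + l) w))"
    by (rule sum.Sigma[symmetric]) auto
  also have "\<dots> = (\<Sum>j\<le>length w. f (take j w) * (\<Sum>l\<le>length (drop j w). g (take l (drop j w)) * h (drop l (drop j w))))"
    by (simp add: sum_distrib_left mult.assoc add.commute)
  finally show ?thesis .
qed

text \<open>The weight \<open>L\<close> will be a matrix entry attached to a word, which makes this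
  the source of multiplicativity of evaluation. A word with a cut whose pieces lie in
  \<open>A\<close> and \<open>B\<close> is the same thing as a pair of words.\<close>

lemma convolution_sum:
  fixes f g L :: "'a list \<Rightarrow> complex"
  assumes fin: "finite A" "finite B" "finite W" and f: "\<And>u. u \<notin> A \<Longrightarrow> f u = 0" and g: "\<And>v. v \<notin> B \<Longrightarrow> g v = 0"
    and W: "\<And>u v. u \<in> A \<Longrightarrow> v \<in> B \<Longrightarrow> u @ v \<in> W"
  shows "(\<Sum>w\<in>W. (\<Sum>i\<le>length w. f (take i w) * g (drop i w)) * L w) = (\<Sum>u\<in>A. \<Sum>v\<in>B. f u * g v * L (u @ v))"
proof -
  let ?S = "Sigma W (\<lambda>w. {..length w})"
  let ?T = "{(w, i) \<in> ?S. take i w \<in> A \<and> drop i w \<in> B}"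
  have "(\<Sum>w\<in>W. (\<Sum>i\<le>length w. f (take i w) * g (drop i w)) * L w) =
    (\<Sum>(w, i)\<in>?S. f (take i w) * g (drop i w) * L w)"
    using fin by (simp add: sum.Sigma sum_distrib_right)
  also have "\<dots> = (\<Sum>(w, i)\<in>?T. f (take i w) * g (drop i w) * L w)"
  proof (rule sum.mono_neutral_right)
    show "\<forall>p\<in>?S - ?T. (case p of (w, i) \<Rightarrow> f (take i w) * g (drop i w) * L w) = 0"
      using f g by (auto simp: case_prod_beta) blast+
  qed (use fin in auto)
  also have "\<dots> = (\<Sum>(u, v)\<in>A \<times> B. f u * g v * L (u @ v))"
    by (rule sum.reindex_bij_witness[where i = "\<lambda>(u, v). (u @ v, length u)" and j = "\<lambda>(w, i). (take i w, drop i w)"])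
       (use W in auto)
  finally show ?thesis by (simp add: sum.cartesian_product)
qed

lemma free_mult_nonzero:
  fixes f g :: "'a list \<Rightarrow> complex"
  assumes "(\<Sum>i\<le>length w. f (take i w) * g (drop i w)) \<noteq> 0"
  shows "\<exists>u v. w = u @ v \<and> f u \<noteq> 0 \<and> g v \<noteq> 0"
proof -
  obtain i where "f (take i w) * g (drop i w) \<noteq> 0" using assms by (meson sum.not_neutral_contains_not_neutral)
  then show ?thesis by (metis append_take_drop_id mult_eq_0_iff)
qed

lemma free_mult_closed:
  assumes "f \<in> carrier (free_algebra d)" "g \<in> carrier (free_algebra d)"
  shows "f \<otimes>\<^bsub>free_algebra d\<^esub> g \<in> carrier (free_algebra d)"
proof -
  have "{w. (f \<otimes>\<^bsub>free_algebra d\<^esub> g) w \<noteq> 0} \<subseteq> (\<lambda>(u, v). u @ v) ` ({u. f u \<noteq> 0} \<times> {v. g v \<noteq> 0})"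
    using free_mult_nonzero by (fastforce simp: free_algebra_simps)
  then have "finite {w. (f \<otimes>\<^bsub>free_algebra d\<^esub> g) w \<noteq> 0}"
    by (rule finite_subset) (use assms in \<open>auto simp: free_algebra_simps\<close>)
  moreover have "set w \<subseteq> {1..d}" if nz: "(f \<otimes>\<^bsub>free_algebra d\<^esub> g) w \<noteq> 0" for w
  proof -
    obtain u v where "w = u @ v" "f u \<noteq> 0" "g v \<noteq> 0"
      using free_mult_nonzero[of f w g] nz by (auto simp: free_algebra_simps)
    then show ?thesis using assms by (auto simp: free_algebra_simps)
  qed
  ultimately show ?thesis by (auto simp: free_algebra_simps(1))
qed

lemma sum_take_Nil: "(\<Sum>i\<le>length w. (if take i w = [] then c else 0) * f (drop i w)) = c * (f w :: complex)"
proof -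
  have "(\<Sum>i\<le>length w. (if take i w = [] then c else 0) * f (drop i w)) = (\<Sum>i\<le>length w. if i = 0 then c * f w else 0)"
    by (intro sum.cong) auto
  then show ?thesis by simp
qed

lemma sum_drop_Nil: "(\<Sum>i\<le>length w. f (take i w) * (if drop i w = [] then c else 0)) = (f w :: complex) * c"
proof -
  have "(\<Sum>i\<le>length w. f (take i w) * (if drop i w = [] then c else 0)) = (\<Sum>i\<le>length w. if i = length w then f w * c else 0)"
    by (intro sum.cong) auto
  then show ?thesis by simp
qed

lemma free_algebra_ring: "ring (free_algebra d)"
proof (rule ringI)
  show "abelian_group (free_algebra d)"
  proof (rule abelian_groupI)
    fix f g assume fg: "f \<in> carrier (free_algebra d)" "g \<in> carrier (free_algebra d)"
    have "{w. f w + g w \<noteq> 0} \<subseteq> {w. f w \<noteq> 0} \<union> {w. g w \<noteq> 0}" by auto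
    then have "finite {w. f w + g w \<noteq> 0}" by (rule finite_subset) (use fg in \<open>auto simp: free_algebra_simps\<close>)
    moreover have "set w \<subseteq> {1..d}" if "f w + g w \<noteq> 0" for w
      using that fg by (cases "f w = 0") (auto simp: free_algebra_simps)
    ultimately show "f \<oplus>\<^bsub>free_algebra d\<^esub> g \<in> carrier (free_algebra d)" by (simp add: free_algebra_simps)
  next
    fix f assume "f \<in> carrier (free_algebra d)"
    then show "\<exists>g\<in>carrier (free_algebra d). g \<oplus>\<^bsub>free_algebra d\<^esub> f = \<zero>\<^bsub>free_algebra d\<^esub>"
      by (intro bexI[of _ "\<lambda>w. - f w"]) (auto simp: free_algebra_simps)
  qed (auto simp: free_algebra_simps)
  show "Group.monoid (free_algebra d)"
  proof (rule monoidI)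
    show "f \<otimes>\<^bsub>free_algebra d\<^esub> g \<in> carrier (free_algebra d)"
      if "f \<in> carrier (free_algebra d)" "g \<in> carrier (free_algebra d)" for f g
      using that by (rule free_mult_closed)
    show "f \<otimes>\<^bsub>free_algebra d\<^esub> g \<otimes>\<^bsub>free_algebra d\<^esub> h = f \<otimes>\<^bsub>free_algebra d\<^esub> (g \<otimes>\<^bsub>free_algebra d\<^esub> h)" for f g h
      unfolding free_algebra_simps by (rule ext) (rule convolution_assoc)
    show "\<one>\<^bsub>free_algebra d\<^esub> \<otimes>\<^bsub>free_algebra d\<^esub> f = f" for f
      unfolding free_algebra_simps sum_take_Nil by simp
    show "f \<otimes>\<^bsub>free_algebra d\<^esub> \<one>\<^bsub>free_algebra d\<^esub> = f" for f
      unfolding free_algebra_simps sum_drop_Nil by simp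
  qed (auto simp: free_algebra_simps)
qed (auto simp: free_algebra_simps algebra_simps sum.distrib)

lemma free_scalar_closed: "free_scalar c \<in> carrier (free_algebra d)"
  by (auto simp: free_algebra_simps free_scalar_def)

lemma free_scalar_simps:
  "free_scalar c \<otimes>\<^bsub>free_algebra d\<^esub> f = (\<lambda>w. c * f w)"
  "f \<otimes>\<^bsub>free_algebra d\<^esub> free_scalar c = (\<lambda>w. c * f w)"
  unfolding free_algebra_simps free_scalar_def sum_take_Nil sum_drop_Nil by (simp_all add: mult.commute)

definition free_word :: "nat list \<Rightarrow> nat list \<Rightarrow> complex" where
  "free_word w = (\<lambda>v. if v = w then 1 else 0)"

lemma free_word_closed: "set w \<subseteq> {1..d} \<Longrightarrow> free_word w \<in> carrier (free_algebra d)"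
  by (auto simp: free_algebra_simps free_word_def)

lemma free_gen_word: "free_gen j = free_word [j]"
  by (simp add: free_gen_def free_word_def)

lemma free_word_Cons: "free_word (j # w) = free_gen j \<otimes>\<^bsub>free_algebra d\<^esub> free_word w"
proof
  fix v
  have "(\<Sum>i\<le>length v. free_gen j (take i v) * free_word w (drop i v)) = (\<Sum>i\<le>length v. if i = 1 then free_word (j # w) v else 0)"
  proof (intro sum.cong refl)
    fix i assume "i \<in> {..length v}"
    then show "free_gen j (take i v) * free_word w (drop i v) = (if i = 1 then free_word (j # w) v else 0)"
      by (cases v; cases i) (auto simp: free_gen_def free_word_def)
  qed
  also have "\<dots> = free_word (j # w) v" by (auto simp: free_word_def Suc_le_eq)
  finally show "free_word (j # w) v = (free_gen j \<otimes>\<^bsub>free_algebra d\<^esub> free_word w) v"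
    by (simp add: free_algebra_simps)
qed

section \<open>The quotient algebra: central scalars, normal ordering, spanning\<close>

locale clifford_quotient =
  fixes m d :: nat
  assumes m_gt_0: "m > 0"
begin

abbreviation "F \<equiv> free_algebra d"
abbreviation "C \<equiv> clifford m d"
abbreviation "I \<equiv> clifford_ideal m d"
abbreviation "s \<equiv> clifford_scalar m d"
abbreviation "g \<equiv> clifford_gen m d"

sublocale F: ring F
  by (rule free_algebra_ring)

lemma gen_closed: "j \<in> {1..d} \<Longrightarrow> free_gen j \<in> carrier F"
  unfolding free_gen_word by (rule free_word_closed) auto

lemma relators_closed: "clifford_relators m d \<subseteq> carrier F"
  by (auto simp: clifford_relators_def Let_def gen_closed free_scalar_closed)

sublocale ideal I F
  unfolding clifford_ideal_def by (rule F.genideal_ideal[OF relators_closed])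

sublocale C: ring C
  unfolding clifford_def by (rule quotient_is_ring)

sublocale \<pi>: ring_hom_ring F C "(+>\<^bsub>F\<^esub>) I"
  unfolding clifford_def by (rule rcos_ring_hom_ring)

lemma C_cases:
  assumes "U \<in> carrier C"
  obtains f where "f \<in> carrier F" "U = I +>\<^bsub>F\<^esub> f"
proof -
  have "U \<in> (\<Union>f\<in>carrier F. {I +>\<^bsub>F\<^esub> f})"
    using assms unfolding clifford_def FactRing_def A_RCOSETS_def' partial_object.simps .
  then show ?thesis using that by blast
qed

lemma coset_eqI: "f \<in> carrier F \<Longrightarrow> f' \<in> carrier F \<Longrightarrow> f \<ominus>\<^bsub>F\<^esub> f' \<in> I \<Longrightarrow> I +>\<^bsub>F\<^esub> f = I +>\<^bsub>F\<^esub> f'"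
  using F.quotient_eq_iff_same_a_r_cos[OF ideal_axioms] by blast

lemma relator_in_ideal: "x \<in> clifford_relators m d \<Longrightarrow> x \<in> I"
  using F.genideal_self[OF relators_closed] by (auto simp: clifford_ideal_def)

lemma s_closed [simp]: "s c \<in> carrier C"
  unfolding clifford_scalar_def by (intro \<pi>.hom_closed free_scalar_closed)

lemma g_closed [simp]: "j \<in> {1..d} \<Longrightarrow> g j \<in> carrier C"
  unfolding clifford_gen_def by (intro \<pi>.hom_closed gen_closed)

lemma s_mult: "s a \<otimes>\<^bsub>C\<^esub> s b = s (a * b)"
  unfolding clifford_scalar_def \<pi>.hom_mult[OF free_scalar_closed free_scalar_closed, symmetric] free_scalar_simps
  by (simp add: free_scalar_def if_distrib[of "\<lambda>x. _ * x"] mult.commute cong: if_cong)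

lemma s_add: "s a \<oplus>\<^bsub>C\<^esub> s b = s (a + b)"
  unfolding clifford_scalar_def \<pi>.hom_add[OF free_scalar_closed free_scalar_closed, symmetric]
  by (rule arg_cong[where f = "(+>\<^bsub>F\<^esub>) I"]) (auto simp: free_scalar_def free_algebra_simps)

lemma s_one: "s 1 = \<one>\<^bsub>C\<^esub>"
  using \<pi>.hom_one by (simp add: clifford_scalar_def free_scalar_def free_algebra_simps)

lemma s_zero: "s 0 = \<zero>\<^bsub>C\<^esub>"
  using \<pi>.hom_zero by (simp add: clifford_scalar_def free_scalar_def free_algebra_simps)

lemma s_central: "x \<in> carrier C \<Longrightarrow> x \<otimes>\<^bsub>C\<^esub> s c = s c \<otimes>\<^bsub>C\<^esub> x"
proof (erule C_cases)
  fix f assume f: "f \<in> carrier F" and x: "x = I +>\<^bsub>F\<^esub> f"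
  show ?thesis unfolding x clifford_scalar_def
    by (simp add: f free_scalar_closed free_scalar_simps flip: \<pi>.hom_mult)
qed

lemma s_left_commute: "x \<in> carrier C \<Longrightarrow> y \<in> carrier C \<Longrightarrow> x \<otimes>\<^bsub>C\<^esub> (s c \<otimes>\<^bsub>C\<^esub> y) = s c \<otimes>\<^bsub>C\<^esub> (x \<otimes>\<^bsub>C\<^esub> y)"
  by (simp add: s_central flip: C.m_assoc)

lemma s_s_mult: "y \<in> carrier C \<Longrightarrow> s a \<otimes>\<^bsub>C\<^esub> (s b \<otimes>\<^bsub>C\<^esub> y) = s (a * b) \<otimes>\<^bsub>C\<^esub> y"
  by (simp add: s_mult flip: C.m_assoc)

lemma g_pow_m: 
  assumes "j \<in> {1..d}"
  shows "g j [^]\<^bsub>C\<^esub> m = \<one>\<^bsub>C\<^esub>"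
proof -
  have "free_gen j [^]\<^bsub>F\<^esub> m \<ominus>\<^bsub>F\<^esub> \<one>\<^bsub>F\<^esub> \<in> I"
    by (rule relator_in_ideal) (use assms in \<open>unfold clifford_relators_def Let_def, blast\<close>)
  then have "I +>\<^bsub>F\<^esub> (free_gen j [^]\<^bsub>F\<^esub> m) = I +>\<^bsub>F\<^esub> \<one>\<^bsub>F\<^esub>"
    using assms by (intro coset_eqI) (auto simp: gen_closed)
  then show ?thesis using assms by (simp add: clifford_gen_def gen_closed \<pi>.hom_nat_pow)
qed

lemma g_swap:
  assumes "k \<in> {1..d}" "l \<in> {1..d}" "k < l"
  shows "g k \<otimes>\<^bsub>C\<^esub> g l = s (clifford_omega m) \<otimes>\<^bsub>C\<^esub> (g l \<otimes>\<^bsub>C\<^esub> g k)"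
proof -
  let ?x = "free_gen k \<otimes>\<^bsub>F\<^esub> free_gen l" and ?y = "free_scalar (clifford_omega m) \<otimes>\<^bsub>F\<^esub> (free_gen l \<otimes>\<^bsub>F\<^esub> free_gen k)"
  have "?x \<ominus>\<^bsub>F\<^esub> ?y \<in> I"
    by (rule relator_in_ideal) (use assms in \<open>unfold clifford_relators_def Let_def, blast\<close>)
  then have "I +>\<^bsub>F\<^esub> ?x = I +>\<^bsub>F\<^esub> ?y"
    using assms by (intro coset_eqI) (auto simp: gen_closed free_scalar_closed)
  then show ?thesis using assms by (simp add: clifford_gen_def clifford_scalar_def gen_closed free_scalar_closed)
qed

lemma g_swap':
  assumes "x \<in> {1..d}" "a \<in> {1..d}" "x < a"
  shows "g a \<otimes>\<^bsub>C\<^esub> g x = s (cnj (clifford_omega m)) \<otimes>\<^bsub>C\<^esub> (g x \<otimes>\<^bsub>C\<^esub> g a)"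
  using assms by (simp add: g_swap[OF assms] s_s_mult s_one)

text \<open>An arbitrary list of generators takes the place of \<open>[1..<Suc d]\<close>, so that
  induction on the list is possible.\<close>

definition cmon :: "nat list \<Rightarrow> (nat \<Rightarrow> nat) \<Rightarrow> (nat list \<Rightarrow> complex) set" where
  "cmon xs J = foldr (\<lambda>j x. (g j [^]\<^bsub>C\<^esub> J j) \<otimes>\<^bsub>C\<^esub> x) xs \<one>\<^bsub>C\<^esub>"

lemma cmon_simps: "cmon [] J = \<one>\<^bsub>C\<^esub>" "cmon (x # xs) J = (g x [^]\<^bsub>C\<^esub> J x) \<otimes>\<^bsub>C\<^esub> cmon xs J"
  by (simp_all add: cmon_def)

lemma cmon_closed: "set xs \<subseteq> {1..d} \<Longrightarrow> cmon xs J \<in> carrier C"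
  by (induction xs) (auto simp: cmon_simps simp del: atLeastAtMost_iff)

lemma cmon_cong: "(\<And>j. j \<in> set xs \<Longrightarrow> J j = K j) \<Longrightarrow> cmon xs J = cmon xs K"
  by (induction xs) (auto simp: cmon_simps)

lemma g_pow_mod:
  assumes "j \<in> {1..d}"
  shows "g j [^]\<^bsub>C\<^esub> (t mod m) = g j [^]\<^bsub>C\<^esub> t"
proof -
  have "g j [^]\<^bsub>C\<^esub> t = g j [^]\<^bsub>C\<^esub> (m * (t div m) + t mod m)" by simp
  also have "\<dots> = (g j [^]\<^bsub>C\<^esub> m) [^]\<^bsub>C\<^esub> (t div m) \<otimes>\<^bsub>C\<^esub> g j [^]\<^bsub>C\<^esub> (t mod m)"
    by (simp only: C.nat_pow_mult[OF g_closed[OF assms]] C.nat_pow_pow[OF g_closed[OF assms]])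
  finally show ?thesis using assms by (simp add: g_pow_m del: atLeastAtMost_iff)
qed

text \<open>Each exchange with one factor \<open>g x\<close> contributes the conjugate of omega. The
  resulting scalar stays unspecified, since only the span of the monomials is at stake.\<close>

lemma g_swap_pow:
  assumes "x \<in> {1..d}" "a \<in> {1..d}" "x < a"
  shows "\<exists>c. g a \<otimes>\<^bsub>C\<^esub> (g x [^]\<^bsub>C\<^esub> (t :: nat)) = s c \<otimes>\<^bsub>C\<^esub> ((g x [^]\<^bsub>C\<^esub> t) \<otimes>\<^bsub>C\<^esub> g a)"
proof (induction t)
  case 0
  have "g a \<otimes>\<^bsub>C\<^esub> (g x [^]\<^bsub>C\<^esub> (0 :: nat)) = s 1 \<otimes>\<^bsub>C\<^esub> ((g x [^]\<^bsub>C\<^esub> (0 :: nat)) \<otimes>\<^bsub>C\<^esub> g a)"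
    using g_closed[OF assms(2)] by (simp add: s_one)
  then show ?case ..
next
  case (Suc t)
  let ?P = "g x [^]\<^bsub>C\<^esub> t"
  have c: "g a \<in> carrier C" "g x \<in> carrier C" "?P \<in> carrier C" using g_closed assms by auto
  obtain e where e: "g a \<otimes>\<^bsub>C\<^esub> ?P = s e \<otimes>\<^bsub>C\<^esub> (?P \<otimes>\<^bsub>C\<^esub> g a)" using Suc by blast
  have "g a \<otimes>\<^bsub>C\<^esub> (g x [^]\<^bsub>C\<^esub> Suc t) = (g a \<otimes>\<^bsub>C\<^esub> ?P) \<otimes>\<^bsub>C\<^esub> g x" using c by (simp add: C.m_assoc)
  also have "\<dots> = s e \<otimes>\<^bsub>C\<^esub> (?P \<otimes>\<^bsub>C\<^esub> (g a \<otimes>\<^bsub>C\<^esub> g x))" using c by (simp add: e C.m_assoc)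
  also have "\<dots> = s (e * cnj (clifford_omega m)) \<otimes>\<^bsub>C\<^esub> (?P \<otimes>\<^bsub>C\<^esub> (g x \<otimes>\<^bsub>C\<^esub> g a))"
    unfolding g_swap'[OF assms] using c by (simp add: s_left_commute[of ?P] s_s_mult)
  also have "\<dots> = s (e * cnj (clifford_omega m)) \<otimes>\<^bsub>C\<^esub> ((g x [^]\<^bsub>C\<^esub> Suc t) \<otimes>\<^bsub>C\<^esub> g a)"
    using c by (simp add: C.m_assoc)
  finally show ?case by blast
qed

text \<open>The factor \<open>g a\<close> passes the smaller generators, which come first in a
  sorted list, and merges with its own power; reduction of the exponent modulo \<open>m\<close>
  keeps the multi-index in range. Later factors do not involve \<open>a\<close>, so changing
  \<open>J a\<close> leaves them alone.\<close>

lemma g_mult_cmon: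
  assumes "sorted_wrt (<) xs" "set xs \<subseteq> {1..d}" "a \<in> set xs"
  shows "\<exists>c. g a \<otimes>\<^bsub>C\<^esub> cmon xs J = s c \<otimes>\<^bsub>C\<^esub> cmon xs (J(a := Suc (J a) mod m))"
  using assms
proof (induction xs)
  case (Cons x xs)
  let ?J = "J(a := Suc (J a) mod m)"
  have xs: "set xs \<subseteq> {1..d}" and x: "x \<in> {1..d}" and a: "a \<in> {1..d}" using Cons.prems by auto
  have c: "g a \<in> carrier C" "g x \<in> carrier C" "cmon xs K \<in> carrier C" for K
    using g_closed[OF x] g_closed[OF a] cmon_closed[OF xs] by auto
  show ?case
  proof (cases "x = a")
    case True
    have "g a \<otimes>\<^bsub>C\<^esub> cmon (x # xs) J = (g a [^]\<^bsub>C\<^esub> Suc (J a)) \<otimes>\<^bsub>C\<^esub> cmon xs J"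
      using c C.nat_pow_Suc2[OF c(1), of "J a"] by (simp add: cmon_simps True C.m_assoc del: C.nat_pow_Suc)
    also have "\<dots> = (g a [^]\<^bsub>C\<^esub> (Suc (J a) mod m)) \<otimes>\<^bsub>C\<^esub> cmon xs J" by (simp only: g_pow_mod[OF a])
    also have "cmon xs J = cmon xs ?J" using Cons.prems(1) True by (intro cmon_cong) auto
    finally have "g a \<otimes>\<^bsub>C\<^esub> cmon (x # xs) J = s 1 \<otimes>\<^bsub>C\<^esub> cmon (x # xs) ?J"
      using c by (simp add: cmon_simps True s_one)
    then show ?thesis ..
  next
    case False
    then have ax: "a \<in> set xs" "x < a" using Cons.prems by auto
    obtain e where e: "g a \<otimes>\<^bsub>C\<^esub> (g x [^]\<^bsub>C\<^esub> J x) = s e \<otimes>\<^bsub>C\<^esub> ((g x [^]\<^bsub>C\<^esub> J x) \<otimes>\<^bsub>C\<^esub> g a)"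
      using g_swap_pow[OF x a ax(2)] by blast
    obtain e' where e': "g a \<otimes>\<^bsub>C\<^esub> cmon xs J = s e' \<otimes>\<^bsub>C\<^esub> cmon xs ?J"
      using Cons.IH[OF _ xs ax(1)] Cons.prems(1) unfolding sorted_wrt.simps by blast
    have "g a \<otimes>\<^bsub>C\<^esub> cmon (x # xs) J = (g a \<otimes>\<^bsub>C\<^esub> (g x [^]\<^bsub>C\<^esub> J x)) \<otimes>\<^bsub>C\<^esub> cmon xs J"
      using c by (simp add: cmon_simps C.m_assoc)
    also have "\<dots> = s e \<otimes>\<^bsub>C\<^esub> ((g x [^]\<^bsub>C\<^esub> J x) \<otimes>\<^bsub>C\<^esub> (g a \<otimes>\<^bsub>C\<^esub> cmon xs J))"
      unfolding e using c by (simp add: C.m_assoc)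
    also have "\<dots> = s (e * e') \<otimes>\<^bsub>C\<^esub> cmon (x # xs) ?J"
      unfolding e' using c False by (simp add: s_left_commute[of "g x [^]\<^bsub>C\<^esub> J x"] s_s_mult cmon_simps)
    finally show ?thesis by blast
  qed
qed simp

lemma full_list: "set [1..<Suc d] \<subseteq> {1..d}" "sorted_wrt (<) [1..<Suc d]"
  by (auto simp del: upt_Suc)

lemma cmon_full: "cmon [1..<Suc d] J = clifford_monomial m d J"
  by (simp add: cmon_def clifford_monomial_def)

lemma monomial_closed: "clifford_monomial m d J \<in> carrier C"
  unfolding cmon_full[symmetric] by (rule cmon_closed[OF full_list(1)])

lemma word_normal_form:
  assumes "set w \<subseteq> {1..d}"
  shows "\<exists>c. \<exists>J\<in>multi_indices m d. I +>\<^bsub>F\<^esub> free_word w = s c \<otimes>\<^bsub>C\<^esub> clifford_monomial m d J"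
  using assms
proof (induction w)
  case Nil
  let ?J = "\<lambda>j\<in>{1..d}. 0"
  have "set xs \<subseteq> {1..d} \<Longrightarrow> cmon xs ?J = \<one>\<^bsub>C\<^esub>" for xs
    by (induction xs) (auto simp: cmon_simps)
  then have "clifford_monomial m d ?J = \<one>\<^bsub>C\<^esub>"
    unfolding cmon_full[symmetric] using full_list(1) by blast
  moreover have "I +>\<^bsub>F\<^esub> free_word [] = \<one>\<^bsub>C\<^esub>"
    using \<pi>.hom_one by (simp add: free_word_def free_algebra_simps)
  ultimately have "I +>\<^bsub>F\<^esub> free_word [] = s 1 \<otimes>\<^bsub>C\<^esub> clifford_monomial m d ?J" by (simp add: s_one)
  moreover have "?J \<in> multi_indices m d" using m_gt_0 by (auto simp: multi_indices_def)
  ultimately show ?case by blast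
next
  case (Cons a w)
  then have a: "a \<in> {1..d}" and w: "set w \<subseteq> {1..d}" by auto
  obtain c J where cJ: "J \<in> multi_indices m d" "I +>\<^bsub>F\<^esub> free_word w = s c \<otimes>\<^bsub>C\<^esub> clifford_monomial m d J"
    using Cons.IH[OF w] by blast
  let ?J = "J(a := Suc (J a) mod m)"
  have "a \<in> set [1..<Suc d]" using a by auto
  then obtain c' where c': "g a \<otimes>\<^bsub>C\<^esub> clifford_monomial m d J = s c' \<otimes>\<^bsub>C\<^esub> clifford_monomial m d ?J"
    using g_mult_cmon[OF full_list(2,1), of a J] unfolding cmon_full by blast
  have "I +>\<^bsub>F\<^esub> free_word (a # w) = g a \<otimes>\<^bsub>C\<^esub> (s c \<otimes>\<^bsub>C\<^esub> clifford_monomial m d J)"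
    unfolding free_word_Cons[of a w d] using a w by (simp add: gen_closed free_word_closed clifford_gen_def cJ(2) del: atLeastAtMost_iff)
  also have "\<dots> = s (c * c') \<otimes>\<^bsub>C\<^esub> clifford_monomial m d ?J"
    using g_closed[OF a] monomial_closed by (simp add: s_left_commute[of "g a"] c' s_s_mult)
  finally have "I +>\<^bsub>F\<^esub> free_word (a # w) = s (c * c') \<otimes>\<^bsub>C\<^esub> clifford_monomial m d ?J" .
  moreover have "?J \<in> multi_indices m d" using cJ(1) a m_gt_0 by (auto simp: multi_indices_def PiE_iff extensional_def)
  ultimately show ?case by blast
qed

definition comb :: "((nat \<Rightarrow> nat) \<Rightarrow> complex) \<Rightarrow> (nat list \<Rightarrow> complex) set" where
  "comb u = (\<Oplus>\<^bsub>C\<^esub>J\<in>multi_indices m d. s (u J) \<otimes>\<^bsub>C\<^esub> clifford_monomial m d J)"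

lemma comb_closed: "comb u \<in> carrier C"
  unfolding comb_def by (rule C.finsum_closed) (auto simp: monomial_closed)

lemma comb_add: "comb u \<oplus>\<^bsub>C\<^esub> comb v = comb (\<lambda>J. u J + v J)"
  unfolding comb_def
  by (subst C.finsum_addf[symmetric]) (auto simp: monomial_closed s_add simp flip: C.l_distr)

lemma comb_single:
  assumes "J \<in> multi_indices m d"
  shows "comb (\<lambda>K. if K = J then c else 0) = s c \<otimes>\<^bsub>C\<^esub> clifford_monomial m d J"
proof -
  have "comb (\<lambda>K. if K = J then c else 0) =
    (\<Oplus>\<^bsub>C\<^esub>K\<in>multi_indices m d. if J = K then s c \<otimes>\<^bsub>C\<^esub> clifford_monomial m d K else \<zero>\<^bsub>C\<^esub>)"
    unfolding comb_def by (rule C.finsum_cong') (auto simp: monomial_closed s_zero)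
  also have "\<dots> = s c \<otimes>\<^bsub>C\<^esub> clifford_monomial m d J"
    using assms by (subst C.finsum_singleton) (auto simp: monomial_closed)
  finally show ?thesis .
qed

lemma comb_zero: "comb (\<lambda>_. 0) = \<zero>\<^bsub>C\<^esub>"
  unfolding comb_def by (rule C.add.finprod_one_eqI) (simp add: s_zero monomial_closed)

lemma span:
  assumes "U \<in> carrier C"
  shows "\<exists>u. U = comb u"
proof -
  \<comment> \<open>Stated for all elements supported in \<open>A\<close>, so that the induction on
    \<open>A\<close> can split off one word at a time.\<close>
  have "\<forall>f\<in>carrier F. {w. f w \<noteq> 0} \<subseteq> A \<longrightarrow> (\<exists>u. I +>\<^bsub>F\<^esub> f = comb u)" if "finite A" for A
    using that
  proof (induction A)
    case empty
    have "f = \<zero>\<^bsub>F\<^esub>" if "{w. f w \<noteq> 0} \<subseteq> {}" for f using that by (auto simp: free_algebra_simps)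
    then show ?case using comb_zero \<pi>.hom_zero by metis
  next
    case (insert w A)
    show ?case
    proof (intro ballI impI)
      fix f assume f: "f \<in> carrier F" "{v. f v \<noteq> 0} \<subseteq> insert w A"
      show "\<exists>u. I +>\<^bsub>F\<^esub> f = comb u"
      proof (cases "f w = 0")
        case True
        then have "{v. f v \<noteq> 0} \<subseteq> A" using f(2) by auto
        then show ?thesis using insert.IH f(1) by blast
      next
        case False
        then have w: "set w \<subseteq> {1..d}" using f(1) by (simp add: free_algebra_simps)
        let ?f = "f(w := 0)"
        have "{v. ?f v \<noteq> 0} \<subseteq> {v. f v \<noteq> 0}" by auto
        then have f': "?f \<in> carrier F" using f(1) by (auto simp: free_algebra_simps intro: finite_subset)
        have "{v. ?f v \<noteq> 0} \<subseteq> A" using f(2) by auto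
        then obtain u where u: "I +>\<^bsub>F\<^esub> ?f = comb u" using insert.IH f' by blast
        obtain c J where cJ: "J \<in> multi_indices m d" "I +>\<^bsub>F\<^esub> free_word w = s c \<otimes>\<^bsub>C\<^esub> clifford_monomial m d J"
          using word_normal_form[OF w] by blast
        have "f = ?f \<oplus>\<^bsub>F\<^esub> (free_scalar (f w) \<otimes>\<^bsub>F\<^esub> free_word w)"
          unfolding free_scalar_simps by (auto simp: free_algebra_simps free_word_def)
        then have "I +>\<^bsub>F\<^esub> f = I +>\<^bsub>F\<^esub> (?f \<oplus>\<^bsub>F\<^esub> (free_scalar (f w) \<otimes>\<^bsub>F\<^esub> free_word w))" by simp
        also have "\<dots> = comb u \<oplus>\<^bsub>C\<^esub> (s (f w) \<otimes>\<^bsub>C\<^esub> (s c \<otimes>\<^bsub>C\<^esub> clifford_monomial m d J))"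
          using f' by (simp add: free_scalar_closed free_word_closed[OF w] u cJ(2) clifford_scalar_def)
        also have "\<dots> = comb u \<oplus>\<^bsub>C\<^esub> comb (\<lambda>K. if K = J then f w * c else 0)"
          by (simp add: s_s_mult monomial_closed comb_single[OF cJ(1)])
        finally show ?thesis unfolding comb_add by blast
      qed
    qed
  qed
  then show ?thesis using assms by (elim C_cases) (auto simp: free_algebra_simps(1))
qed

lemma g_unit:
  assumes "j \<in> {1..d}"
  shows "g j \<in> Units C"
proof -
  have c: "g j \<in> carrier C" using g_closed[OF assms] .
  have m: "m = Suc (m - 1)" using m_gt_0 by simp
  have "g j [^]\<^bsub>C\<^esub> (m - 1) \<otimes>\<^bsub>C\<^esub> g j = \<one>\<^bsub>C\<^esub>"
    using g_pow_m[OF assms] m C.nat_pow_Suc[of "g j" "m - 1"] by metis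
  moreover have "g j \<otimes>\<^bsub>C\<^esub> g j [^]\<^bsub>C\<^esub> (m - 1) = \<one>\<^bsub>C\<^esub>"
    using g_pow_m[OF assms] m C.nat_pow_Suc2[OF c, of "m - 1"] by metis
  ultimately show ?thesis using c by (auto simp: Units_def)
qed

lemma monomial_unit: "clifford_monomial m d J \<in> Units C"
proof -
  have "set xs \<subseteq> {1..d} \<Longrightarrow> cmon xs J \<in> Units C" for xs
    by (induction xs) (auto simp: cmon_simps g_unit C.Units_pow_closed simp del: atLeastAtMost_iff)
  then show ?thesis unfolding cmon_full[symmetric] using full_list(1) by blast
qed

end


section \<open>The Clifford algebra as an algebra of matrices\<close>

sublocale clifford_matrices \<subseteq> clifford_quotient m d
  by unfold_locales (rule m_pos)

context clifford_matrices
begin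

section \<open>Evaluation of the free algebra at the matrices\<close>

lemma E_closed: "k < r \<Longrightarrow> j \<in> {1..d} \<Longrightarrow> E k j \<in> carrier_mat n n"
  using clifford_sys.E(1)[OF block_sys] .

definition word_mat :: "nat \<Rightarrow> nat list \<Rightarrow> complex mat" where
  "word_mat k w = foldr (\<lambda>j A. E k j * A) w (1\<^sub>m n)"

lemma word_mat_closed: "k < r \<Longrightarrow> set w \<subseteq> {1..d} \<Longrightarrow> word_mat k w \<in> carrier_mat n n"
proof (induction w)
  case (Cons j w)
  then have "E k j \<in> carrier_mat n n" "word_mat k w \<in> carrier_mat n n" using E_closed by auto
  then show ?case by (simp add: word_mat_def mult_carrier_mat[of _ n n _ n])
qed (simp add: word_mat_def)

lemma word_mat_append:
  assumes "k < r" "set u \<subseteq> {1..d}" "set v \<subseteq> {1..d}"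
  shows "word_mat k (u @ v) = word_mat k u * word_mat k v"
  using assms(2)
proof (induction u)
  case Nil
  then show ?case using word_mat_closed[OF assms(1,3)] by (simp add: word_mat_def)
next
  case (Cons j u)
  then have c: "E k j \<in> carrier_mat n n" "word_mat k u \<in> carrier_mat n n" "word_mat k v \<in> carrier_mat n n"
    using E_closed word_mat_closed assms by auto
  have "word_mat k ((j # u) @ v) = E k j * (word_mat k u * word_mat k v)"
    using Cons by (simp add: word_mat_def)
  also have "\<dots> = word_mat k (j # u) * word_mat k v"
    using c by (simp add: word_mat_def assoc_mult_mat[of _ n n _ n _ n])
  finally show ?case .
qed

text \<open>This is the evaluation homomorphism of the free algebra at the generators of block
  \<open>k\<close>.\<close>

definition \<rho> :: "nat \<Rightarrow> (nat list \<Rightarrow> complex) \<Rightarrow> complex mat" where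
  "\<rho> k f = mat n n (\<lambda>(i, j). \<Sum>w | f w \<noteq> 0. f w * word_mat k w $$ (i, j))"

lemma rho_closed [simp]: "\<rho> k f \<in> carrier_mat n n" "dim_row (\<rho> k f) = n" "dim_col (\<rho> k f) = n"
  by (simp_all add: \<rho>_def)

lemma rho_entry:
  assumes "finite W" "\<And>w. w \<notin> W \<Longrightarrow> f w = 0" "i < n" "j < n"
  shows "\<rho> k f $$ (i, j) = (\<Sum>w\<in>W. f w * word_mat k w $$ (i, j))"
  using assms by (auto simp: \<rho>_def intro!: sum.mono_neutral_left)

lemma rho_add:
  assumes "f \<in> carrier F" "f' \<in> carrier F"
  shows "\<rho> k (f \<oplus>\<^bsub>F\<^esub> f') = \<rho> k f + \<rho> k f'"
proof (rule eq_matI)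
  fix i j assume "i < dim_row (\<rho> k f + \<rho> k f')" "j < dim_col (\<rho> k f + \<rho> k f')"
  then have ij: "i < n" "j < n" by auto
  let ?W = "{w. f w \<noteq> 0} \<union> {w. f' w \<noteq> 0}"
  have W: "finite ?W" using assms by (simp add: free_algebra_simps)
  show "\<rho> k (f \<oplus>\<^bsub>F\<^esub> f') $$ (i, j) = (\<rho> k f + \<rho> k f') $$ (i, j)"
    using ij rho_entry[OF W, of f] rho_entry[OF W, of f'] rho_entry[OF W, of "f \<oplus>\<^bsub>F\<^esub> f'"]
    by (simp add: free_algebra_simps sum.distrib algebra_simps)
qed auto

lemma rho_mult:
  assumes "k < r" "f \<in> carrier F" "f' \<in> carrier F"
  shows "\<rho> k (f \<otimes>\<^bsub>F\<^esub> f') = \<rho> k f * \<rho> k f'"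
proof (rule eq_matI)
  fix i j assume "i < dim_row (\<rho> k f * \<rho> k f')" "j < dim_col (\<rho> k f * \<rho> k f')"
  then have ij: "i < n" "j < n" by auto
  let ?A = "{w. f w \<noteq> 0}" and ?B = "{w. f' w \<noteq> 0}"
  let ?W = "(\<lambda>(u, v). u @ v) ` (?A \<times> ?B)"
  have fin: "finite ?A" "finite ?B" "finite ?W" and sub: "\<And>u. u \<in> ?A \<Longrightarrow> set u \<subseteq> {1..d}" "\<And>v. v \<in> ?B \<Longrightarrow> set v \<subseteq> {1..d}"
    using assms by (auto simp: free_algebra_simps)
  have "\<rho> k (f \<otimes>\<^bsub>F\<^esub> f') $$ (i, j) = (\<Sum>w\<in>?W. (f \<otimes>\<^bsub>F\<^esub> f') w * word_mat k w $$ (i, j))"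
    using free_mult_nonzero[of f _ f'] by (intro rho_entry fin ij) (fastforce simp: free_algebra_simps)
  also have "\<dots> = (\<Sum>u\<in>?A. \<Sum>v\<in>?B. f u * f' v * word_mat k (u @ v) $$ (i, j))"
    unfolding free_algebra_simps by (rule convolution_sum[OF fin]) auto
  also have "\<dots> = (\<Sum>u\<in>?A. \<Sum>v\<in>?B. f u * f' v * (\<Sum>l<n. word_mat k u $$ (i, l) * word_mat k v $$ (l, j)))"
  proof (intro sum.cong refl)
    fix u v assume "u \<in> ?A" "v \<in> ?B"
    with sub have uv: "set u \<subseteq> {1..d}" "set v \<subseteq> {1..d}" by blast+
    then show "f u * f' v * word_mat k (u @ v) $$ (i, j) = f u * f' v * (\<Sum>l<n. word_mat k u $$ (i, l) * word_mat k v $$ (l, j))"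
      using ij word_mat_closed[OF assms(1) uv(1)] word_mat_closed[OF assms(1) uv(2)]
      by (simp add: word_mat_append[OF assms(1)] scalar_prod_def atLeast0LessThan)
  qed
  also have "\<dots> = (\<Sum>u\<in>?A. \<Sum>v\<in>?B. \<Sum>l<n. (f u * word_mat k u $$ (i, l)) * (f' v * word_mat k v $$ (l, j)))"
    by (simp add: sum_distrib_left mult_ac)
  also have "\<dots> = (\<Sum>l<n. \<Sum>u\<in>?A. \<Sum>v\<in>?B. (f u * word_mat k u $$ (i, l)) * (f' v * word_mat k v $$ (l, j)))"
    by (simp only: sum.swap[of _ "{..<n}"])
  also have "\<dots> = (\<Sum>l<n. (\<Sum>u\<in>?A. f u * word_mat k u $$ (i, l)) * (\<Sum>v\<in>?B. f' v * word_mat k v $$ (l, j)))"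
    by (simp only: sum_product)
  also have "\<dots> = (\<Sum>l<n. \<rho> k f $$ (i, l) * \<rho> k f' $$ (l, j))"
    using ij by (simp add: \<rho>_def)
  also have "\<dots> = (\<rho> k f * \<rho> k f') $$ (i, j)"
    using ij by (simp add: scalar_prod_def atLeast0LessThan)
  finally show "\<rho> k (f \<otimes>\<^bsub>F\<^esub> f') $$ (i, j) = (\<rho> k f * \<rho> k f') $$ (i, j)" .
qed auto

lemma rho_scalar: "\<rho> k (free_scalar c) = c \<cdot>\<^sub>m 1\<^sub>m n"
proof (rule eq_matI)
  fix i j assume "i < dim_row (c \<cdot>\<^sub>m 1\<^sub>m n)" "j < dim_col (c \<cdot>\<^sub>m 1\<^sub>m n)"
  then show "\<rho> k (free_scalar c) $$ (i, j) = (c \<cdot>\<^sub>m 1\<^sub>m n) $$ (i, j)"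
    using rho_entry[of "{[]}" "free_scalar c" i j k] by (simp add: free_scalar_def word_mat_def)
qed auto

lemma rho_one: "\<rho> k \<one>\<^bsub>F\<^esub> = 1\<^sub>m n"
proof -
  have "\<one>\<^bsub>F\<^esub> = free_scalar 1" by (simp add: free_algebra_simps free_scalar_def)
  then show ?thesis by (simp add: rho_scalar one_smult_mat)
qed

lemma rho_gen:
  assumes "k < r" "a \<in> {1..d}"
  shows "\<rho> k (free_gen a) = E k a"
proof (rule eq_matI)
  note c = E_closed[OF assms]
  show "dim_row (\<rho> k (free_gen a)) = dim_row (E k a)" "dim_col (\<rho> k (free_gen a)) = dim_col (E k a)" using c by auto
  fix i j assume "i < dim_row (E k a)" "j < dim_col (E k a)"
  then show "\<rho> k (free_gen a) $$ (i, j) = E k a $$ (i, j)"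
    using rho_entry[of "{[a]}" "free_gen a" i j k] c by (simp add: free_gen_def word_mat_def)
qed

abbreviation "R \<equiv> ring_mat TYPE(complex) n ()"

lemma rho_ring_hom: "k < r \<Longrightarrow> ring_hom_ring F R (\<rho> k)"
  by (intro ring_hom_ringI2 ring_hom_memI free_algebra_ring ring_mat)
     (simp_all add: ring_mat_simps rho_add rho_mult rho_one)

text \<open>The kernel of a ring homomorphism is an ideal, so by minimality of the generated ideal
  only the relators need checking. Each is a difference of two elements with the same image, the
  situation isolated in \<open>minus\<close>.\<close>

lemma rho_ideal:
  assumes k: "k < r" and f: "f \<in> I"
  shows "\<rho> k f = 0\<^sub>m n n"
proof -
  interpret \<rho>: ring_hom_ring F R "\<rho> k" using rho_ring_hom[OF k] .
  have minus: "x \<ominus>\<^bsub>F\<^esub> y \<in> a_kernel F R (\<rho> k)" if "x \<in> carrier F" "y \<in> carrier F" "\<rho> k x = \<rho> k y" for x y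
  proof -
    have "\<rho> k (x \<ominus>\<^bsub>F\<^esub> y) = \<rho> k x \<ominus>\<^bsub>R\<^esub> \<rho> k y"
      unfolding a_minus_def using that(1,2) by (simp only: \<rho>.hom_add \<rho>.hom_a_inv F.a_inv_closed)
    also have "\<dots> = \<zero>\<^bsub>R\<^esub>"
      unfolding a_minus_def that(3) by (rule \<rho>.S.r_neg) (simp add: ring_mat_simps)
    finally show ?thesis unfolding a_kernel_def' using F.minus_closed[OF that(1,2)] by blast
  qed
  have "clifford_relators m d \<subseteq> a_kernel F R (\<rho> k)"
  proof
    fix x assume "x \<in> clifford_relators m d"
    then consider j where "j \<in> {1..d}" "x = free_gen j [^]\<^bsub>F\<^esub> m \<ominus>\<^bsub>F\<^esub> \<one>\<^bsub>F\<^esub>"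
      | a b where "a \<in> {1..d}" "b \<in> {1..d}" "a < b" "x = free_gen a \<otimes>\<^bsub>F\<^esub> free_gen b \<ominus>\<^bsub>F\<^esub>
          (free_scalar (clifford_omega m) \<otimes>\<^bsub>F\<^esub> (free_gen b \<otimes>\<^bsub>F\<^esub> free_gen a))"
      unfolding clifford_relators_def Let_def by blast
    then show "x \<in> a_kernel F R (\<rho> k)"
    proof cases
      case 1
      have "\<rho> k (free_gen j [^]\<^bsub>F\<^esub> m) = E k j ^\<^sub>m m"
        using \<rho>.hom_nat_pow[OF gen_closed[OF 1(1)], of m] pow_mat_ring_pow[OF E_closed[OF k 1(1)], of m "()"]
        by (simp add: rho_gen[OF k 1(1)])
      also have "\<dots> = \<rho> k \<one>\<^bsub>F\<^esub>" using clifford_sys.E(3)[OF block_sys[OF k] 1(1)] by (simp add: rho_one)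
      finally show ?thesis unfolding 1(2) using gen_closed[OF 1(1)] by (intro minus) auto
    next
      case 2
      note c = gen_closed[OF 2(1)] gen_closed[OF 2(2)] free_scalar_closed
      have "\<rho> k (free_gen a \<otimes>\<^bsub>F\<^esub> free_gen b) = clifford_omega m \<cdot>\<^sub>m (E k b * E k a)"
        using clifford_sys.E(4)[OF block_sys[OF k] 2(1-3)] by (simp add: ring_mat_simps c rho_gen[OF k 2(1)] rho_gen[OF k 2(2)])
      also have "\<dots> = \<rho> k (free_scalar (clifford_omega m) \<otimes>\<^bsub>F\<^esub> (free_gen b \<otimes>\<^bsub>F\<^esub> free_gen a))"
        using E_closed[OF k 2(1)] E_closed[OF k 2(2)]
        by (simp add: ring_mat_simps c rho_gen[OF k 2(1)] rho_gen[OF k 2(2)] rho_scalar mult_smult_assoc_mat[of _ n n _ n]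
            mult_carrier_mat[of _ n n _ n] left_mult_one_mat[of _ n n])
      finally show ?thesis unfolding 2(4) using c by (intro minus) auto
    qed
  qed
  then have "I \<subseteq> a_kernel F R (\<rho> k)"
    unfolding clifford_ideal_def by (rule F.genideal_minimal[OF \<rho>.kernel_is_ideal])
  then show ?thesis using f unfolding a_kernel_def' ring_mat_simps by blast
qed

text \<open>The argument is a coset, so a representative is picked by \<open>SOME\<close>;
  independence of the choice is \<open>Phi_coset\<close>.\<close>

definition \<Phi> :: "nat \<Rightarrow> (nat list \<Rightarrow> complex) set \<Rightarrow> complex mat" where
  "\<Phi> k U = \<rho> k (SOME f. f \<in> carrier F \<and> U = I +>\<^bsub>F\<^esub> f)"

lemma Phi_coset:
  assumes k: "k < r" and f: "f \<in> carrier F"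
  shows "\<Phi> k (I +>\<^bsub>F\<^esub> f) = \<rho> k f"
proof -
  interpret \<rho>: ring_hom_ring F R "\<rho> k" using rho_ring_hom[OF k] .
  define f' where "f' = (SOME f'. f' \<in> carrier F \<and> I +>\<^bsub>F\<^esub> f = I +>\<^bsub>F\<^esub> f')"
  have f': "f' \<in> carrier F" "I +>\<^bsub>F\<^esub> f = I +>\<^bsub>F\<^esub> f'"
    using someI[of "\<lambda>f'. f' \<in> carrier F \<and> I +>\<^bsub>F\<^esub> f = I +>\<^bsub>F\<^esub> f'" f] f by (auto simp: f'_def)
  have x: "f' \<ominus>\<^bsub>F\<^esub> f \<in> I" using F.quotient_eq_iff_same_a_r_cos[OF ideal_axioms f'(1) f] f'(2) by simp
  have "f' = (f' \<ominus>\<^bsub>F\<^esub> f) \<oplus>\<^bsub>F\<^esub> f" using f f' by (simp add: a_minus_def F.a_assoc F.l_neg)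
  then have "\<rho> k f' = \<rho> k (f' \<ominus>\<^bsub>F\<^esub> f) + \<rho> k f" using rho_add[of "f' \<ominus>\<^bsub>F\<^esub> f" f] f f' by simp
  also have "\<dots> = \<rho> k f" by (simp add: rho_ideal[OF k x])
  finally show ?thesis by (simp add: \<Phi>_def f'_def)
qed

lemma Phi_closed [simp]: "\<Phi> k U \<in> carrier_mat n n"
  by (simp add: \<Phi>_def)

lemma dim_Phi [simp]: "dim_row (\<Phi> k U) = n" "dim_col (\<Phi> k U) = n"
  by (simp_all add: \<Phi>_def)

lemma dim_mono_mat [simp]: "k < r \<Longrightarrow> dim_row (mono_mat k J) = n" "k < r \<Longrightarrow> dim_col (mono_mat k J) = n"
  using carrier_matD[OF mon_carrier[of k J]] by blast+

lemma Phi_mult: "k < r \<Longrightarrow> U \<in> carrier C \<Longrightarrow> V \<in> carrier C \<Longrightarrow> \<Phi> k (U \<otimes>\<^bsub>C\<^esub> V) = \<Phi> k U * \<Phi> k V"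
  by (elim C_cases) (simp add: Phi_coset rho_mult flip: \<pi>.hom_mult)

lemma Phi_add: "k < r \<Longrightarrow> U \<in> carrier C \<Longrightarrow> V \<in> carrier C \<Longrightarrow> \<Phi> k (U \<oplus>\<^bsub>C\<^esub> V) = \<Phi> k U + \<Phi> k V"
  by (elim C_cases) (simp add: Phi_coset rho_add flip: \<pi>.hom_add)

lemma Phi_one: "k < r \<Longrightarrow> \<Phi> k \<one>\<^bsub>C\<^esub> = 1\<^sub>m n"
  using Phi_coset[OF _ F.one_closed] by (simp add: rho_one)

lemma Phi_scalar: "k < r \<Longrightarrow> \<Phi> k (s c) = c \<cdot>\<^sub>m 1\<^sub>m n"
  by (simp add: clifford_scalar_def Phi_coset free_scalar_closed rho_scalar)

lemma Phi_scalar_mult: "k < r \<Longrightarrow> U \<in> carrier C \<Longrightarrow> \<Phi> k (s c \<otimes>\<^bsub>C\<^esub> U) = c \<cdot>\<^sub>m \<Phi> k U"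
  by (simp add: Phi_mult Phi_scalar mult_smult_assoc_mat[of _ n n _ n] left_mult_one_mat[of _ n n])

lemma Phi_zero: "k < r \<Longrightarrow> \<Phi> k \<zero>\<^bsub>C\<^esub> = 0\<^sub>m n n"
  using Phi_scalar[of k 0] by (auto simp: s_zero)

lemma Phi_gen: "k < r \<Longrightarrow> j \<in> {1..d} \<Longrightarrow> \<Phi> k (g j) = E k j"
  by (simp add: clifford_gen_def Phi_coset gen_closed rho_gen del: atLeastAtMost_iff)

lemma Phi_pow: "k < r \<Longrightarrow> U \<in> carrier C \<Longrightarrow> \<Phi> k (U [^]\<^bsub>C\<^esub> (t :: nat)) = \<Phi> k U ^\<^sub>m t"
proof (induction t)
  case 0
  then show ?case by (simp add: Phi_one)
qed (simp add: Phi_mult)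

lemma Phi_monomial:
  assumes k: "k < r"
  shows "\<Phi> k (clifford_monomial m d J) = mono_mat k J"
proof -
  have "set xs \<subseteq> {1..d} \<Longrightarrow> \<Phi> k (cmon xs J) = mat_monomial n (E k) xs J" for xs
  proof (induction xs)
    case Nil
    then show ?case using k by (simp add: cmon_simps Phi_one mat_monomial_def)
  next
    case (Cons x xs)
    then have "x \<in> {1..d}" "g x \<in> carrier C" "cmon xs J \<in> carrier C" using g_closed cmon_closed by auto
    then show ?case using Cons k by (simp add: cmon_simps Phi_mult Phi_pow Phi_gen mat_monomial_def del: atLeastAtMost_iff)
  qed
  then show ?thesis unfolding cmon_full[symmetric] full_monomial_def using full_list(1) by blast
qed

lemma Phi_finsum:
  assumes "k < r" "finite A" "x \<in> A \<rightarrow> carrier C" "i < n" "j < n"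
  shows "\<Phi> k (\<Oplus>\<^bsub>C\<^esub>a\<in>A. x a) $$ (i, j) = (\<Sum>a\<in>A. \<Phi> k (x a) $$ (i, j))"
  using assms(2,3)
proof (induction A)
  case empty
  then show ?case using assms by (simp add: Phi_zero)
next
  case (insert a A)
  then have "\<Phi> k (finsum C x (insert a A)) = \<Phi> k (x a) + \<Phi> k (finsum C x A)"
    using assms(1) by (simp add: C.finsum_insert Phi_add C.finsum_closed)
  then show ?case using insert assms by (simp del: C.finsum_insert)
qed

section \<open>Recovering the coefficients from the matrices\<close>

lemma Phi_comb:
  assumes "k < r" "i < n" "j < n"
  shows "\<Phi> k (comb u) $$ (i, j) = (\<Sum>J\<in>multi_indices m d. u J * mono_mat k J $$ (i, j))"
  unfolding comb_def using assms mon_carrier[OF assms(1)]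
  by (subst Phi_finsum) (auto simp: monomial_closed Phi_scalar_mult Phi_monomial intro!: sum.cong)

text \<open>The coefficient in an orthogonal expansion: inner product with the monomial, divided by
  its squared norm \<open>r * n\<close> over all blocks. The division stands inside the sum so that
  the expression has the linear form that \<open>unitary_coordinatesI\<close> expects.\<close>

definition dual :: "(nat \<Rightarrow> complex mat) \<Rightarrow> (nat \<Rightarrow> nat) \<Rightarrow> complex" where
  "dual A J = (\<Sum>k<r. \<Sum>i<n. \<Sum>j<n. cnj (mono_mat k J $$ (i, j)) / of_nat (r * n) * A k $$ (i, j))"

text \<open>This amounts to linear independence of the monomials in the quotient algebra:
  orthogonality of their images isolates each coefficient.\<close>

lemma dual_Phi_comb:
  assumes "K \<in> multi_indices m d"
  shows "dual (\<lambda>k. \<Phi> k (comb u)) K = u K"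
proof -
  let ?c = "of_nat (r * n) :: complex"
  have nz: "?c \<noteq> 0" using r_pos n_pos by simp
  have "dual (\<lambda>k. \<Phi> k (comb u)) K =
    (\<Sum>k<r. \<Sum>i<n. \<Sum>j<n. \<Sum>J\<in>multi_indices m d. u J / ?c * (cnj (mono_mat k K $$ (i, j)) * mono_mat k J $$ (i, j)))"
    unfolding dual_def by (intro sum.cong refl) (simp add: Phi_comb sum_distrib_left mult_ac)
  also have "\<dots> = (\<Sum>J\<in>multi_indices m d. u J / ?c * (\<Sum>k<r. \<Sum>i<n. \<Sum>j<n. cnj (mono_mat k K $$ (i, j)) * mono_mat k J $$ (i, j)))"
    unfolding sum_distrib_left by (simp only: sum.swap[of _ _ "multi_indices m d"])
  also have "\<dots> = (\<Sum>J\<in>multi_indices m d. if K = J then u J else 0)"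
    using assms nz by (intro sum.cong refl) (simp add: mon_orthogonal)
  also have "\<dots> = u K" using assms by simp
  finally show ?thesis .
qed

text \<open>Surjectivity of the representation, with an explicit preimage; completeness now takes
  the role of orthogonality.\<close>

lemma Phi_comb_dual:
  assumes "k < r" "i < n" "j < n"
  shows "\<Phi> k (comb (dual A)) $$ (i, j) = A k $$ (i, j)"
proof -
  let ?c = "of_nat (r * n) :: complex"
  have nz: "?c \<noteq> 0" using r_pos n_pos by simp
  have "\<Phi> k (comb (dual A)) $$ (i, j) =
    (\<Sum>J\<in>multi_indices m d. \<Sum>k'<r. \<Sum>i'<n. \<Sum>j'<n. A k' $$ (i', j') / ?c * (mono_mat k J $$ (i, j) * cnj (mono_mat k' J $$ (i', j'))))"
    unfolding Phi_comb[OF assms] dual_def by (intro sum.cong refl) (simp add: sum_distrib_right sum_distrib_left mult_ac)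
  also have "\<dots> = (\<Sum>k'<r. \<Sum>i'<n. \<Sum>j'<n. A k' $$ (i', j') / ?c * (\<Sum>J\<in>multi_indices m d. mono_mat k J $$ (i, j) * cnj (mono_mat k' J $$ (i', j'))))"
    unfolding sum_distrib_left by (simp only: sum.swap[of _ "multi_indices m d"])
  also have "\<dots> = (\<Sum>k'<r. \<Sum>i'<n. \<Sum>j'<n. if (k, i, j) = (k', i', j') then A k' $$ (i', j') else 0)"
    using assms nz by (intro sum.cong refl) (simp add: mon_complete)
  also have "\<dots> = (\<Sum>q\<in>{..<r} \<times> {..<n} \<times> {..<n}. if (k, i, j) = q then A (fst q) $$ snd q else 0)"
    unfolding sum.cartesian_product by (intro sum.cong) (auto split: if_splits)
  also have "\<dots> = A k $$ (i, j)"
    using assms by (subst sum.mono_neutral_right[where S = "{(k, i, j)}"]) auto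
  finally show ?thesis .
qed

lemma comb_cong: "(\<And>J. J \<in> multi_indices m d \<Longrightarrow> u J = v J) \<Longrightarrow> comb u = comb v"
  unfolding comb_def by (rule C.finsum_cong') (auto simp: monomial_closed)

text \<open>Justifies the definite description: existence comes from \<open>span\<close>, uniqueness
  from \<open>dual_Phi_comb\<close>.\<close>

lemma clifford_coeffs:
  assumes U: "U \<in> carrier C"
  shows "clifford_coeffs m d U \<in> multi_indices m d \<rightarrow>\<^sub>E UNIV" "comb (clifford_coeffs m d U) = U"
proof -
  have "\<exists>!u. u \<in> multi_indices m d \<rightarrow>\<^sub>E UNIV \<and> U = comb u"
  proof -
    obtain u where u: "U = comb u" using span[OF U] by blast
    \<comment> \<open>Coefficient families have to be extensional to be unique, so the one obtained
      from \<open>span\<close> is cut down to the multi-indices.\<close>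
    have "U = comb (restrict u (multi_indices m d))" unfolding u by (rule comb_cong) simp
    moreover have "v = v'" if "v \<in> multi_indices m d \<rightarrow>\<^sub>E UNIV" "v' \<in> multi_indices m d \<rightarrow>\<^sub>E UNIV" "comb v = comb v'" for v v'
      using that dual_Phi_comb[of _ v] dual_Phi_comb[of _ v'] by (intro PiE_ext[of v _ _ v']) auto
    ultimately show ?thesis by (intro ex1I[of _ "restrict u (multi_indices m d)"]) auto
  qed
  from theI'[OF this] show "clifford_coeffs m d U \<in> multi_indices m d \<rightarrow>\<^sub>E UNIV" "comb (clifford_coeffs m d U) = U"
    by (auto simp: clifford_coeffs_def comb_def)
qed

lemma Phi_coeffs:
  "U \<in> carrier C \<Longrightarrow> k < r \<Longrightarrow> i < n \<Longrightarrow> j < n \<Longrightarrow>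
    \<Phi> k U $$ (i, j) = (\<Sum>J\<in>multi_indices m d. mono_mat k J $$ (i, j) * clifford_coeffs m d U J)"
  using Phi_comb[of k i j "clifford_coeffs m d U"] clifford_coeffs(2) by (simp add: mult.commute)

lemma coeffs_Phi:
  "U \<in> carrier C \<Longrightarrow> J \<in> multi_indices m d \<Longrightarrow> clifford_coeffs m d U J = dual (\<lambda>k. \<Phi> k U) J"
  using dual_Phi_comb[of J "clifford_coeffs m d U"] clifford_coeffs(2) by simp

text \<open>Injectivity of the representation, since the coefficients are functions of the
  matrices.\<close>

lemma Phi_eqI:
  assumes "U \<in> carrier C" "V \<in> carrier C" "\<And>k. k < r \<Longrightarrow> \<Phi> k U = \<Phi> k V"
  shows "U = V"
proof -
  have "dual (\<lambda>k. \<Phi> k U) J = dual (\<lambda>k. \<Phi> k V) J" for J using assms(3) by (simp add: dual_def)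
  then have "comb (clifford_coeffs m d U) = comb (clifford_coeffs m d V)"
    using assms by (intro comb_cong) (simp add: coeffs_Phi)
  then show ?thesis using clifford_coeffs(2) assms by simp
qed

section \<open>The conjugation and the unitary group\<close>

lemma conj_closed: "clifford_conj m d U \<in> carrier C"
  unfolding clifford_conj_def by (rule C.finsum_closed) (auto simp: monomial_unit)

text \<open>A left inverse of a unitary matrix is its adjoint. This is the point where the inverses
  in the conjugation become adjoints.\<close>

lemma Phi_inv_monomial:
  assumes k: "k < r"
  shows "\<Phi> k (inv\<^bsub>C\<^esub> clifford_monomial m d J) = mat_adjoint (mono_mat k J)"
proof -
  let ?x = "clifford_monomial m d J" and ?M = "mono_mat k J"
  let ?Y = "\<Phi> k (inv\<^bsub>C\<^esub> ?x)"
  note c = mon_carrier[OF k, of J] mat_adjoint_carrier[OF mon_carrier[OF k, of J]]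
  have "?Y * ?M = \<Phi> k (inv\<^bsub>C\<^esub> ?x \<otimes>\<^bsub>C\<^esub> ?x)"
    by (simp only: Phi_mult[OF k C.Units_inv_closed[OF monomial_unit] monomial_closed] Phi_monomial[OF k])
  also have "\<dots> = 1\<^sub>m n" by (simp only: C.Units_l_inv[OF monomial_unit] Phi_one[OF k])
  finally have "?Y * ?M = 1\<^sub>m n" .
  then have "?Y * ?M * mat_adjoint ?M = mat_adjoint ?M" using c by simp
  moreover have "?Y * ?M * mat_adjoint ?M = ?Y * (?M * mat_adjoint ?M)"
    using c Phi_closed by (intro assoc_mult_mat[of _ n n _ n _ n]) auto
  moreover have "?M * mat_adjoint ?M = 1\<^sub>m n" using unitary_mult_adjoint[OF c(1) mon_unitary[OF k]] .
  ultimately show ?thesis using right_mult_one_mat[OF Phi_closed, of k "inv\<^bsub>C\<^esub> ?x"] by simp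
qed

text \<open>Conjugating the coefficients and replacing each monomial matrix by its adjoint is
  exactly how the adjoint acts on a linear combination.\<close>

lemma Phi_conj:
  assumes U: "U \<in> carrier C" and k: "k < r"
  shows "\<Phi> k (clifford_conj m d U) = mat_adjoint (\<Phi> k U)"
proof (rule eq_matI)
  show "dim_row (\<Phi> k (clifford_conj m d U)) = dim_row (mat_adjoint (\<Phi> k U))"
    "dim_col (\<Phi> k (clifford_conj m d U)) = dim_col (mat_adjoint (\<Phi> k U))" by simp_all
  fix i j assume "i < dim_row (mat_adjoint (\<Phi> k U))" "j < dim_col (mat_adjoint (\<Phi> k U))"
  then have ij: "i < n" "j < n" by simp_all
  have "\<Phi> k (clifford_conj m d U) $$ (i, j) = (\<Sum>J\<in>multi_indices m d. cnj (clifford_coeffs m d U J) * mat_adjoint (mono_mat k J) $$ (i, j))"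
    unfolding clifford_conj_def using k ij mon_carrier[OF k]
    by (subst Phi_finsum) (auto simp: monomial_unit Phi_scalar_mult Phi_inv_monomial intro!: sum.cong)
  also have "\<dots> = (\<Sum>J\<in>multi_indices m d. cnj (mono_mat k J $$ (j, i) * clifford_coeffs m d U J))"
    using ij k by (intro sum.cong) (auto simp: mult.commute)
  also have "\<dots> = cnj (\<Phi> k U $$ (j, i))" using ij k U by (simp add: Phi_coeffs)
  also have "\<dots> = mat_adjoint (\<Phi> k U) $$ (i, j)" using ij by simp
  finally show "\<Phi> k (clifford_conj m d U) $$ (i, j) = mat_adjoint (\<Phi> k U) $$ (i, j)" .
qed

text \<open>The defining equation may be tested after applying all the maps \<open>\<Phi> k\<close>,
  because they are jointly injective.\<close>

lemma unitary_iff: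
  assumes "U \<in> carrier C"
  shows "U \<in> carrier (unitary_clifford m d) \<longleftrightarrow> (\<forall>k<r. mat_adjoint (\<Phi> k U) * \<Phi> k U = 1\<^sub>m n)"
proof -
  have "clifford_conj m d U \<otimes>\<^bsub>C\<^esub> U = \<one>\<^bsub>C\<^esub> \<longleftrightarrow> (\<forall>k<r. \<Phi> k (clifford_conj m d U \<otimes>\<^bsub>C\<^esub> U) = \<Phi> k \<one>\<^bsub>C\<^esub>)"
    using Phi_eqI[OF C.m_closed[OF conj_closed assms] C.one_closed] by (intro iffI) simp_all
  then show ?thesis using assms conj_closed by (simp add: unitary_clifford_def Phi_mult Phi_conj Phi_one)
qed

lemma unitary_coordinates_clifford:
  "\<exists>c c'. unitary_coordinates (unitary_clifford m d) r n (\<lambda>U. \<lambda>k\<in>{..<r}. \<Phi> k U) c c'"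
proof -
  let ?G = "unitary_clifford m d" and ?h = "\<lambda>U. \<lambda>k\<in>{..<r}. \<Phi> k U"
  have sub: "U \<in> carrier C" if "U \<in> carrier ?G" for U using that by (simp add: unitary_clifford_def)
  have ops: "U \<otimes>\<^bsub>?G\<^esub> V = U \<otimes>\<^bsub>C\<^esub> V" "\<one>\<^bsub>?G\<^esub> = \<one>\<^bsub>C\<^esub>" for U V by (simp_all add: unitary_clifford_def)
  have unit: "mat_adjoint (\<Phi> k U) * \<Phi> k U = 1\<^sub>m n" if "U \<in> carrier ?G" "k < r" for U k
    using unitary_iff[OF sub[OF that(1)]] that by simp
  have "unitary_coordinates ?G r n ?h
      (\<lambda>k i j a. mono_mat k (fst a) $$ (i, j) * (if snd a then \<i> else 1))
      (\<lambda>a k i j. (if snd a then - \<i> else 1) * (cnj (mono_mat k (fst a) $$ (i, j)) / of_nat (r * n)))"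
  proof (rule unitary_coordinatesI[where P = "multi_indices m d" and u = "clifford_coeffs m d"])
    show "bij_betw ?h (carrier ?G) ({..<r} \<rightarrow>\<^sub>E carrier (unitary_matrices n))"
    proof (rule bij_betw_byWitness[where f' = "\<lambda>A. comb (dual A)"])
      have eq: "\<Phi> k (comb (dual A)) = A k" if "A \<in> {..<r} \<rightarrow>\<^sub>E carrier (unitary_matrices n)" "k < r" for A k
      proof -
        have "A k \<in> carrier_mat n n" using PiE_mem[OF that(1), of k] that(2) by (simp add: unitary_matrices_def)
        then show ?thesis using that(2) by (intro eq_matI) (simp_all add: Phi_comb_dual)
      qed
      show "\<forall>U\<in>carrier ?G. comb (dual (?h U)) = U"
      proof
        fix U assume U: "U \<in> carrier ?G"
        have "comb (dual (?h U)) = comb (clifford_coeffs m d U)"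
          using sub[OF U] by (intro comb_cong) (simp add: coeffs_Phi dual_def)
        then show "comb (dual (?h U)) = U" using clifford_coeffs(2) sub[OF U] by simp
      qed
      show "\<forall>A\<in>{..<r} \<rightarrow>\<^sub>E carrier (unitary_matrices n). ?h (comb (dual A)) = A"
      proof
        fix A assume A: "A \<in> {..<r} \<rightarrow>\<^sub>E carrier (unitary_matrices n)"
        show "?h (comb (dual A)) = A"
        proof (rule ext)
          fix k show "?h (comb (dual A)) k = A k" using eq[OF A] PiE_arb[OF A, of k] by (cases "k < r") auto
        qed
      qed
      show "?h ` carrier ?G \<subseteq> {..<r} \<rightarrow>\<^sub>E carrier (unitary_matrices n)"
        using unit by (auto simp: unitary_matrices_def)
      show "(\<lambda>A. comb (dual A)) ` ({..<r} \<rightarrow>\<^sub>E carrier (unitary_matrices n)) \<subseteq> carrier ?G"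
      proof (intro image_subsetI)
        fix A assume A: "A \<in> {..<r} \<rightarrow>\<^sub>E carrier (unitary_matrices n)"
        have "mat_adjoint (A k) * A k = 1\<^sub>m n" if "k < r" for k
          using PiE_mem[OF A, of k] that by (simp add: unitary_matrices_def)
        then show "comb (dual A) \<in> carrier ?G" using A by (simp add: unitary_iff comb_closed eq)
      qed
    qed
  next
    fix U V assume UV: "U \<in> carrier ?G" "V \<in> carrier ?G"
    show "U \<otimes>\<^bsub>?G\<^esub> V \<in> carrier ?G"
      unfolding ops using sub UV unit by (simp add: unitary_iff Phi_mult unitary_mult)
    show "?h (U \<otimes>\<^bsub>?G\<^esub> V) k = ?h U k * ?h V k" if "k < r" for k
      using that sub UV by (simp add: ops Phi_mult)
  next
    show "\<one>\<^bsub>?G\<^esub> \<in> carrier ?G" unfolding ops by (simp add: unitary_iff Phi_one)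
    show "?h \<one>\<^bsub>?G\<^esub> k = 1\<^sub>m n" if "k < r" for k using that by (simp add: ops Phi_one)
  next
    fix U k i j assume "U \<in> carrier ?G" "k < r" "i < n" "j < n"
    then show "?h U k $$ (i, j) = (\<Sum>J\<in>multi_indices m d. mono_mat k J $$ (i, j) * clifford_coeffs m d U J)"
      using sub by (simp add: Phi_coeffs)
  next
    fix U J assume "U \<in> carrier ?G" "J \<in> multi_indices m d"
    then show "clifford_coeffs m d U J =
      (\<Sum>k<r. \<Sum>i<n. \<Sum>j<n. cnj (mono_mat k J $$ (i, j)) / of_nat (r * n) * ?h U k $$ (i, j))"
      using sub by (simp add: coeffs_Phi dual_def)
  qed (auto simp: unitary_clifford_def)
  then show ?thesis by blast
qed

end

theorem theorem6p1:
  fixes m d :: nat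
  assumes "m \<ge> 2" and "d \<ge> 1"
  shows "if even d
         then lie_isomorphic (unitary_clifford m d) (unitary_matrices (m ^ (d div 2)))
         else lie_isomorphic (unitary_clifford m d)
                (unitary_matrices_power m (m ^ ((d - 1) div 2)))"
proof -
  obtain E where "clifford_matrices m d (m ^ (d div 2)) (if odd d then m else 1) E"
    using clifford_matrices_exist[OF assms] by blast
  then interpret clifford_matrices m d "m ^ (d div 2)" "if odd d then m else 1" E .
  obtain c c' where U: "unitary_coordinates (unitary_clifford m d) (if odd d then m else 1) (m ^ (d div 2))
      (\<lambda>U. \<lambda>k\<in>{..<if odd d then m else 1}. \<Phi> k U) c c'"
    using unitary_coordinates_clifford by blast
  show ?thesis
  proof (cases "even d")
    case True
    obtain e e' where "unitary_coordinates (unitary_matrices (m ^ (d div 2))) 1 (m ^ (d div 2)) (\<lambda>A. \<lambda>k\<in>{..<1}. A) e e'"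
      using unitary_coordinates_matrices by blast
    with U True show ?thesis by (auto intro: lie_isomorphic_if_unitary_coordinates)
  next
    case False
    \<comment> \<open>For odd \<open>d\<close> the exponent in the statement agrees with the one
      used for both parities.\<close>
    then have "(d - 1) div 2 = d div 2" by presburger
    moreover obtain e e' where "unitary_coordinates (unitary_matrices_power m (m ^ (d div 2))) m (m ^ (d div 2)) (\<lambda>A. A) e e'"
      using unitary_coordinates_power by blast
    ultimately show ?thesis using U False by (auto intro: lie_isomorphic_if_unitary_coordinates)
  qed
qed


end
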